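(* Let $\Sigma=(X,\sigma)$ be a topological dynamical system. Suppose $B\subseteq C^*(\Sigma)$ is a $C^*$-subalgebra such that $C(X)\subseteq B\subseteq C(X)'$, and denote by $\Delta$ and $\Gamma$ the spectrum of $B$ and of $C(X)'$, respectively. Then $B$ has the intersection property for ideals of $C^*(\Sigma)$ if and only if for every proper closed subset $S\subsetneq\Gamma$ that is invariant under $\tilde\sigma$ and its inverse, the restriction of $S$ to $B$, i.e. $\{\gamma|_B:\gamma\in S\}$, is a proper subset of $\Delta$.
   Context: A topological dynamical system $\Sigma=(X,\sigma)$ consists of a compact Hausdorff space $X$ and a homeomorphism $\sigma$ of $X$. $C^*(\Sigma)=C(X)\rtimes_\alpha\mathbb{Z}$ is the $C^*$-crossed product for the automorphism $\alpha(f)=f\circ\sigma^{-1}$ of $C(X)$; it is generated by a copy of $C(X)$ and a canonical unitary $\delta$ with $\delta f\delta^*=\alpha(f)$. $C(X)'=\{a\in C^*(\Sigma): af=fa\text{ for all }f\in C(X)\}$; it is a commutative $C^*$-algebra, invariant under $\operatorname{Ad}\delta(a)=\delta a\delta^*$ and its inverse. The spectrum of a commutative $C^*$-algebra is its space of characters. $\tilde\sigma$ is the homeomorphism of $\Gamma$ induced by the restriction of $\operatorname{Ad}\delta$ to $C(X)'$, i.e. $\operatorname{Ad}\delta(F)=F\circ\tilde\sigma^{-1}$ for $F\in C(\Gamma)\cong C(X)'$. $B$ has the intersection property for ideals of $C^*(\Sigma)$ if $J\cap B\ne\{0\}$ for every non-zero two-sided ideal $J$ of $C^*(\Sigma)$,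 not necessarily closed or self-adjoint. *)

theory Defs
  imports "HOL-Analysis.Analysis"
begin

section \<open>C*-algebras\<close>

class cstar_algebra = banach + real_normed_algebra +
  fixes scaleC :: "complex \<Rightarrow> 'a \<Rightarrow> 'a"
    and adj :: "'a \<Rightarrow> 'a"
  assumes scaleC_add_right: "scaleC c (a + b) = scaleC c a + scaleC c b"
    and scaleC_add_left: "scaleC (c + d) a = scaleC c a + scaleC d a"
    and scaleC_scaleC: "scaleC c (scaleC d a) = scaleC (c * d) a"
    and scaleC_of_real: "scaleC (complex_of_real r) a = scaleR r a"
    and norm_scaleC: "norm (scaleC c a) = cmod c * norm a"
    and mult_scaleC_left: "scaleC c a * b = scaleC c (a * b)"
    and mult_scaleC_right: "a * scaleC c b = scaleC c (a * b)"
    and adj_add: "adj (a + b) = adj a + adj b"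
    and adj_scaleC: "adj (scaleC c a) = scaleC (cnj c) (adj a)"
    and adj_mult: "adj (a * b) = adj b * adj a"
    and adj_adj: "adj (adj a) = a"
    and cstar_identity: "norm (adj a * a) = (norm a)\<^sup>2"

text \<open>The unit is not required to differ from zero, so that the crossed product over the
  empty space, which is the zero algebra, is not excluded.\<close>

class unital_cstar_algebra = cstar_algebra + monoid_mult

definition cstar_subalgebra :: "'a::cstar_algebra set \<Rightarrow> bool" where
  "cstar_subalgebra B \<longleftrightarrow>
     0 \<in> B \<and> (\<forall>a\<in>B. \<forall>b\<in>B. a + b \<in> B) \<and> (\<forall>c. \<forall>a\<in>B. scaleC c a \<in> B) \<and>
     (\<forall>a\<in>B. \<forall>b\<in>B. a * b \<in> B) \<and> (\<forall>a\<in>B. adj a \<in> B) \<and> closed B"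

definition two_sided_ideal :: "'a::cstar_algebra set \<Rightarrow> bool" where
  "two_sided_ideal J \<longleftrightarrow>
     0 \<in> J \<and> (\<forall>a\<in>J. \<forall>b\<in>J. a + b \<in> J) \<and> (\<forall>c. \<forall>a\<in>J. scaleC c a \<in> J) \<and>
     (\<forall>x. \<forall>a\<in>J. x * a \<in> J \<and> a * x \<in> J)"

definition intersection_property :: "'a::cstar_algebra set \<Rightarrow> bool" where
  "intersection_property B \<longleftrightarrow> (\<forall>J. two_sided_ideal J \<and> J \<noteq> {0} \<longrightarrow> J \<inter> B \<noteq> {0})"

definition commutant :: "'a::cstar_algebra set \<Rightarrow> 'a set" where
  "commutant F = {a. \<forall>f\<in>F. a * f = f * a}"

text \<open>A character is represented by a function on the whole type that is \<open>undefined\<close> outside the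
  algebra, so that equality of characters is equality on the algebra.\<close>

definition characters :: "'a::cstar_algebra set \<Rightarrow> ('a \<Rightarrow> complex) set" where
  "characters B = {\<gamma> \<in> extensional B.
     (\<forall>a\<in>B. \<forall>b\<in>B. \<gamma> (a + b) = \<gamma> a + \<gamma> b) \<and> (\<forall>c. \<forall>a\<in>B. \<gamma> (scaleC c a) = c * \<gamma> a) \<and>
     (\<forall>a\<in>B. \<forall>b\<in>B. \<gamma> (a * b) = \<gamma> a * \<gamma> b) \<and> (\<exists>a\<in>B. \<gamma> a \<noteq> 0)}"

text \<open>The topology is that of pointwise convergence, i.e. the weak-* topology.\<close>

definition spectrum :: "'a::cstar_algebra set \<Rightarrow> ('a \<Rightarrow> complex) topology" where
  "spectrum B = subtopology (product_topology (\<lambda>_. euclidean) B) (characters B)"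

lemma topspace_spectrum: "topspace (spectrum B) = characters B"
  by (auto simp: spectrum_def characters_def PiE_def)

text \<open>For \<open>D\<close> commutative and invariant under \<open>Ad u\<close> and \<open>Ad u\<^sup>-\<^sup>1\<close>, this is the map
  \<open>\<gamma> \<mapsto> \<gamma> \<circ> (Ad u)\<^sup>-\<^sup>1\<close> on the spectrum of \<open>D\<close>. Writing \<open>a(\<gamma>) = \<gamma>(a)\<close> for the Gelfand transform
  and \<open>\<tau>\<close> for the map, this says \<open>(Ad u (a))(\<tau> \<gamma>) = a(\<gamma>)\<close>, that is, \<open>Ad u (a) = a \<circ> \<tau>\<^sup>-\<^sup>1\<close>;
  see the lemma below.\<close>

definition spectrum_map :: "'a::cstar_algebra \<Rightarrow> 'a set \<Rightarrow> ('a \<Rightarrow> complex) \<Rightarrow> ('a \<Rightarrow> complex)" where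
  "spectrum_map u D \<gamma> = restrict (\<lambda>a. \<gamma> (adj u * a * u)) D"

lemma spectrum_map_Ad:
  fixes u :: "'a::unital_cstar_algebra"
  assumes "adj u * u = 1" and "a \<in> D" and "u * a * adj u \<in> D"
  shows "spectrum_map u D \<gamma> (u * a * adj u) = \<gamma> a"
proof -
  have "adj u * (u * a * adj u) * u = (adj u * u) * a * (adj u * u)"
    by (simp only: mult.assoc)
  then show ?thesis
    using assms by (simp add: spectrum_map_def)
qed


section \<open>Dynamical systems and crossed products by the integers\<close>

locale topological_dynamical_system =
  fixes X :: "'x topology" and \<sigma> :: "'x \<Rightarrow> 'x"
  assumes compact: "compact_space X"
    and Hausdorff: "Hausdorff_space X"
    and homeo: "homeomorphic_map X X \<sigma>"

text \<open>Elements of \<open>C(X)\<close> are extended by zero outside \<open>topspace X\<close>; the unit of \<open>C(X)\<close> is then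
  \<open>indicator (topspace X)\<close>.\<close>

definition CX :: "'x topology \<Rightarrow> ('x \<Rightarrow> complex) set" where
  "CX X = {f. continuous_map X euclidean f \<and> (\<forall>x. x \<notin> topspace X \<longrightarrow> f x = 0)}"

definition iter_int :: "'x topology \<Rightarrow> ('x \<Rightarrow> 'x) \<Rightarrow> int \<Rightarrow> 'x \<Rightarrow> 'x" where
  "iter_int X \<sigma> n =
     (if 0 \<le> n then \<sigma> ^^ nat n else inv_into (topspace X) \<sigma> ^^ nat (- n))"

text \<open>The power \<open>\<alpha>\<^sup>n\<close> of the automorphism \<open>\<alpha>(f) = f \<circ> \<sigma>\<^sup>-\<^sup>1\<close> of \<open>C(X)\<close>.\<close>

definition alpha_pow ::
  "'x topology \<Rightarrow> ('x \<Rightarrow> 'x) \<Rightarrow> int \<Rightarrow> ('x \<Rightarrow> complex) \<Rightarrow> 'x \<Rightarrow> complex" where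
  "alpha_pow X \<sigma> n f = (\<lambda>x. if x \<in> topspace X then f (iter_int X \<sigma> (- n) x) else 0)"

text \<open>The convolution algebra \<open>C\<^sub>c(\<int>, C(X))\<close>: the function \<open>a\<close> stands for the finite formal sum
  of the terms \<open>a\<^sub>n \<delta>\<^sup>n\<close>, and product and involution are those forced by
  \<open>\<delta> f = \<alpha>(f) \<delta>\<close> and \<open>\<delta>\<^sup>* = \<delta>\<^sup>-\<^sup>1\<close>.\<close>

definition conv_carrier :: "'x topology \<Rightarrow> (int \<Rightarrow> 'x \<Rightarrow> complex) set" where
  "conv_carrier X = {a. finite {n. a n \<noteq> (\<lambda>x. 0)} \<and> (\<forall>n. a n \<in> CX X)}"

definition conv_mult ::
  "'x topology \<Rightarrow> ('x \<Rightarrow> 'x) \<Rightarrow> (int \<Rightarrow> 'x \<Rightarrow> complex) \<Rightarrow> (int \<Rightarrow> 'x \<Rightarrow> complex)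
    \<Rightarrow> int \<Rightarrow> 'x \<Rightarrow> complex" where
  "conv_mult X \<sigma> a b =
     (\<lambda>n x. \<Sum>k | a k \<noteq> (\<lambda>x. 0). a k x * alpha_pow X \<sigma> k (b (n - k)) x)"

definition conv_adj ::
  "'x topology \<Rightarrow> ('x \<Rightarrow> 'x) \<Rightarrow> (int \<Rightarrow> 'x \<Rightarrow> complex) \<Rightarrow> int \<Rightarrow> 'x \<Rightarrow> complex" where
  "conv_adj X \<sigma> a = (\<lambda>n x. cnj (alpha_pow X \<sigma> n (a (- n)) x))"

definition cstar_seminorm ::
  "'x topology \<Rightarrow> ('x \<Rightarrow> 'x) \<Rightarrow> ((int \<Rightarrow> 'x \<Rightarrow> complex) \<Rightarrow> real) \<Rightarrow> bool" where
  "cstar_seminorm X \<sigma> p \<longleftrightarrow>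
     (\<forall>a\<in>conv_carrier X. \<forall>b\<in>conv_carrier X.
        p (\<lambda>n x. a n x + b n x) \<le> p a + p b \<and> p (conv_mult X \<sigma> a b) \<le> p a * p b) \<and>
     (\<forall>a\<in>conv_carrier X. (\<forall>c. p (\<lambda>n x. c * a n x) = cmod c * p a) \<and>
        p (conv_mult X \<sigma> (conv_adj X \<sigma> a) a) = (p a)\<^sup>2)"

definition unitary_pow :: "'a::unital_cstar_algebra \<Rightarrow> int \<Rightarrow> 'a" where
  "unitary_pow u n = (if 0 \<le> n then u ^ nat n else adj u ^ nat (- n))"

definition integrated_form ::
  "(('x \<Rightarrow> complex) \<Rightarrow> 'a) \<Rightarrow> 'a \<Rightarrow> (int \<Rightarrow> 'x \<Rightarrow> complex) \<Rightarrow> 'a::unital_cstar_algebra" where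
  "integrated_form \<pi> \<delta> a = (\<Sum>n | a n \<noteq> (\<lambda>x. 0). \<pi> (a n) * unitary_pow \<delta> n)"

text \<open>The C*-algebra \<open>'a\<close>, with the copy \<open>\<pi> ` CX X\<close> of \<open>C(X)\<close> and the unitary \<open>\<delta>\<close>, is the full
  crossed product of \<open>C(X)\<close> by \<open>\<alpha>\<close>: the completion of the convolution algebra in its greatest
  C*-seminorm. The norm of the integrated form of a covariant pair is itself a C*-seminorm on the
  convolution algebra, so \<open>universal\<close> says that it is the greatest one. C*-seminorms on the
  convolution algebra are exactly the seminorms coming from its *-homomorphisms into C*-algebras,
  over which one cannot quantify directly, as they live in arbitrary types.\<close>

locale cstar_crossed_product =
  fixes X :: "'x topology" and \<sigma> :: "'x \<Rightarrow> 'x"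
    and \<pi> :: "('x \<Rightarrow> complex) \<Rightarrow> 'a::unital_cstar_algebra" and \<delta> :: 'a
  assumes pi_add: "\<lbrakk>f \<in> CX X; g \<in> CX X\<rbrakk> \<Longrightarrow> \<pi> (\<lambda>x. f x + g x) = \<pi> f + \<pi> g"
    and pi_scale: "f \<in> CX X \<Longrightarrow> \<pi> (\<lambda>x. c * f x) = scaleC c (\<pi> f)"
    and pi_mult: "\<lbrakk>f \<in> CX X; g \<in> CX X\<rbrakk> \<Longrightarrow> \<pi> (\<lambda>x. f x * g x) = \<pi> f * \<pi> g"
    and pi_adj: "f \<in> CX X \<Longrightarrow> \<pi> (\<lambda>x. cnj (f x)) = adj (\<pi> f)"
    and pi_one: "\<pi> (indicator (topspace X)) = 1"
    and pi_inj: "inj_on \<pi> (CX X)"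
    and unitary: "adj \<delta> * \<delta> = 1" "\<delta> * adj \<delta> = 1"
    and covariant: "f \<in> CX X \<Longrightarrow> \<delta> * \<pi> f * adj \<delta> = \<pi> (alpha_pow X \<sigma> 1 f)"
    and dense: "closure (integrated_form \<pi> \<delta> ` conv_carrier X) = UNIV"
    and universal: "\<lbrakk>cstar_seminorm X \<sigma> p; a \<in> conv_carrier X\<rbrakk>
          \<Longrightarrow> p a \<le> norm (integrated_form \<pi> \<delta> a)"

end

theory Submission
  imports Defs
begin

text \<open>
  Write \<open>C'\<close> for the commutant of \<open>C(X)\<close> and \<open>\<Gamma>\<close>, \<open>\<Delta>\<close> for the spectra of \<open>C'\<close> and \<open>B\<close>. Ideals of the crossed
  product and closed invariant subsets of \<open>\<Gamma>\<close> correspond loosely to each other: an ideal \<open>J\<close> has a zero set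
  \<open>S\<close>, the common zeros of \<open>J \<inter> C'\<close>, and a set \<open>S\<close> has an ideal \<open>J\<close>, the largest one contained in all the left
  ideals generated by the kernels of the characters in \<open>S\<close>. The ideal \<open>J\<close> meets \<open>B\<close> in zero just if the
  characters in \<open>S\<close> restrict to all characters of \<open>B\<close>.

  One implication starts from an invariant \<open>S\<close>. Its ideal contains every element of \<open>C'\<close> that vanishes on \<open>S\<close>,
  because conjugation by the unitary translates along \<open>S\<close>, and every element of \<open>C'\<close> in it vanishes on \<open>S\<close>
  (\<open>restriction_proper_if_intersection_property\<close>). The other one starts from an ideal \<open>J\<close>. The crucial point is
  that \<open>S\<close> is a proper subset of \<open>\<Gamma>\<close>, that is, \<open>C'\<close> itself has the intersection property
  (\<open>ideal_meets_commutant\<close>): compressing an element of \<open>J\<close> by a bump function that is concentrated on a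
  sufficiently small open set moves it close to \<open>C'\<close>. An ideal that comes close to an element of a
  commutative subalgebra, relative to its norm, meets this subalgebra (\<open>ideal_near_element_meets\<close>); this
  deals at the same time with ideals that are not closed.

  Two bodies of theory are built up for this. For commutative C*-algebras there are enough characters
  (\<open>exists_character\<close>, \<open>exists_norming_character\<close>) and there is a functional calculus. The characters arise as
  minimal C*-seminorms: minimality makes a C*-seminorm multiplicative, and a multiplicative one is the modulus of
  a character by Ostrowski's elementary argument. For the crossed product, the universal property provides
  the gauge action, and averaging over it yields Fourier coefficients and Fejer means
  (\<open>fejer_mean_tendsto\<close>). They show that \<open>C'\<close> is commutative (\<open>commutant_commutative\<close>) and that a non-zero
  element has a non-zero coefficient.
\<close>

section \<open>Elementary facts on C*-algebras\<close>

lemma scaleC_one [simp]: "scaleC 1 (a::'a::cstar_algebra) = a"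
  using scaleC_of_real[of 1 a] by simp

lemma scaleC_zero_left [simp]: "scaleC 0 (a::'a::cstar_algebra) = 0"
  using scaleC_of_real[of 0 a] by simp

lemma scaleC_zero_right [simp]: "scaleC c (0::'a::cstar_algebra) = 0"
  using norm_scaleC[of c "0::'a"] by simp

lemma scaleC_minus_one: "scaleC (- 1) (a::'a::cstar_algebra) = - a"
  using scaleC_of_real[of "- 1" a] by simp

lemma scaleC_minus_left: "scaleC (- c) (a::'a::cstar_algebra) = - scaleC c a"
  using scaleC_add_left[of "- c" c a] by (simp add: eq_neg_iff_add_eq_0)

lemma scaleC_diff_left: "scaleC (c - d) (a::'a::cstar_algebra) = scaleC c a - scaleC d a"
  using scaleC_add_left[of c "- d" a] by (simp add: scaleC_minus_left)

lemma scaleC_minus_right: "scaleC c (- a) = - scaleC c (a::'a::cstar_algebra)"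
  using scaleC_add_right[of c "- a" a] by (simp add: eq_neg_iff_add_eq_0)

lemma scaleC_diff_right: "scaleC c (a - b) = scaleC c a - scaleC c (b::'a::cstar_algebra)"
  using scaleC_add_right[of c a "- b"] by (simp add: scaleC_minus_right)

lemma scaleC_sum_right: "scaleC c (\<Sum>i\<in>I. f i) = (\<Sum>i\<in>I. scaleC c (f i :: 'a::cstar_algebra))"
  by (induction I rule: infinite_finite_induct) (simp_all add: scaleC_add_right)

lemma scaleC_sum_left: "scaleC (\<Sum>i\<in>I. f i) (a::'a::cstar_algebra) = (\<Sum>i\<in>I. scaleC (f i) a)"
  by (induction I rule: infinite_finite_induct) (simp_all add: scaleC_add_left)

lemma adj_zero [simp]: "adj (0::'a::cstar_algebra) = 0"
  using adj_scaleC[of 0 "0::'a"] by simp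

lemma adj_minus: "adj (- a) = - adj (a::'a::cstar_algebra)"
  using adj_scaleC[of "- 1" a] by (simp add: scaleC_minus_one)

lemma adj_diff: "adj (a - b) = adj a - adj (b::'a::cstar_algebra)"
  using adj_add[of a "- b"] by (simp add: adj_minus)

lemma adj_sum: "adj (\<Sum>i\<in>I. f i) = (\<Sum>i\<in>I. adj (f i :: 'a::cstar_algebra))"
  by (induction I rule: infinite_finite_induct) (simp_all add: adj_add)

lemma adj_one [simp]: "adj (1::'a::unital_cstar_algebra) = 1"
  by (metis adj_adj adj_mult mult_1_right)

lemma adj_power: "adj (a ^ n) = adj (a::'a::unital_cstar_algebra) ^ n"
  by (induction n) (simp_all add: adj_mult power_commutes)

lemma norm_adj [simp]: "norm (adj a) = norm (a::'a::cstar_algebra)"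
proof -
  have le: "norm b \<le> norm (adj b)" for b :: 'a
  proof (cases "b = 0")
    case False
    have "norm b * norm b \<le> norm (adj b) * norm b"
      using cstar_identity[of b] norm_mult_ineq[of "adj b" b] by (simp add: power2_eq_square)
    with False show ?thesis by simp
  qed simp
  show ?thesis using le[of a] le[of "adj a"] by (simp add: adj_adj)
qed

lemma norm_one_le: "norm (1::'a::unital_cstar_algebra) \<le> 1"
proof -
  have "norm (1::'a) * norm (1::'a) = norm (1::'a)"
    using cstar_identity[of "1::'a"] by (simp add: power2_eq_square)
  then show ?thesis by (cases "norm (1::'a) = 0") auto
qed

lemma norm_one_if_nonzero:
  fixes x :: "'a::unital_cstar_algebra"
  assumes "x \<noteq> 0" shows "norm (1::'a) = 1"
proof -
  have "(1::'a) \<noteq> 0"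
  proof
    assume "(1::'a) = 0"
    then have "1 * x = 0" by (simp only: mult_zero_left)
    with assms show False by simp
  qed
  moreover have "norm (1::'a) * norm (1::'a) = norm (1::'a)"
    using cstar_identity[of "1::'a"] by (simp add: power2_eq_square)
  ultimately show ?thesis by simp
qed

lemma norm_power_le: "norm (x ^ n) \<le> norm (x::'a::unital_cstar_algebra) ^ n"
proof (induction n)
  case (Suc n)
  have "norm (x ^ Suc n) \<le> norm x * norm (x ^ n)"
    by (simp add: norm_mult_ineq)
  also have "\<dots> \<le> norm x * norm x ^ n"
    using Suc by (intro mult_left_mono) auto
  finally show ?case by simp
qed (simp add: norm_one_le)

lemma cstar_subalgebraD:
  assumes "cstar_subalgebra B"
  shows "0 \<in> B" "\<And>a b. \<lbrakk>a \<in> B; b \<in> B\<rbrakk> \<Longrightarrow> a + b \<in> B" "\<And>c a. a \<in> B \<Longrightarrow> scaleC c a \<in> B"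
    "\<And>a b. \<lbrakk>a \<in> B; b \<in> B\<rbrakk> \<Longrightarrow> a * b \<in> B" "\<And>a. a \<in> B \<Longrightarrow> adj a \<in> B" "closed B"
  using assms by (auto simp: cstar_subalgebra_def)

lemma cstar_subalgebra_minus:
  assumes "cstar_subalgebra B" "b \<in> B"
  shows "- b \<in> B" "a \<in> B \<Longrightarrow> a - b \<in> B"
  using cstar_subalgebraD(2)[OF assms(1), of a "- b"] cstar_subalgebraD(3)[OF assms, of "- 1"]
  by (simp_all add: scaleC_minus_one)

lemma two_sided_idealD:
  assumes "two_sided_ideal J"
  shows "0 \<in> J" "\<And>a b. \<lbrakk>a \<in> J; b \<in> J\<rbrakk> \<Longrightarrow> a + b \<in> J" "\<And>c a. a \<in> J \<Longrightarrow> scaleC c a \<in> J"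
    "\<And>x a. a \<in> J \<Longrightarrow> x * a \<in> J" "\<And>x a. a \<in> J \<Longrightarrow> a * x \<in> J"
  using assms by (auto simp: two_sided_ideal_def)

lemma two_sided_ideal_minus: "\<lbrakk>two_sided_ideal J; a \<in> J\<rbrakk> \<Longrightarrow> - a \<in> J"
  using two_sided_idealD(3)[of J a "- 1"] by (simp add: scaleC_minus_one)

lemma power_mem:
  fixes x :: "'a::unital_cstar_algebra"
  assumes "cstar_subalgebra D" "1 \<in> D" "x \<in> D"
  shows "x ^ n \<in> D"
  by (induction n) (auto simp: assms cstar_subalgebraD[OF assms(1)])

lemma sum_mem:
  assumes "cstar_subalgebra B" "\<And>i. i \<in> I \<Longrightarrow> f i \<in> B" shows "sum f I \<in> B"
  using assms(2) by (induction I rule: infinite_finite_induct) (auto simp: cstar_subalgebraD[OF assms(1)])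

text \<open>The Neumann series, which stays inside the closed subalgebra.\<close>

lemma neumann_inverse:
  fixes x :: "'a::unital_cstar_algebra"
  assumes D: "cstar_subalgebra D" "1 \<in> D" and x: "x \<in> D" "norm x < 1"
  obtains y where "y \<in> D" "(1 - x) * y = 1"
proof -
  have s: "summable (\<lambda>n. x ^ n)"
    by (rule summable_comparison_test'[OF summable_geometric[of "norm x"]])
       (use x norm_power_le in auto)
  define y where "y = (\<Sum>n. x ^ n)"
  have "x * y = (\<Sum>n. x * x ^ n)"
    unfolding y_def using s by (rule suminf_mult[symmetric])
  also have "\<dots> = y - 1"
    using suminf_split_head[OF s] by (simp add: y_def)
  finally have "(1 - x) * y = 1" by (simp add: left_diff_distrib)
  moreover have "y \<in> D"
  proof (rule closed_sequentially[where f = "\<lambda>n. \<Sum>i<n. x ^ i"])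
    show "closed D" using D by (simp add: cstar_subalgebraD)
    show "(\<lambda>n. \<Sum>i<n. x ^ i) \<longlonglongrightarrow> y"
      unfolding y_def using s by (rule summable_LIMSEQ)
    have "(\<Sum>i<n. x ^ i) \<in> D" for n
      by (induction n) (auto simp: cstar_subalgebraD[OF D(1)] power_mem[OF D x(1)])
    then show "\<And>n. (\<Sum>i<n. x ^ i) \<in> D" .
  qed
  ultimately show thesis using that by blast
qed

lemma charactersD:
  assumes "\<gamma> \<in> characters B"
  shows "\<gamma> \<in> extensional B" "\<And>a b. \<lbrakk>a \<in> B; b \<in> B\<rbrakk> \<Longrightarrow> \<gamma> (a + b) = \<gamma> a + \<gamma> b"
    "\<And>c a. a \<in> B \<Longrightarrow> \<gamma> (scaleC c a) = c * \<gamma> a"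
    "\<And>a b. \<lbrakk>a \<in> B; b \<in> B\<rbrakk> \<Longrightarrow> \<gamma> (a * b) = \<gamma> a * \<gamma> b" "\<exists>a\<in>B. \<gamma> a \<noteq> 0"
  using assms by (auto simp: characters_def)

locale commutative_cstar_subalgebra =
  fixes D :: "'a::unital_cstar_algebra set"
  assumes subalgebra: "cstar_subalgebra D"
    and one_mem [simp, intro]: "1 \<in> D"
    and commute: "\<lbrakk>a \<in> D; b \<in> D\<rbrakk> \<Longrightarrow> a * b = b * a"
begin

lemmas mem [simp, intro] = cstar_subalgebraD(1-5)[OF subalgebra] cstar_subalgebra_minus[OF subalgebra]

lemma closed: "closed D" by (rule cstar_subalgebraD(6)[OF subalgebra])

lemma power_mem' [simp, intro]: "x \<in> D \<Longrightarrow> x ^ n \<in> D"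
  by (rule power_mem[OF subalgebra one_mem])

lemma left_commute: "\<lbrakk>a \<in> D; b \<in> D\<rbrakk> \<Longrightarrow> a * (b * c) = b * (a * c)"
  by (metis commute mult.assoc)

context
  fixes \<gamma> assumes \<gamma>: "\<gamma> \<in> characters D"
begin

lemmas character_simps = charactersD(2-4)[OF \<gamma>]

lemma character_zero: "\<gamma> 0 = 0"
  using character_simps(2)[of 0 0] by auto

lemma character_one: "\<gamma> 1 = 1"
proof -
  obtain a where "a \<in> D" "\<gamma> a \<noteq> 0" using charactersD(5)[OF \<gamma>] by blast
  moreover have "\<gamma> (a * 1) = \<gamma> a * \<gamma> 1" by (rule character_simps(3)) (use \<open>a \<in> D\<close> in auto)
  ultimately show ?thesis by simp
qed

lemma character_minus: "a \<in> D \<Longrightarrow> \<gamma> (- a) = - \<gamma> a"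
  using character_simps(2)[of a "- 1"] by (simp add: scaleC_minus_one)

lemma character_diff: "\<lbrakk>a \<in> D; b \<in> D\<rbrakk> \<Longrightarrow> \<gamma> (a - b) = \<gamma> a - \<gamma> b"
  using character_simps(1)[of a "- b"] by (simp add: character_minus)

lemma character_power: "a \<in> D \<Longrightarrow> \<gamma> (a ^ n) = \<gamma> a ^ n"
  by (induction n) (auto simp: character_one character_simps)

lemma character_sum: "(\<And>i. i \<in> I \<Longrightarrow> f i \<in> D) \<Longrightarrow> \<gamma> (\<Sum>i\<in>I. f i) = (\<Sum>i\<in>I. \<gamma> (f i)) \<and> (\<Sum>i\<in>I. f i) \<in> D"
  by (induction I rule: infinite_finite_induct) (auto simp: character_zero character_simps)

text \<open>A value larger than the norm could be scaled to \<open>1\<close> at an element \<open>z\<close> with \<open>norm z < 1\<close>; but then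
  \<open>1 - z\<close> is invertible and has value \<open>0\<close>.\<close>

lemma character_norm_le:
  assumes "x \<in> D" shows "cmod (\<gamma> x) \<le> norm x"
proof (rule ccontr)
  assume "\<not> ?thesis"
  then have lt: "norm x < cmod (\<gamma> x)" by simp
  then have nz: "\<gamma> x \<noteq> 0" by auto
  define z where "z = scaleC (1 / \<gamma> x) x"
  have z: "z \<in> D" "norm z < 1" "\<gamma> z = 1"
    using assms lt nz by (auto simp: z_def norm_scaleC norm_divide character_simps)
  obtain y where y: "y \<in> D" "(1 - z) * y = 1"
    using neumann_inverse[OF subalgebra one_mem z(1,2)] .
  have "\<gamma> ((1 - z) * y) = 0"
    using z y(1) by (simp add: character_simps character_diff character_one)
  with y(2) character_one show False by simp
qed

lemma character_selfadj:
  assumes "x \<in> D" "adj x = x" shows "Im (\<gamma> x) = 0"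
proof (rule ccontr)
  assume nz: "Im (\<gamma> x) \<noteq> 0"
  define b where "b = Im (\<gamma> x)"
  \<comment> \<open>Adding \<open>\<i>t\<close> moves the value by \<open>t\<close> but raises the squared norm by at most \<open>t\<^sup>2\<close>, so that the
    term linear in \<open>t\<close> has to vanish.\<close>
  have ineq: "(b + t)\<^sup>2 \<le> (norm x)\<^sup>2 + t\<^sup>2" for t :: real
  proof -
    define w where "w = x + scaleC (\<i> * t) 1"
    have w: "w \<in> D" using assms by (auto simp: w_def)
    have "adj w * w = (x - scaleC (\<i> * t) 1) * (x + scaleC (\<i> * t) 1)"
      by (simp add: w_def adj_add adj_scaleC assms scaleC_minus_left)
    also have "\<dots> = x * x + scaleC (t\<^sup>2) 1"
      by (simp add: distrib_left distrib_right left_diff_distrib right_diff_distrib mult_scaleC_left mult_scaleC_right scaleC_scaleC power2_eq_square scaleC_minus_left)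
         (simp add: scaleC_diff_right scaleC_scaleC scaleC_minus_left algebra_simps)
    finally have "(norm w)\<^sup>2 = norm (x * x + scaleC (t\<^sup>2) 1)"
      by (metis cstar_identity)
    also have "\<dots> \<le> norm (x * x) + norm (scaleC (t\<^sup>2) (1::'a))" by (rule norm_triangle_ineq)
    also have "\<dots> \<le> (norm x)\<^sup>2 + t\<^sup>2"
      using norm_mult_ineq[of x x] mult_left_mono[OF norm_one_le[where ?'a='a], of "t\<^sup>2"] 
      by (simp add: norm_scaleC power2_eq_square norm_mult)
    finally have 1: "(norm w)\<^sup>2 \<le> (norm x)\<^sup>2 + t\<^sup>2" .
    have "b + t = Im (\<gamma> w)"
      using assms by (simp add: w_def character_simps character_one b_def)
    then have "\<bar>b + t\<bar> \<le> norm w"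
      using character_norm_le[OF w] abs_Im_le_cmod[of "\<gamma> w"] by simp
    then have "(b + t)\<^sup>2 \<le> (norm w)\<^sup>2" by (metis abs_ge_zero power2_abs power_mono)
    with 1 show ?thesis by simp
  qed
  have "b\<^sup>2 + 2 * b * t \<le> (norm x)\<^sup>2" for t
    using ineq[of t] by (simp add: power2_sum)
  from this[of "((norm x)\<^sup>2 + 1) / (2 * b)"] nz
  have "b\<^sup>2 + ((norm x)\<^sup>2 + 1) \<le> (norm x)\<^sup>2" by (simp add: b_def)
  then show False using zero_le_power2[of b] by linarith
qed

lemma character_adj:
  assumes "x \<in> D" shows "\<gamma> (adj x) = cnj (\<gamma> x)"
proof -
  have 1: "Im (\<gamma> (x + adj x)) = 0"
    using assms by (intro character_selfadj) (auto simp: adj_add adj_adj add.commute)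
  have 2: "Im (\<gamma> (scaleC \<i> (x - adj x))) = 0"
    using assms by (intro character_selfadj) (auto simp: adj_scaleC adj_diff adj_adj scaleC_minus_left scaleC_diff_right)
  show ?thesis using 1 2 assms by (simp add: character_simps character_diff complex_eq_iff)
qed

lemma character_square:
  assumes "x \<in> D" shows "\<gamma> (adj x * x) = (cmod (\<gamma> x))\<^sup>2"
  using assms by (simp add: character_simps character_adj complex_norm_square[symmetric] mult.commute)

end

end

section \<open>Existence of characters\<close>

context commutative_cstar_subalgebra
begin

text \<open>C*-seminorms on the subalgebra. Being zero outside of it makes the pointwise order antisymmetric,
  as Zorn's lemma demands.\<close>

definition seminorm :: "('a \<Rightarrow> real) \<Rightarrow> bool" where
  "seminorm p \<longleftrightarrow> (\<forall>x. x \<notin> D \<longrightarrow> p x = 0) \<and> p 1 = 1 \<and>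
     (\<forall>x\<in>D. \<forall>y\<in>D. p (x + y) \<le> p x + p y \<and> p (x * y) \<le> p x * p y) \<and>
     (\<forall>x\<in>D. (\<forall>c. p (scaleC c x) = cmod c * p x) \<and> p (adj x) = p x \<and> (p x)\<^sup>2 \<le> p (adj x * x))"

lemma seminorm_basic:
  assumes "seminorm p"
  shows "\<And>x. x \<notin> D \<Longrightarrow> p x = 0" "p 1 = 1" "\<And>x y. \<lbrakk>x \<in> D; y \<in> D\<rbrakk> \<Longrightarrow> p (x + y) \<le> p x + p y"
    "\<And>x y. \<lbrakk>x \<in> D; y \<in> D\<rbrakk> \<Longrightarrow> p (x * y) \<le> p x * p y"
    "\<And>c x. x \<in> D \<Longrightarrow> p (scaleC c x) = cmod c * p x"
    "\<And>x. x \<in> D \<Longrightarrow> p (adj x) = p x"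
  using assms by (auto simp: seminorm_def)

lemma seminorm_derived:
  assumes "seminorm p"
  shows "\<And>x. x \<in> D \<Longrightarrow> p (adj x * x) = (p x)\<^sup>2" "\<And>x. x \<in> D \<Longrightarrow> 0 \<le> p x" "p 0 = 0"
    "\<And>x. x \<in> D \<Longrightarrow> p (- x) = p x" "\<And>x y. \<lbrakk>x \<in> D; y \<in> D\<rbrakk> \<Longrightarrow> p (x - y) \<le> p x + p y"
proof -
  note 1 = seminorm_basic[OF assms]
  show "p (adj x * x) = (p x)\<^sup>2" if "x \<in> D" for x
    using assms 1(4)[of "adj x" x] 1(6)[of x] that by (fastforce simp: seminorm_def power2_eq_square)
  show m: "p (- x) = p x" if "x \<in> D" for x
    using 1(5)[OF that, of "- 1"] by (simp add: scaleC_minus_one)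
  show z: "p 0 = 0"
    using 1(5)[of 0 0] by simp
  show "0 \<le> p x" if "x \<in> D" for x
    using 1(3)[of x "- x"] that m[OF that] z by auto
  show "p (x - y) \<le> p x + p y" if "x \<in> D" "y \<in> D" for x y
    using 1(3)[of x "- y"] that m[OF that(2)] by simp
qed

lemmas seminormD = seminorm_basic seminorm_derived

text \<open>Both constructions of new seminorms, localization and the infimum of a chain, are infima of
  families that need not consist of C*-seminorms themselves. What makes the infimum one is that any
  two members are dominated by a third in the sense of the last hypothesis.\<close>

lemma seminorm_directed_Inf:
  assumes ne: "\<Phi> \<noteq> {}"
    and nonneg: "\<And>\<phi> x. \<lbrakk>\<phi> \<in> \<Phi>; x \<in> D\<rbrakk> \<Longrightarrow> 0 \<le> \<phi> x" and one: "\<And>\<phi>. \<phi> \<in> \<Phi> \<Longrightarrow> \<phi> 1 = 1"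
    and hom: "\<And>\<phi> x c. \<lbrakk>\<phi> \<in> \<Phi>; x \<in> D\<rbrakk> \<Longrightarrow> \<phi> (scaleC c x) = cmod c * \<phi> x"
    and star: "\<And>\<phi> x. \<lbrakk>\<phi> \<in> \<Phi>; x \<in> D\<rbrakk> \<Longrightarrow> \<phi> (adj x) = \<phi> x"
    and square: "\<And>\<phi> x. \<lbrakk>\<phi> \<in> \<Phi>; x \<in> D\<rbrakk> \<Longrightarrow> (\<phi> x)\<^sup>2 \<le> \<phi> (adj x * x)"
    and directed: "\<And>\<phi> \<psi>. \<lbrakk>\<phi> \<in> \<Phi>; \<psi> \<in> \<Phi>\<rbrakk> \<Longrightarrow> \<exists>\<eta>\<in>\<Phi>. \<forall>x\<in>D. \<forall>y\<in>D.
                    \<eta> (x + y) \<le> \<phi> x + \<psi> y \<and> \<eta> (x * y) \<le> \<phi> x * \<psi> y"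
  shows "seminorm (\<lambda>x. if x \<in> D then INF \<phi>\<in>\<Phi>. \<phi> x else 0)" (is "seminorm ?p")
proof -
  have lower: "?p x \<le> \<phi> x" if "\<phi> \<in> \<Phi>" "x \<in> D" for \<phi> x
    using that nonneg by (auto intro!: cINF_lower bdd_belowI[where m = 0])
  have greatest: "c \<le> ?p x" if "\<And>\<phi>. \<phi> \<in> \<Phi> \<Longrightarrow> c \<le> \<phi> x" "x \<in> D" for c x
    using that ne by (auto intro!: cINF_greatest)
  have nonneg': "0 \<le> ?p x" if "x \<in> D" for x
    using that nonneg by (intro greatest) auto
  have greatest_mult: "c \<le> a * ?p x" if c: "\<And>\<phi>. \<phi> \<in> \<Phi> \<Longrightarrow> c \<le> a * \<phi> x" and "0 \<le> a" "x \<in> D" for a c x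
  proof (cases "a = 0")
    case True
    then show ?thesis using c ne by auto
  next
    case False
    then have "c / a \<le> ?p x"
      using that by (intro greatest) (auto simp: field_simps)
    then show ?thesis using False \<open>0 \<le> a\<close> by (auto simp: field_simps)
  qed
  have add: "?p (x + y) \<le> ?p x + ?p y" if "x \<in> D" "y \<in> D" for x y
  proof -
    have "?p (x + y) \<le> \<phi> x + \<psi> y" if \<phi>\<psi>: "\<phi> \<in> \<Phi>" "\<psi> \<in> \<Phi>" for \<phi> \<psi>
    proof -
      obtain \<eta> where "\<eta> \<in> \<Phi>" "\<eta> (x + y) \<le> \<phi> x + \<psi> y"
        using directed[OF \<phi>\<psi>] \<open>x \<in> D\<close> \<open>y \<in> D\<close> by blast
      then show ?thesis using lower[of \<eta> "x + y"] \<open>x \<in> D\<close> \<open>y \<in> D\<close> by simp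
    qed
    note sum_le = this
    have 1: "?p (x + y) - \<phi> x \<le> ?p y" if "\<phi> \<in> \<Phi>" for \<phi>
    proof (rule greatest)
      show "?p (x + y) - \<phi> x \<le> \<psi> y" if "\<psi> \<in> \<Phi>" for \<psi>
        using sum_le[OF \<open>\<phi> \<in> \<Phi>\<close> that] by linarith
    qed fact
    have "?p (x + y) - ?p y \<le> ?p x"
    proof (rule greatest)
      show "?p (x + y) - ?p y \<le> \<phi> x" if "\<phi> \<in> \<Phi>" for \<phi>
        using 1[OF that] by linarith
    qed fact
    then show ?thesis by linarith
  qed
  have mult: "?p (x * y) \<le> ?p x * ?p y" if "x \<in> D" "y \<in> D" for x y
  proof -
    have "?p (x * y) \<le> \<phi> x * \<psi> y" if \<phi>\<psi>: "\<phi> \<in> \<Phi>" "\<psi> \<in> \<Phi>" for \<phi> \<psi>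
    proof -
      obtain \<eta> where "\<eta> \<in> \<Phi>" "\<eta> (x * y) \<le> \<phi> x * \<psi> y"
        using directed[OF \<phi>\<psi>] \<open>x \<in> D\<close> \<open>y \<in> D\<close> by blast
      then show ?thesis using lower[of \<eta> "x * y"] \<open>x \<in> D\<close> \<open>y \<in> D\<close> by simp
    qed
    then have "?p (x * y) \<le> \<phi> x * ?p y" if "\<phi> \<in> \<Phi>" for \<phi>
      using that \<open>y \<in> D\<close> nonneg \<open>x \<in> D\<close> by (intro greatest_mult) auto
    then have "?p (x * y) \<le> ?p y * \<phi> x" if "\<phi> \<in> \<Phi>" for \<phi>
      using that by (simp add: mult.commute)
    then have "?p (x * y) \<le> ?p y * ?p x" 
      using nonneg'[of y] that by (intro greatest_mult) auto
    then show ?thesis by (simp add: mult.commute)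
  qed
  have hom': "?p (scaleC c x) = cmod c * ?p x" if "x \<in> D" for c x
  proof (rule antisym)
    have "?p (scaleC c x) \<le> cmod c * \<phi> x" if "\<phi> \<in> \<Phi>" for \<phi>
      using lower[OF that, of "scaleC c x"] hom[OF that \<open>x \<in> D\<close>, of c] \<open>x \<in> D\<close> by auto
    then show "?p (scaleC c x) \<le> cmod c * ?p x" using that by (intro greatest_mult) auto
    have "cmod c * ?p x \<le> \<phi> (scaleC c x)" if "\<phi> \<in> \<Phi>" for \<phi>
      using mult_left_mono[OF lower[OF that \<open>x \<in> D\<close>], of "cmod c"] hom[OF that \<open>x \<in> D\<close>, of c] by auto
    then show "cmod c * ?p x \<le> ?p (scaleC c x)" using that by (intro greatest) auto
  qed
  have square': "(?p x)\<^sup>2 \<le> ?p (adj x * x)" if "x \<in> D" for x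
  proof (rule greatest)
    fix \<phi> assume \<phi>: "\<phi> \<in> \<Phi>"
    have "(?p x)\<^sup>2 \<le> (\<phi> x)\<^sup>2"
      using lower[OF \<phi> that] nonneg'[OF that] by (intro power_mono) auto
    then show "(?p x)\<^sup>2 \<le> \<phi> (adj x * x)" using square[OF \<phi> that] by simp
  qed (use that in auto)
  have star': "?p (adj x) = ?p x" if "x \<in> D" for x
  proof -
    have "(INF \<phi>\<in>\<Phi>. \<phi> (adj x)) = (INF \<phi>\<in>\<Phi>. \<phi> x)"
      using star that by (intro INF_cong) auto
    then show ?thesis using that by simp
  qed
  have one': "?p 1 = 1"
  proof -
    have "(INF \<phi>\<in>\<Phi>. \<phi> 1) = (INF \<phi>\<in>\<Phi>. 1)" using one by (intro INF_cong) auto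
    then show ?thesis using ne by simp
  qed
  show ?thesis
    unfolding seminorm_def
    by (intro conjI allI ballI impI add mult hom' square' star' one') auto
qed

text \<open>If \<open>p\<close> is the supremum norm over a closed set of points, then \<open>q\<close> is the supremum norm over those
  points at which all elements of \<open>E\<close> have modulus \<open>1\<close>. The C*-identity survives because
  \<open>p (x * e)\<^sup>2 = p (adj x * x * e * e) \<le> p (adj x * x * e)\<close>.\<close>

lemma seminorm_localize:
  assumes p: "seminorm p" and ne: "E \<noteq> {}"
    and E: "\<And>e. e \<in> E \<Longrightarrow> e \<in> D \<and> adj e = e \<and> p e = 1"
    and mult: "\<And>e f. \<lbrakk>e \<in> E; f \<in> E\<rbrakk> \<Longrightarrow> e * f \<in> E"
    and q_def: "q = (\<lambda>x. if x \<in> D then INF e\<in>E. p (x * e) else 0)"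
  shows "seminorm q" "\<And>x e. \<lbrakk>x \<in> D; e \<in> E\<rbrakk> \<Longrightarrow> q x \<le> p (x * e)"
    "\<And>x. x \<in> D \<Longrightarrow> q x \<le> p x" "\<And>x e. \<lbrakk>x \<in> D; e \<in> E\<rbrakk> \<Longrightarrow> q (x * e) = q x"
proof -
  note P = seminormD[OF p]
  define \<Phi> where "\<Phi> = (\<lambda>e x. p (x * e)) ` E"
  have shrink: "p (x * e) \<le> p x" if "x \<in> D" "e \<in> E" for x e
    using P(4)[of x e] E[OF that(2)] that by simp
  have "seminorm (\<lambda>x. if x \<in> D then INF \<phi>\<in>\<Phi>. \<phi> x else 0)"
  proof (rule seminorm_directed_Inf)
    show "\<Phi> \<noteq> {}" using ne by (simp add: \<Phi>_def)
  next
    fix \<phi> x assume "\<phi> \<in> \<Phi>" and x: "x \<in> D"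
    then obtain e where e: "e \<in> E" and \<phi>: "\<phi> = (\<lambda>x. p (x * e))" by (auto simp: \<Phi>_def)
    note Ee = E[OF e]
    show "0 \<le> \<phi> x" using Ee x P(8) by (simp add: \<phi>)
    show "\<phi> (scaleC c x) = cmod c * \<phi> x" for c
      using Ee x P(5)[of "x * e" c] by (simp add: \<phi> mult_scaleC_left)
    show "\<phi> (adj x) = \<phi> x"
      using Ee x P(6)[of "x * e"] by (simp add: \<phi> adj_mult commute)
    have "(\<phi> x)\<^sup>2 = p (adj (x * e) * (x * e))"
      using Ee x P(7)[of "x * e"] by (simp add: \<phi>)
    also have "adj (x * e) * (x * e) = (adj x * x * e) * e"
      using Ee x by (simp add: adj_mult mult.assoc left_commute[of e "adj x"] left_commute[of e x])
    also have "p ((adj x * x * e) * e) \<le> p (adj x * x * e)"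
      using Ee x e by (intro shrink) auto
    finally show "(\<phi> x)\<^sup>2 \<le> \<phi> (adj x * x)" by (simp add: \<phi>)
  next
    fix \<phi> assume "\<phi> \<in> \<Phi>"
    then obtain e where e: "e \<in> E" and \<phi>: "\<phi> = (\<lambda>x. p (x * e))" by (auto simp: \<Phi>_def)
    then show "\<phi> 1 = 1" using E by simp
  next
    fix \<phi> \<psi> assume "\<phi> \<in> \<Phi>" "\<psi> \<in> \<Phi>"
    then obtain e f where e: "e \<in> E" "f \<in> E"
      and \<phi>: "\<phi> = (\<lambda>x. p (x * e))" "\<psi> = (\<lambda>x. p (x * f))" by (auto simp: \<Phi>_def)
    note Ee = E[OF e(1)] E[OF e(2)]
    show "\<exists>\<eta>\<in>\<Phi>. \<forall>x\<in>D. \<forall>y\<in>D. \<eta> (x + y) \<le> \<phi> x + \<psi> y \<and> \<eta> (x * y) \<le> \<phi> x * \<psi> y"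
    proof (intro bexI ballI conjI)
      fix x y assume xy: "x \<in> D" "y \<in> D"
      have "(x + y) * (e * f) = x * e * f + y * f * e"
        using Ee by (simp add: distrib_right mult.assoc commute)
      also have "p (x * e * f + y * f * e) \<le> p (x * e * f) + p (y * f * e)"
        using Ee xy by (intro P) auto
      also have "\<dots> \<le> p (x * e) + p (y * f)"
        using Ee xy e by (intro add_mono shrink) auto
      finally show "p ((x + y) * (e * f)) \<le> \<phi> x + \<psi> y" by (simp add: \<phi>)
      have "x * y * (e * f) = x * e * (y * f)"
        using Ee xy by (simp add: mult.assoc left_commute[of y e])
      then show "p (x * y * (e * f)) \<le> \<phi> x * \<psi> y"
        using Ee xy P(4)[of "x * e" "y * f"] by (simp add: \<phi>)
    next
      show "(\<lambda>x. p (x * (e * f))) \<in> \<Phi>" using e mult by (auto simp: \<Phi>_def)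
    qed
  qed
  then show "seminorm q" by (simp add: \<Phi>_def q_def image_image cong: if_cong)
  show lower: "q x \<le> p (x * e)" if "x \<in> D" "e \<in> E" for x e
    unfolding q_def using that E P(8) by (auto intro!: cINF_lower bdd_belowI[where m = 0])
  show "q x \<le> p x" if "x \<in> D" for x
    using ne lower[OF that] shrink[OF that] by fastforce
  have greatest: "c \<le> q x" if "\<And>e. e \<in> E \<Longrightarrow> c \<le> p (x * e)" "x \<in> D" for c x
    unfolding q_def using that ne by (auto intro!: cINF_greatest)
  show "q (x * e) = q x" if x: "x \<in> D" and e: "e \<in> E" for x e
  proof (rule antisym)
    have "q (x * e) \<le> p (x * f)" if f: "f \<in> E" for f
    proof -
      have "q (x * e) \<le> p (x * e * f)" using x f E[OF e] by (intro lower) auto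
      also have "x * e * f = x * f * e" using E[OF e] E[OF f] by (simp add: mult.assoc commute)
      also have "p (x * f * e) \<le> p (x * f)" using x e E[OF f] by (intro shrink) auto
      finally show ?thesis .
    qed
    then show "q (x * e) \<le> q x" using x by (rule greatest)
    have "q x \<le> p (x * e * f)" if f: "f \<in> E" for f
      using lower[OF x mult[OF e f]] by (simp add: mult.assoc)
    then show "q x \<le> q (x * e)" using x E[OF e] by (intro greatest) auto
  qed
qed

text \<open>The C*-identity gives this for \<open>n\<close> a power of two, and \<open>k ^ n\<close> is a factor of \<open>k ^ (2 ^ n)\<close>.\<close>

lemma seminorm_selfadj_power:
  assumes p: "seminorm p" and k: "k \<in> D" "adj k = k" "p k = 1"
  shows "p (k ^ n) = 1"
proof -
  note P = seminormD[OF p]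
  have le: "p (k ^ n) \<le> 1" for n
  proof (induction n)
    case (Suc n)
    have "p (k ^ Suc n) \<le> p k * p (k ^ n)" using k P(4)[of k "k ^ n"] by simp
    with Suc k show ?case by simp
  qed (simp add: P)
  have two: "p (k ^ (2 ^ n)) = 1" for n
  proof (induction n)
    case (Suc n)
    have "k ^ (2 ^ Suc n) = adj (k ^ (2 ^ n)) * k ^ (2 ^ n)"
      by (simp add: adj_power k power_add[symmetric] mult_2)
    then show ?case using P(7)[of "k ^ (2 ^ n)"] Suc k by simp
  qed (use k in simp)
  have "n < 2 ^ n" by (rule less_exp)
  then have "k ^ (2 ^ n) = k ^ n * k ^ (2 ^ n - n)" by (simp add: power_add[symmetric])
  then have "1 \<le> p (k ^ n) * p (k ^ (2 ^ n - n))"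
    using P(4)[of "k ^ n" "k ^ (2 ^ n - n)"] two[of n] k by simp
  also have "\<dots> \<le> p (k ^ n)" using le[of "2 ^ n - n"] k P(8)[of "k ^ n"] by (simp add: mult_left_le)
  finally show ?thesis using le[of n] by simp
qed

text \<open>For self-adjoint \<open>k\<close>, localizing \<open>p\<close> at the powers of \<open>k / p k\<close> yields a smaller C*-seminorm, hence
  \<open>p\<close> itself, and this says that \<open>p (x * k) = p x * p k\<close>. The general case follows with the
  C*-identity.\<close>

lemma minimal_seminorm_multiplicative:
  assumes p: "seminorm p" 
    and min: "\<And>q. \<lbrakk>seminorm q; \<And>x. x \<in> D \<Longrightarrow> q x \<le> p x; \<And>x e. \<lbrakk>x \<in> D; e \<in> E\<rbrakk> \<Longrightarrow> q (x * e) = q x\<rbrakk> \<Longrightarrow> q = p"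
    and E: "\<And>x e. \<lbrakk>x \<in> D; e \<in> E\<rbrakk> \<Longrightarrow> p (x * e) = p x" "E \<subseteq> D"
    and xy: "x \<in> D" "y \<in> D"
  shows "p (x * y) = p x * p y"
proof -
  note P = seminormD[OF p]
  have selfadj: "p (x * k) = p x * p k" if x: "x \<in> D" and k: "k \<in> D" "adj k = k" for x k
  proof (cases "p k = 0")
    case True
    then show ?thesis using P(4)[of x k] P(8)[of "x * k"] x k by simp
  next
    case False
    then have pos: "p k > 0" using P(8)[of k] k by simp
    define l where "l = scaleC (1 / p k) k"
    have l: "l \<in> D" "adj l = l" "p l = 1"
      using k pos P(5)[of k] by (auto simp: l_def adj_scaleC norm_divide)
    \<comment> \<open>By minimality, localizing at the powers of \<open>l\<close> changes nothing, which bounds \<open>p x\<close> by \<open>p (x * l)\<close>.\<close>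
    define F where "F = range (\<lambda>n. l ^ n)"
    define q where "q = (\<lambda>x. if x \<in> D then INF e\<in>F. p (x * e) else 0)"
    have F: "F \<noteq> {}" "\<And>e. e \<in> F \<Longrightarrow> e \<in> D \<and> adj e = e \<and> p e = 1"
      "\<And>e f. \<lbrakk>e \<in> F; f \<in> F\<rbrakk> \<Longrightarrow> e * f \<in> F"
      using l by (auto simp: F_def adj_power seminorm_selfadj_power[OF p] power_add[symmetric])
    note loc = seminorm_localize[OF p F q_def]
    have "q = p"
    proof (rule min)
      show "q (x * e) = q x" if "x \<in> D" "e \<in> E" for x e
      proof -
        have "p (x * e * f) = p (x * f)" if "f \<in> F" for f
        proof -
          have "x * e * f = x * f * e"
            using \<open>e \<in> E\<close> E(2) F(2)[OF that] by (simp add: mult.assoc commute subset_iff)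
          then show ?thesis using E(1)[of "x * f" e] \<open>e \<in> E\<close> \<open>x \<in> D\<close> F(2)[OF that] by simp
        qed
        then show ?thesis using that E(2) by (auto simp: q_def cong: INF_cong)
      qed
    qed (use loc in auto)
    moreover have "q x \<le> p (x * l)" 
      using loc(2)[of x l] x rangeI[of "\<lambda>n. l ^ n" 1] by (simp add: F_def)
    moreover have "p (x * l) = p (x * k) / p k"
      using P(5)[of "x * k" "1 / p k"] x k pos by (simp add: l_def mult_scaleC_right norm_divide)
    ultimately have "p x * p k \<le> p (x * k)" using pos by (simp add: field_simps)
    then show ?thesis using P(4)[of x k] x k by simp
  qed
  have "(p (x * y))\<^sup>2 = p (adj (x * y) * (x * y))"
    using P(7)[of "x * y"] xy by simp
  also have "adj (x * y) * (x * y) = (adj x * x) * (adj y * y)"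
    using xy by (simp add: adj_mult mult.assoc left_commute[of "adj y"])
  also have "p \<dots> = p (adj x * x) * p (adj y * y)"
    using xy by (intro selfadj) (auto simp: adj_mult adj_adj)
  also have "\<dots> = (p x * p y)\<^sup>2" using P(7) xy by (simp add: power_mult_distrib)
  finally show ?thesis
    using P(8)[of "x * y"] P(8)[of x] P(8)[of y] xy by (simp add: power2_eq_iff_nonneg)
qed

lemma square_diff_scalar:
  "w * w - scaleC (r * r) 1 = (w - scaleC r 1) * (w - scaleC (- r) (1::'a))"
  by (simp add: scaleC_minus_left left_diff_distrib distrib_left mult_scaleC_left mult_scaleC_right
      scaleC_scaleC scaleC_add_right scaleC_diff_right)

text \<open>The theorem of Gelfand and Mazur, for an absolute value in place of a norm. The proof is
  Ostrowski's.\<close>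

lemma multiplicative_seminorm_scalar:
  assumes p: "seminorm p" and mult: "\<And>x y. \<lbrakk>x \<in> D; y \<in> D\<rbrakk> \<Longrightarrow> p (x * y) = p x * p y"
    and x: "x \<in> D"
  shows "\<exists>\<mu>. p (x - scaleC \<mu> 1) = 0"
proof (rule ccontr)
  assume no_zero: "\<nexists>\<mu>. p (x - scaleC \<mu> 1) = 0"
  note P = seminormD[OF p]
  have p_scalar: "p (scaleC c 1) = cmod c" for c using P(5)[of 1 c] P(2) by simp
  have lip: "p (y - scaleC a 1) \<le> p (y - scaleC b 1) + cmod (a - b)" if "y \<in> D" for y a b
  proof -
    have "y - scaleC a 1 = (y - scaleC b 1) - scaleC (a - b) 1"
      by (simp add: scaleC_diff_left)
    then show ?thesis
      using P(11)[of "y - scaleC b 1" "scaleC (a - b) 1"] that p_scalar by (simp only: mem one_mem)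
  qed
  define R where "R = 2 * p x"
  have "continuous_on (cball 0 R) (\<lambda>\<mu>. p (x - scaleC \<mu> 1))"
  proof (rule continuous_on_subset[OF _ subset_UNIV])
    show "continuous_on UNIV (\<lambda>\<mu>. p (x - scaleC \<mu> 1))"
    proof (rule continuous_onI)
      fix a :: complex and e :: real assume "e > 0"
      have "dist (p (x - scaleC b 1)) (p (x - scaleC a 1)) \<le> dist b a" for b
        using lip[OF x, of a b] lip[OF x, of b a] by (auto simp: dist_norm abs_le_iff norm_minus_commute)
      then show "\<exists>d>0. \<forall>b\<in>UNIV. dist b a < d \<longrightarrow> dist (p (x - scaleC b 1)) (p (x - scaleC a 1)) \<le> e"
        using \<open>e > 0\<close> by (meson less_imp_le order_trans)
    qed
  qed
  moreover have "cball (0::complex) R \<noteq> {}" using P(8)[OF x] by (simp add: R_def)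
  ultimately obtain a where a: "\<And>b. b \<in> cball 0 R \<Longrightarrow> p (x - scaleC a 1) \<le> p (x - scaleC b 1)"
    using continuous_attains_inf[OF compact_cball] by metis
  define m where "m = p (x - scaleC a 1)"
  have m_pos: "m > 0" using no_zero P(8)[of "x - scaleC a 1"] x by (simp add: m_def order_less_le)
  have m_min: "m \<le> p (x - scaleC b 1)" for b
  proof (cases "b \<in> cball 0 R")
    case False
    have "cmod b \<le> p (x - scaleC b 1) + p x"
    proof -
      have "scaleC b 1 = x - (x - scaleC b 1)" by simp
      then show ?thesis using P(11)[of x "x - scaleC b 1"] p_scalar[of b] x by simp
    qed
    moreover have "m \<le> p x" using a[of 0] P(8)[OF x] by (simp add: m_def R_def)
    ultimately show ?thesis using False by (simp add: R_def)
  qed (use a m_def in auto)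
  \<comment> \<open>Wherever the distance is minimal it is minimal on a whole disc of radius \<open>m\<close>: a factor of
    \<open>y ^ (2 ^ n) - c ^ (2 ^ n)\<close> other than \<open>y - c\<close> contributes at least \<open>m\<close>, and there are \<open>2 ^ n - 1\<close> of
    them, while the product is at most \<open>m ^ (2 ^ n) + \<bar>c\<bar> ^ (2 ^ n)\<close>.\<close>
  have disc: "p (y - scaleC c 1) = m"
    if y: "y \<in> D" "p y = m" and ge: "\<And>b. m \<le> p (y - scaleC b 1)" and c: "cmod c < m" for y c
  proof -
    have lower: "m ^ (2 ^ n) \<le> p (y ^ (2 ^ n) - scaleC d 1)" for n d
    proof (induction n arbitrary: d)
      case (Suc n)
      define r where "r = csqrt d"
      have d: "d = r * r" by (simp add: r_def power2_eq_square[symmetric])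
      define w where "w = y ^ (2 ^ n)"
      have w: "w \<in> D" using y by (simp add: w_def)
      have "y ^ (2 ^ Suc n) = w * w" by (simp add: w_def power_add[symmetric] mult_2)
      then have "y ^ (2 ^ Suc n) - scaleC d 1 = (w - scaleC r 1) * (w - scaleC (- r) 1)"
        by (simp only: d square_diff_scalar)
      then have "p (y ^ (2 ^ Suc n) - scaleC d 1) = p (w - scaleC r 1) * p (w - scaleC (- r) 1)"
        using w by (simp add: mult)
      moreover have "m ^ (2 ^ n) * m ^ (2 ^ n) \<le> p (w - scaleC r 1) * p (w - scaleC (- r) 1)"
        unfolding w_def using m_pos by (intro mult_mono Suc order_trans[OF _ Suc]) auto
      ultimately show ?case by (simp add: power_add[symmetric] mult_2)
    qed (use ge in simp)
    have upper: "p (y - scaleC c 1) * m ^ (2 ^ n) \<le> m * p (y ^ (2 ^ n) - scaleC (c ^ (2 ^ n)) 1)" for n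
    proof (induction n)
      case (Suc n)
      define w where "w = y ^ (2 ^ n)"
      define r where "r = c ^ (2 ^ n)"
      have w: "w \<in> D" using y by (simp add: w_def)
      have "y ^ (2 ^ Suc n) - scaleC (c ^ (2 ^ Suc n)) 1 = (w - scaleC r 1) * (w - scaleC (- r) 1)"
        unfolding square_diff_scalar[symmetric] by (simp add: w_def r_def power_add mult_2)
      then have eq: "p (y ^ (2 ^ Suc n) - scaleC (c ^ (2 ^ Suc n)) 1) = p (w - scaleC r 1) * p (w - scaleC (- r) 1)"
        using w by (simp add: mult)
      have "p (y - scaleC c 1) * m ^ (2 ^ Suc n) = (p (y - scaleC c 1) * m ^ (2 ^ n)) * m ^ (2 ^ n)"
        by (simp add: power_add[symmetric] mult_2)
      also have "\<dots> \<le> (m * p (w - scaleC r 1)) * p (w - scaleC (- r) 1)"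
      proof (rule mult_mono)
        show "p (y - scaleC c 1) * m ^ (2 ^ n) \<le> m * p (w - scaleC r 1)"
          using Suc by (simp add: w_def r_def)
        show "m ^ (2 ^ n) \<le> p (w - scaleC (- r) 1)"
          using lower[of n "- r"] by (simp add: w_def)
        show "0 \<le> m * p (w - scaleC r 1)"
          using m_pos P(8)[of "w - scaleC r 1"] w by simp
      qed (use m_pos in simp)
      finally show ?case unfolding eq by (simp only: mult.assoc)
    qed (simp add: mult.commute)
    have py: "p (y ^ n) = m ^ n" for n
      by (induction n) (use y P(2) in \<open>simp_all add: mult\<close>)
    have bound: "p (y - scaleC c 1) \<le> m * (1 + (cmod c / m) ^ (2 ^ n))" for n
    proof -
      have "p (y ^ (2 ^ n) - scaleC (c ^ (2 ^ n)) 1) \<le> m ^ (2 ^ n) + cmod c ^ (2 ^ n)"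
        using P(11)[of "y ^ (2 ^ n)" "scaleC (c ^ (2 ^ n)) 1"] y by (simp add: py p_scalar norm_power)
      then have "p (y - scaleC c 1) * m ^ (2 ^ n) \<le> m * (m ^ (2 ^ n) + cmod c ^ (2 ^ n))"
        using upper[of n] m_pos by (meson dual_order.trans less_imp_le mult_left_mono)
      then show ?thesis using m_pos by (simp add: power_divide field_simps)
    qed
    have "(\<lambda>n. (cmod c / m) ^ n) \<longlonglongrightarrow> 0"
      using c m_pos by (intro LIMSEQ_realpow_zero) auto
    then have "(\<lambda>n. (cmod c / m) ^ (2 ^ n)) \<longlonglongrightarrow> 0"
      using LIMSEQ_subseq_LIMSEQ[of _ 0 "\<lambda>n. 2 ^ n"] by (force simp: o_def strict_mono_def)
    then have "(\<lambda>n. m * (1 + (cmod c / m) ^ (2 ^ n))) \<longlonglongrightarrow> m * (1 + 0)"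
      by (intro tendsto_intros)
    then have "p (y - scaleC c 1) \<le> m"
      using bound by (intro LIMSEQ_le_const[of _ m]) auto
    with ge[of c] show ?thesis by simp
  qed
  \<comment> \<open>Walking along discs, five steps of length \<open>m / 2\<close> already contradict the triangle inequality.\<close>
  define y where "y = x - scaleC a 1"
  have y: "y \<in> D" using x by (simp add: y_def)
  have shift: "y - scaleC c 1 - scaleC b 1 = x - scaleC (a + c + b) 1" for b c
    by (simp add: y_def scaleC_add_left algebra_simps)
  have step: "p (y - scaleC (of_real (real n * (m / 2))) 1) = m" for n :: nat
  proof (induction n)
    case 0
    then show ?case by (simp add: y_def m_def)
  next
    case (Suc n)
    have "p (y - scaleC (of_real (real n * (m / 2))) 1 - scaleC (of_real (m / 2)) 1) = m"
    proof (rule disc)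
      show "m \<le> p (y - scaleC (of_real (real n * (m / 2))) 1 - scaleC b 1)" for b
        unfolding shift by (rule m_min)
    qed (use Suc y m_pos in \<open>auto simp: norm_divide\<close>)
    moreover have "y - scaleC (of_real (real n * (m / 2))) 1 - scaleC (of_real (m / 2)) 1 =
        y - scaleC (of_real (real (Suc n) * (m / 2))) 1"
      by (simp add: y_def scaleC_diff_left[symmetric] scaleC_add_left[symmetric] diff_diff_eq algebra_simps add_divide_distrib)
    ultimately show ?case by (simp only:)
  qed
  have "scaleC (of_real (real 5 * (m / 2))) 1 = y - (y - scaleC (of_real (real 5 * (m / 2))) 1)" by simp
  then have "real 5 * (m / 2) \<le> p y + p (y - scaleC (of_real (real 5 * (m / 2))) 1)"
    using P(11)[of y "y - scaleC (of_real (real 5 * (m / 2))) 1"] y m_pos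
      p_scalar[of "of_real (real 5 * (m / 2))"] by (simp add: norm_mult norm_divide)
  also have "\<dots> = m + m" using step[of 0] step[of 5] by simp
  finally show False using m_pos by simp
qed

lemma multiplicative_seminorm_character:
  assumes p: "seminorm p" and mult: "\<And>x y. \<lbrakk>x \<in> D; y \<in> D\<rbrakk> \<Longrightarrow> p (x * y) = p x * p y"
  obtains \<gamma> where "\<gamma> \<in> characters D" "\<And>x. x \<in> D \<Longrightarrow> cmod (\<gamma> x) = p x"
proof -
  note P = seminormD[OF p]
  define \<gamma> where "\<gamma> = restrict (\<lambda>x. SOME \<mu>. p (x - scaleC \<mu> 1) = 0) D"
  have \<gamma>: "p (x - scaleC (\<gamma> x) 1) = 0" if "x \<in> D" for x
    using someI_ex[OF multiplicative_seminorm_scalar[OF p mult that]] that by (simp add: \<gamma>_def)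
  have p_scalar: "p (scaleC c 1) = cmod c" for c using P(5)[of 1 c] P(2) by simp
  have unique: "\<gamma> x = c" if "x \<in> D" "p (x - scaleC c 1) = 0" for x c
  proof -
    have "scaleC (\<gamma> x - c) 1 = (x - scaleC c 1) - (x - scaleC (\<gamma> x) 1)"
      by (simp add: scaleC_diff_left)
    then have "cmod (\<gamma> x - c) \<le> 0"
      using P(11)[of "x - scaleC c 1" "x - scaleC (\<gamma> x) 1"] p_scalar[of "\<gamma> x - c"] that \<gamma>[of x] by simp
    then show ?thesis by simp
  qed
  have null: "p z = 0" if "z \<in> D" "p z \<le> 0" for z using P(8) that by (simp add: antisym)
  have "\<gamma> \<in> characters D"
    unfolding characters_def
  proof (intro CollectI conjI ballI allI)
    fix a b assume ab: "a \<in> D" "b \<in> D"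
    note g = \<gamma>[OF ab(1)] \<gamma>[OF ab(2)]
    show "\<gamma> (a + b) = \<gamma> a + \<gamma> b"
    proof (rule unique)
      have "a + b - scaleC (\<gamma> a + \<gamma> b) 1 = (a - scaleC (\<gamma> a) 1) + (b - scaleC (\<gamma> b) 1)"
        by (simp add: scaleC_add_left)
      moreover have "p ((a - scaleC (\<gamma> a) 1) + (b - scaleC (\<gamma> b) 1)) = 0"
        using P(3)[of "a - scaleC (\<gamma> a) 1" "b - scaleC (\<gamma> b) 1"] g ab by (intro null) auto
      ultimately show "p (a + b - scaleC (\<gamma> a + \<gamma> b) 1) = 0" by (simp only:)
    qed (use ab in auto)
    show "\<gamma> (a * b) = \<gamma> a * \<gamma> b"
    proof (rule unique)
      have "a * b - scaleC (\<gamma> a * \<gamma> b) 1 = (a - scaleC (\<gamma> a) 1) * b + scaleC (\<gamma> a) (b - scaleC (\<gamma> b) 1)"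
        by (simp add: scaleC_diff_right scaleC_scaleC algebra_simps mult_scaleC_left)
      moreover have "p ((a - scaleC (\<gamma> a) 1) * b + scaleC (\<gamma> a) (b - scaleC (\<gamma> b) 1)) = 0"
        using P(3)[of "(a - scaleC (\<gamma> a) 1) * b" "scaleC (\<gamma> a) (b - scaleC (\<gamma> b) 1)"]
          mult[of "a - scaleC (\<gamma> a) 1" b] P(5)[of "b - scaleC (\<gamma> b) 1" "\<gamma> a"] g ab
        by (intro null) auto
      ultimately show "p (a * b - scaleC (\<gamma> a * \<gamma> b) 1) = 0" by (simp only:)
    qed (use ab in auto)
  next
    fix c a assume a: "a \<in> D"
    show "\<gamma> (scaleC c a) = c * \<gamma> a"
    proof (rule unique)
      have "scaleC c a - scaleC (c * \<gamma> a) 1 = scaleC c (a - scaleC (\<gamma> a) 1)"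
        by (simp add: scaleC_diff_right scaleC_scaleC)
      then show "p (scaleC c a - scaleC (c * \<gamma> a) 1) = 0"
        using P(5)[of "a - scaleC (\<gamma> a) 1" c] \<gamma>[OF a] a by simp
    qed (use a in auto)
  next
    have "\<gamma> 1 = 1" by (rule unique) (auto simp: P)
    then show "\<exists>a\<in>D. \<gamma> a \<noteq> 0" by (intro bexI[of _ 1]) auto
  qed (simp add: \<gamma>_def)
  moreover have "cmod (\<gamma> x) = p x" if x: "x \<in> D" for x
  proof (rule antisym)
    show "cmod (\<gamma> x) \<le> p x"
      using P(11)[of x "x - scaleC (\<gamma> x) 1"] \<gamma>[OF x] x p_scalar[of "\<gamma> x"] by simp
    show "p x \<le> cmod (\<gamma> x)"
      using P(3)[of "x - scaleC (\<gamma> x) 1" "scaleC (\<gamma> x) 1"] \<gamma>[OF x] x p_scalar[of "\<gamma> x"] by simp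
  qed
  ultimately show thesis using that by blast
qed

lemma seminorm_norm:
  assumes "norm (1::'a) = 1"
  shows "seminorm (\<lambda>x. if x \<in> D then norm x else 0)"
  using assms by (auto simp: seminorm_def norm_triangle_ineq norm_mult_ineq norm_scaleC cstar_identity)

text \<open>A set of self-adjoint elements of norm one that is closed under products peaks at a common
  point of the spectrum. All characters in this development come from this lemma. The point is found
  as a minimal C*-seminorm among those for which multiplication by elements of \<open>E\<close> is isometric.\<close>

lemma exists_character:
  assumes ne: "E \<noteq> {}"
    and E: "\<And>e. e \<in> E \<Longrightarrow> e \<in> D \<and> adj e = e \<and> norm e = 1"
    and mult: "\<And>e f. \<lbrakk>e \<in> E; f \<in> E\<rbrakk> \<Longrightarrow> e * f \<in> E"
  obtains \<gamma> where "\<gamma> \<in> characters D" "\<And>e. e \<in> E \<Longrightarrow> cmod (\<gamma> e) = 1"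
proof -
  from ne obtain e where "e \<in> E" by blast
  then have "e \<noteq> 0" using E by force
  then have one: "norm (1::'a) = 1" by (rule norm_one_if_nonzero)
  define \<P> where "\<P> = {p. seminorm p \<and> (\<forall>x\<in>D. \<forall>e\<in>E. p (x * e) = p x)}"
  define le where "le = (\<lambda>p q :: 'a \<Rightarrow> real. \<forall>x. q x \<le> p x)"
  have "seminorm (\<lambda>x. if x \<in> D then norm x else 0)" by (rule seminorm_norm[OF one])
  moreover have "\<And>e. e \<in> E \<Longrightarrow> e \<in> D \<and> adj e = e \<and> (if e \<in> D then norm e else 0) = 1"
    using E by simp
  ultimately have "(\<lambda>x. if x \<in> D then INF e\<in>E. if x * e \<in> D then norm (x * e) else 0 else 0) \<in> \<P>"
    unfolding \<P>_def using seminorm_localize(1,4)[OF _ ne _ mult refl] by blast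
  then have P_ne: "\<P> \<noteq> {}" by blast
  have "\<exists>p\<in>\<P>. \<forall>q\<in>\<P>. le p q \<longrightarrow> q = p"
  proof (rule predicate_Zorn)
    show "partial_order_on \<P> (relation_of le \<P>)"
      unfolding partial_order_on_def preorder_on_def
    proof (intro conjI)
      show "antisym (relation_of le \<P>)"
        by (rule antisymI) (simp add: relation_of_def le_def fun_eq_iff order_eq_iff)
      show "trans (relation_of le \<P>)"
        by (rule transI) (fastforce simp: relation_of_def le_def intro: order_trans)
      show "refl_on \<P> (relation_of le \<P>)" "relation_of le \<P> \<subseteq> \<P> \<times> \<P>"
        by (auto simp: refl_on_def relation_of_def le_def)
    qed
  next
    fix C assume C: "C \<in> Chains (relation_of le \<P>)"
    then have CP: "C \<subseteq> \<P>" by (auto simp: Chains_def relation_of_def)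
    show "\<exists>q\<in>\<P>. \<forall>p\<in>C. le p q"
    proof (cases "C = {}")
      case False
      define q where "q = (\<lambda>x. if x \<in> D then INF p\<in>C. p x else 0)"
      have sem: "seminorm p" if "p \<in> C" for p using that CP by (auto simp: \<P>_def)
      note S = seminormD[OF sem]
      have "seminorm q"
        unfolding q_def
      proof (rule seminorm_directed_Inf[OF False])
        fix p p' assume p: "p \<in> C" "p' \<in> C"
        then have "le p p' \<or> le p' p" using C by (auto simp: Chains_def relation_of_def)
        then obtain r where r: "r \<in> C" "\<And>x. r x \<le> p x" "\<And>x. r x \<le> p' x"
          using p by (auto simp: le_def)
        have "r (x + y) \<le> p x + p' y \<and> r (x * y) \<le> p x * p' y" if xy: "x \<in> D" "y \<in> D" for x y
        proof
          show "r (x + y) \<le> p x + p' y"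
            using S(3)[OF r(1) xy] r(2)[of x] r(3)[of y] by simp
          have "r x * r y \<le> p x * p' y"
            using r p xy S(8) by (intro mult_mono) auto
          then show "r (x * y) \<le> p x * p' y"
            using S(4)[OF r(1) xy] by simp
        qed
        then show "\<exists>r\<in>C. \<forall>x\<in>D. \<forall>y\<in>D. r (x + y) \<le> p x + p' y \<and> r (x * y) \<le> p x * p' y"
          using r(1) by blast
      qed (use S in auto)
      moreover have "q (x * e) = q x" if "x \<in> D" "e \<in> E" for x e
      proof -
        have "p (x * e) = p x" if "p \<in> C" for p
          using that CP \<open>x \<in> D\<close> \<open>e \<in> E\<close> by (auto simp: \<P>_def)
        then have "(INF p\<in>C. p (x * e)) = (INF p\<in>C. p x)" by (intro INF_cong) auto
        then show ?thesis using that E by (simp add: q_def)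
      qed
      moreover have "le p q" if "p \<in> C" for p
        unfolding le_def
      proof
        fix x show "q x \<le> p x"
          using that S(8) S(1)[OF that, of x]
          by (cases "x \<in> D") (auto simp: q_def intro!: cINF_lower bdd_belowI[where m = 0])
      qed
      ultimately show ?thesis by (auto simp: \<P>_def)
    qed (use P_ne in auto)
  qed
  then obtain p where pP: "p \<in> \<P>" and min: "\<And>q. \<lbrakk>q \<in> \<P>; le p q\<rbrakk> \<Longrightarrow> q = p" by blast
  have p: "seminorm p" and pE: "\<And>x e. \<lbrakk>x \<in> D; e \<in> E\<rbrakk> \<Longrightarrow> p (x * e) = p x"
    using pP by (auto simp: \<P>_def)
  have "p (x * y) = p x * p y" if "x \<in> D" "y \<in> D" for x y
  proof (rule minimal_seminorm_multiplicative[OF p _ pE _ that])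
    fix q assume q: "seminorm q" "\<And>x. x \<in> D \<Longrightarrow> q x \<le> p x" "\<And>x e. \<lbrakk>x \<in> D; e \<in> E\<rbrakk> \<Longrightarrow> q (x * e) = q x"
    have "q x \<le> p x" for x
      using q(2) seminormD(1)[OF p] seminormD(1)[OF q(1)] by (cases "x \<in> D") auto
    then show "q = p" using q by (intro min) (auto simp: \<P>_def le_def)
  qed (use E in auto)
  from multiplicative_seminorm_character[OF p this]
  obtain \<gamma> where \<gamma>: "\<gamma> \<in> characters D" "\<And>x. x \<in> D \<Longrightarrow> cmod (\<gamma> x) = p x" by blast
  have "cmod (\<gamma> e) = 1" if "e \<in> E" for e
    using pE[of 1 e] that E \<gamma>(2)[of e] seminormD(2)[OF p] by simp
  with \<gamma>(1) show thesis by (rule that)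
qed

end

section \<open>Functional calculus\<close>

context commutative_cstar_subalgebra
begin

lemma exists_norming_character:
  assumes x: "x \<in> D" "x \<noteq> 0"
  obtains \<gamma> where "\<gamma> \<in> characters D" "cmod (\<gamma> x) = norm x"
proof -
  define h where "h = scaleC (1 / (norm x)\<^sup>2) (adj x * x)"
  have h: "h \<in> D" "adj h = h" "norm h = 1"
    using x by (auto simp: h_def adj_scaleC adj_mult adj_adj norm_scaleC cstar_identity norm_divide norm_power)
  have one: "norm (1::'a) = 1" using x(2) by (rule norm_one_if_nonzero)
  have "norm (h ^ n) = 1" for n
    using seminorm_selfadj_power[OF seminorm_norm[OF one], of h n] h by simp
  then have "e \<in> D \<and> adj e = e \<and> norm e = 1" if "e \<in> range (\<lambda>n. h ^ n)" for e
    using that h by (auto simp: adj_power)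
  moreover have "e * f \<in> range (\<lambda>n. h ^ n)" if "e \<in> range (\<lambda>n. h ^ n)" "f \<in> range (\<lambda>n. h ^ n)" for e f
    using that by (auto simp: power_add[symmetric])
  ultimately obtain \<gamma> where \<gamma>: "\<gamma> \<in> characters D" "\<And>e. e \<in> range (\<lambda>n. h ^ n) \<Longrightarrow> cmod (\<gamma> e) = 1"
    using exists_character[of "range (\<lambda>n. h ^ n)"] by blast
  have "cmod (\<gamma> h) = 1" using \<gamma>(2)[of h] rangeI[of "\<lambda>n. h ^ n" 1] by simp
  moreover have "\<gamma> h = (1 / (norm x)\<^sup>2) * (cmod (\<gamma> x))\<^sup>2"
    using x by (simp add: h_def character_simps(2)[OF \<gamma>(1)] character_square[OF \<gamma>(1)])
  ultimately have "(cmod (\<gamma> x))\<^sup>2 = (norm x)\<^sup>2"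
    using x by (simp add: norm_divide norm_power)
  then have "cmod (\<gamma> x) = norm x" by simp
  with \<gamma>(1) show thesis by (rule that)
qed

lemma norm_le_if_characters_le:
  assumes "x \<in> D" "0 \<le> r" "\<And>\<gamma>. \<gamma> \<in> characters D \<Longrightarrow> cmod (\<gamma> x) \<le> r"
  shows "norm x \<le> r"
  using assms exists_norming_character[of x] by (cases "x = 0") (simp, metis)

lemma eq_if_characters_eq:
  assumes "x \<in> D" "y \<in> D" "\<And>\<gamma>. \<gamma> \<in> characters D \<Longrightarrow> \<gamma> x = \<gamma> y"
  shows "x = y"
proof -
  have "norm (x - y) \<le> 0"
    by (rule norm_le_if_characters_le) (use assms in \<open>simp_all add: character_diff\<close>)
  then show ?thesis by simp
qed

lemma polynomial_calculus:
  fixes g :: "real \<Rightarrow> real"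
  assumes h: "h \<in> D" "adj h = h" and g: "real_polynomial_function g"
  shows "\<exists>c\<in>D. \<forall>\<gamma>\<in>characters D. \<gamma> c = of_real (g (Re (\<gamma> h)))"
  using g
proof induction
  case (linear f)
  have f: "f t = t * f 1" for t :: real
    using linear_cmul[OF bounded_linear.linear[OF linear], of t 1] by simp
  show ?case
  proof (intro bexI ballI)
    fix \<gamma> assume \<gamma>: "\<gamma> \<in> characters D"
    then have "\<gamma> h = of_real (Re (\<gamma> h))"
      using h by (simp add: character_selfadj complex_eq_iff)
    then show "\<gamma> (scaleC (of_real (f 1)) h) = of_real (f (Re (\<gamma> h)))"
      using character_simps(2)[OF \<gamma> h(1), of "of_real (f 1)"] by (simp add: f[of "Re (\<gamma> h)"] mult.commute)
  qed (use h in auto)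
next
  case (const c)
  show ?case
    by (rule bexI[of _ "scaleC (of_real c) 1"]) (auto simp: character_simps(2) character_one)
next
  case (add f g)
  then obtain c d where "c \<in> D" "d \<in> D" "\<forall>\<gamma>\<in>characters D. \<gamma> c = of_real (f (Re (\<gamma> h)))"
    "\<forall>\<gamma>\<in>characters D. \<gamma> d = of_real (g (Re (\<gamma> h)))" by blast
  then show ?case by (intro bexI[of _ "c + d"]) (auto simp: character_simps(1))
next
  case (mult f g)
  then obtain c d where "c \<in> D" "d \<in> D" "\<forall>\<gamma>\<in>characters D. \<gamma> c = of_real (f (Re (\<gamma> h)))"
    "\<forall>\<gamma>\<in>characters D. \<gamma> d = of_real (g (Re (\<gamma> h)))" by blast
  then show ?case by (intro bexI[of _ "c * d"]) (auto simp: character_simps(3))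
qed

text \<open>Since the norm is attained on characters, uniform approximation of \<open>f\<close> by polynomials on the range
  of \<open>h\<close> becomes convergence in norm.\<close>

lemma functional_calculus:
  fixes f :: "real \<Rightarrow> real"
  assumes h: "h \<in> D" "adj h = h" and f: "continuous_on UNIV f"
  obtains c where "c \<in> D" "adj c = c" "\<And>\<gamma>. \<gamma> \<in> characters D \<Longrightarrow> \<gamma> c = of_real (f (Re (\<gamma> h)))"
proof -
  define S where "S = {- norm h..norm h}"
  have "\<exists>g. real_polynomial_function g \<and> (\<forall>t\<in>S. \<bar>f t - g t\<bar> < inverse (Suc n))" for n
  proof -
    have "compact S" "continuous_on S f" "0 < inverse (real (Suc n))"
      using continuous_on_subset[OF f] by (auto simp: S_def)
    from Stone_Weierstrass_real_polynomial_function[OF this] obtain g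
      where "real_polynomial_function g" "\<And>t. t \<in> S \<Longrightarrow> \<bar>f t - g t\<bar> < inverse (Suc n)" by blast
    then show ?thesis by blast
  qed
  then obtain g where g: "\<And>n. real_polynomial_function (g n)" 
    and gf: "\<And>n t. t \<in> S \<Longrightarrow> \<bar>f t - g n t\<bar> < inverse (Suc n)" by metis
  have "\<exists>c\<in>D. \<forall>\<gamma>\<in>characters D. \<gamma> c = of_real (g n (Re (\<gamma> h)))" for n
    by (rule polynomial_calculus[OF h g])
  then obtain c where c: "\<And>n. c n \<in> D"
    and \<gamma>c: "\<And>n \<gamma>. \<gamma> \<in> characters D \<Longrightarrow> \<gamma> (c n) = of_real (g n (Re (\<gamma> h)))" by metis
  have S: "Re (\<gamma> h) \<in> S" if "\<gamma> \<in> characters D" for \<gamma>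
    using character_norm_le[OF that h(1)] abs_Re_le_cmod[of "\<gamma> h"] by (auto simp: S_def abs_le_iff)
  have dist: "norm (c m - c n) \<le> inverse (Suc m) + inverse (Suc n)" for m n
  proof (rule norm_le_if_characters_le)
    fix \<gamma> assume \<gamma>: "\<gamma> \<in> characters D"
    have "\<gamma> (c m - c n) = of_real (g m (Re (\<gamma> h)) - g n (Re (\<gamma> h)))"
      using c by (simp add: character_diff[OF \<gamma>] \<gamma>c[OF \<gamma>])
    then have "cmod (\<gamma> (c m - c n)) = \<bar>g m (Re (\<gamma> h)) - g n (Re (\<gamma> h))\<bar>" by (simp only: norm_of_real)
    also have "\<dots> \<le> inverse (Suc m) + inverse (Suc n)"
      using gf[OF S[OF \<gamma>], of m] gf[OF S[OF \<gamma>], of n] by linarith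
    finally show "cmod (\<gamma> (c m - c n)) \<le> inverse (Suc m) + inverse (Suc n)" .
  qed (use c in auto)
  have "Cauchy c"
  proof (rule metric_CauchyI)
    fix e :: real assume "e > 0"
    then obtain N where N: "inverse (Suc N) < e / 2"
      using reals_Archimedean[of "e / 2"] by auto
    show "\<exists>M. \<forall>m\<ge>M. \<forall>n\<ge>M. dist (c m) (c n) < e"
    proof (intro exI allI impI)
      fix m n assume "N \<le> m" "N \<le> n"
      then have "inverse (real (Suc m)) \<le> inverse (real (Suc N))" "inverse (real (Suc n)) \<le> inverse (real (Suc N))"
        by (auto simp: field_simps)
      then show "dist (c m) (c n) < e" using dist[of m n] N unfolding dist_norm by linarith
    qed
  qed
  then obtain l where l: "c \<longlonglongrightarrow> l" using convergent_eq_Cauchy by blast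
  have lD: "l \<in> D" using closed_sequentially[OF closed c l] .
  have \<gamma>l: "\<gamma> l = of_real (f (Re (\<gamma> h)))" if \<gamma>: "\<gamma> \<in> characters D" for \<gamma>
  proof (rule LIMSEQ_unique)
    have "(\<lambda>n. norm (c n - l)) \<longlonglongrightarrow> 0" using l by (simp add: LIM_zero tendsto_norm_zero)
    then have "(\<lambda>n. \<gamma> (c n) - \<gamma> l) \<longlonglongrightarrow> 0"
      by (rule Lim_null_comparison[rotated])
         (use c lD character_norm_le[OF \<gamma>] in \<open>simp add: character_diff[OF \<gamma>, symmetric]\<close>)
    then show "(\<lambda>n. \<gamma> (c n)) \<longlonglongrightarrow> \<gamma> l" by (simp add: LIM_zero_iff)
    have "(\<lambda>n. g n (Re (\<gamma> h)) - f (Re (\<gamma> h))) \<longlonglongrightarrow> 0"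
      by (rule Lim_null_comparison[OF _ LIMSEQ_inverse_real_of_nat])
         (use gf[OF S[OF \<gamma>]] in \<open>simp add: abs_minus_commute less_imp_le\<close>)
    then have "(\<lambda>n. g n (Re (\<gamma> h))) \<longlonglongrightarrow> f (Re (\<gamma> h))" by (simp add: LIM_zero_iff)
    then show "(\<lambda>n. \<gamma> (c n)) \<longlonglongrightarrow> of_real (f (Re (\<gamma> h)))"
      unfolding \<gamma>c[OF \<gamma>] by (rule tendsto_of_real)
  qed
  have "adj l = l"
    by (rule eq_if_characters_eq) (use lD in \<open>simp_all add: character_adj \<gamma>l\<close>)
  with lD \<gamma>l show thesis using that by blast
qed

lemma square_calculus:
  fixes f :: "real \<Rightarrow> real"
  assumes k: "k \<in> D" and f: "continuous_on UNIV f"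
  obtains c where "c \<in> D" "adj c = c" "\<And>\<gamma>. \<gamma> \<in> characters D \<Longrightarrow> \<gamma> c = of_real (f ((cmod (\<gamma> k))\<^sup>2))"
proof -
  have "adj k * k \<in> D" "adj (adj k * k) = adj k * k" using k by (auto simp: adj_mult adj_adj)
  from functional_calculus[OF this f] obtain c where
    c: "c \<in> D" "adj c = c" "\<And>\<gamma>. \<gamma> \<in> characters D \<Longrightarrow> \<gamma> c = of_real (f (Re (\<gamma> (adj k * k))))" by blast
  show thesis
  proof (rule that[OF c(1,2)])
    fix \<gamma> assume \<gamma>: "\<gamma> \<in> characters D"
    have "Re (\<gamma> (adj k * k)) = (cmod (\<gamma> k))\<^sup>2"
      unfolding character_square[OF \<gamma> k] by (simp only: Re_complex_of_real)
    then show "\<gamma> c = of_real (f ((cmod (\<gamma> k))\<^sup>2))" by (simp only: c(3)[OF \<gamma>])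
  qed
qed

text \<open>The resolvent \<open>1 / (1 + adj k * k)\<close> has modulus \<open>1\<close> exactly at the zeros of \<open>k\<close>. It serves to
  translate vanishing of \<open>k\<close> at a character into unimodularity.\<close>

lemma exists_resolvent:
  assumes k: "k \<in> D"
  shows "\<exists>e\<in>D. adj e = e \<and> norm e \<le> 1 \<and> e + e * (adj k * k) = 1"
proof -
  have "continuous_on UNIV (\<lambda>t::real. 1 / (1 + \<bar>t\<bar>))"
    by (intro continuous_intros) (auto simp: add_nonneg_eq_0_iff)
  from square_calculus[OF k this] obtain e where e: "e \<in> D" "adj e = e"
    and \<gamma>e: "\<And>\<gamma>. \<gamma> \<in> characters D \<Longrightarrow> \<gamma> e = of_real (1 / (1 + (cmod (\<gamma> k))\<^sup>2))" by auto
  have "norm e \<le> 1"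
  proof (rule norm_le_if_characters_le)
    fix \<gamma> assume \<gamma>: "\<gamma> \<in> characters D"
    show "cmod (\<gamma> e) \<le> 1" unfolding \<gamma>e[OF \<gamma>] norm_of_real by (simp add: add_pos_nonneg)
  qed (use e in auto)
  moreover have "e + e * (adj k * k) = 1"
  proof (rule eq_if_characters_eq)
    fix \<gamma> assume \<gamma>: "\<gamma> \<in> characters D"
    define t where "t = (cmod (\<gamma> k))\<^sup>2"
    have t: "1 + t \<noteq> 0" by (simp add: t_def add_nonneg_eq_0_iff)
    have "\<gamma> (adj k * k) = of_real t"
      unfolding character_square[OF \<gamma> k] t_def ..
    then have "\<gamma> (e + e * (adj k * k)) = of_real (1 / (1 + t)) + of_real (1 / (1 + t)) * of_real t"
      using e k \<gamma>e[OF \<gamma>] by (simp add: character_simps(1,3)[OF \<gamma>] t_def del: of_real_power)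
    also have "\<dots> = complex_of_real (1 / (1 + t) + 1 / (1 + t) * t)" by (simp only: of_real_add of_real_mult)
    also have "1 / (1 + t) + 1 / (1 + t) * t = 1" using t by (simp add: field_simps)
    finally show "\<gamma> (e + e * (adj k * k)) = \<gamma> 1" by (simp add: character_one[OF \<gamma>])
  qed (use e k in auto)
  ultimately show ?thesis using e by blast
qed

definition peaks :: "('a \<Rightarrow> complex) \<Rightarrow> 'a set" where
  "peaks \<xi> = {e \<in> D. \<xi> e = 1 \<and> norm e \<le> 1}"

lemma peaks_mult: 
  assumes "\<xi> \<in> characters D" "e \<in> peaks \<xi>" "f \<in> peaks \<xi>" shows "e * f \<in> peaks \<xi>"
proof -
  have "norm (e * f) \<le> norm e * norm f" by (rule norm_mult_ineq)
  also have "\<dots> \<le> 1 * 1" using assms by (intro mult_mono) (auto simp: peaks_def)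
  finally show ?thesis using assms by (auto simp: peaks_def character_simps[OF assms(1)])
qed

text \<open>An element of the maximal ideal belonging to a character is small near that character.\<close>

lemma exists_peak:
  assumes \<xi>: "\<xi> \<in> characters D" and k: "k \<in> D" "\<xi> k = 0" and "\<epsilon> > 0"
  obtains e where "e \<in> peaks \<xi>" "norm (k * e) \<le> \<epsilon>"
proof -
  define f where "f = (\<lambda>t::real. max 0 (1 - \<bar>t\<bar> / \<epsilon>\<^sup>2))"
  have "continuous_on UNIV f" unfolding f_def using \<open>\<epsilon> > 0\<close> by (intro continuous_intros) auto
  from square_calculus[OF k(1) this] obtain e where e: "e \<in> D" "adj e = e"
    and \<gamma>e: "\<And>\<gamma>. \<gamma> \<in> characters D \<Longrightarrow> \<gamma> e = of_real (f ((cmod (\<gamma> k))\<^sup>2))" by blast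
  have f: "0 \<le> f t" "f t \<le> 1" for t by (auto simp: f_def)
  have "norm e \<le> 1"
    by (rule norm_le_if_characters_le) (use e f in \<open>auto simp: \<gamma>e abs_le_iff intro: order_trans[OF _ f(1)]\<close>)
  moreover have "\<xi> e = 1" using k by (simp add: \<gamma>e[OF \<xi>] f_def)
  moreover have "norm (k * e) \<le> \<epsilon>"
  proof (rule norm_le_if_characters_le)
    fix \<gamma> assume \<gamma>: "\<gamma> \<in> characters D"
    define t where "t = cmod (\<gamma> k)"
    have "cmod (\<gamma> (k * e)) = t * f (t\<^sup>2)"
      using e k f by (simp add: character_simps[OF \<gamma>] \<gamma>e[OF \<gamma>] norm_mult t_def)
    also have "\<dots> \<le> \<epsilon>"
    proof (cases "t \<le> \<epsilon>")
      case True
      then show ?thesis using mult_mono[of t \<epsilon> "f (t\<^sup>2)" 1] f \<open>\<epsilon> > 0\<close> by (simp add: t_def)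
    next
      case False
      then have "\<epsilon>\<^sup>2 \<le> t\<^sup>2" using \<open>\<epsilon> > 0\<close> by (intro power_mono) auto
      then have "f (t\<^sup>2) = 0" using \<open>\<epsilon> > 0\<close> by (simp add: f_def)
      then show ?thesis using \<open>\<epsilon> > 0\<close> by simp
    qed
    finally show "cmod (\<gamma> (k * e)) \<le> \<epsilon>" .
  qed (use e k \<open>\<epsilon> > 0\<close> in auto)
  ultimately show thesis using that[of e] e by (auto simp: peaks_def)
qed

text \<open>Let \<open>f\<close> be a function of \<open>adj c * c\<close> that lives where \<open>c\<close> is large and let \<open>d\<close> invert \<open>c\<close> there. Then
  \<open>f = f * d * c\<close>, so that \<open>f * (1 - d * (c - j)) = f * d * j\<close> lies in the ideal, and \<open>1 - d * (c - j)\<close> is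
  invertible. The argument never passes to the closure of the ideal, which is why ideals that are
  neither closed nor self-adjoint are covered.\<close>

lemma ideal_near_element_meets:
  assumes J: "two_sided_ideal J" "j \<in> J" and c: "c \<in> D" and near: "norm (c - j) < norm c / 2"
  shows "J \<inter> D \<noteq> {0}"
proof -
  have nc: "norm c > 0" using near norm_ge_zero[of "c - j"] by linarith
  define \<tau> where "\<tau> = (norm c / 2)\<^sup>2"
  have \<tau>: "\<tau> > 0" "\<tau> < (norm c)\<^sup>2" using nc by (auto simp: \<tau>_def power_divide)
  have "continuous_on UNIV (\<lambda>t. max 0 (t - \<tau>))" "continuous_on UNIV (\<lambda>t. 1 / max t \<tau>)"
    using \<tau> by (auto intro!: continuous_intros)
  from square_calculus[OF c this(1)] square_calculus[OF c this(2)] 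
  obtain f g where f: "f \<in> D" "\<And>\<gamma>. \<gamma> \<in> characters D \<Longrightarrow> \<gamma> f = of_real (max 0 ((cmod (\<gamma> c))\<^sup>2 - \<tau>))"
    and g: "g \<in> D" "\<And>\<gamma>. \<gamma> \<in> characters D \<Longrightarrow> \<gamma> g = of_real (1 / max ((cmod (\<gamma> c))\<^sup>2) \<tau>)" by metis
  \<comment> \<open>On the part of the spectrum where \<open>f\<close> lives, \<open>d\<close> is an inverse of \<open>c\<close>.\<close>
  define d where "d = g * adj c"
  have d: "d \<in> D" using g c by (simp add: d_def)
  have nd: "norm d \<le> 2 / norm c"
  proof (rule norm_le_if_characters_le)
    fix \<gamma> assume \<gamma>: "\<gamma> \<in> characters D"
    define t where "t = cmod (\<gamma> c)"
    have t: "t \<ge> 0" by (simp add: t_def)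
    have "cmod (\<gamma> d) = 1 / max (t\<^sup>2) \<tau> * t"
      using g c \<tau>(1) by (simp add: d_def character_simps[OF \<gamma>] g(2)[OF \<gamma>] character_adj[OF \<gamma>] norm_mult norm_divide t_def)
    also have "\<dots> \<le> 2 / norm c"
    proof (cases "t \<le> norm c / 2")
      case True
      have "1 / max (t\<^sup>2) \<tau> * t \<le> 1 / \<tau> * (norm c / 2)"
        using True t \<tau> by (intro mult_mono divide_left_mono) auto
      also have "\<dots> = 2 / norm c" using nc by (simp add: \<tau>_def power2_eq_square)
      finally show ?thesis .
    next
      case False
      then have t0: "0 < t" using nc by linarith
      have "\<tau> \<le> t\<^sup>2" using False nc unfolding \<tau>_def by (intro power_mono) auto
      then have "1 / max (t\<^sup>2) \<tau> * t = 1 / t" using t by (simp add: power2_eq_square max_def)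
      also have "1 / t \<le> 1 / (norm c / 2)" using False nc t0 by (intro divide_left_mono mult_pos_pos) auto
      also have "\<dots> = 2 / norm c" by simp
      finally show ?thesis .
    qed
    finally show "cmod (\<gamma> d) \<le> 2 / norm c" .
  qed (use d in auto)
  have fdc: "f * (d * c) = f"
  proof (rule eq_if_characters_eq)
    fix \<gamma> assume \<gamma>: "\<gamma> \<in> characters D"
    define t where "t = cmod (\<gamma> c)"
    have "\<gamma> (f * (d * c)) = \<gamma> f * (\<gamma> g * (cnj (\<gamma> c) * \<gamma> c))"
      using f g c by (simp add: d_def character_simps[OF \<gamma>] character_adj[OF \<gamma>])
    also have "cnj (\<gamma> c) * \<gamma> c = of_real (t\<^sup>2)"
      using complex_norm_square[of "\<gamma> c"] by (simp add: t_def mult.commute)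
    also have "\<gamma> f * (\<gamma> g * of_real (t\<^sup>2)) = \<gamma> f"
    proof (cases "t\<^sup>2 \<le> \<tau>")
      case True
      then show ?thesis by (simp add: f(2)[OF \<gamma>] t_def[symmetric])
    next
      case False
      moreover from False have "t \<noteq> 0" using \<tau> by auto
      ultimately show ?thesis using \<tau> by (simp add: g(2)[OF \<gamma>] t_def[symmetric] max_def)
    qed
    finally show "\<gamma> (f * (d * c)) = \<gamma> f" .
  qed (use f d c in auto)
  have "norm (d * (c - j)) \<le> norm d * norm (c - j)" by (rule norm_mult_ineq)
  also have "\<dots> \<le> 2 / norm c * norm (c - j)" using nd by (intro mult_right_mono) auto
  also have "\<dots> < 1" using near nc by (simp add: field_simps)
  finally obtain y where y: "(1 - d * (c - j)) * y = 1"
    using neumann_inverse[of UNIV "d * (c - j)"] by (auto simp: cstar_subalgebra_def)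
  have "f = f * ((1 - d * (c - j)) * y)" using y by simp
  also have "\<dots> = (f - f * (d * c) + f * d * j) * y"
    by (simp add: algebra_simps)
  also have "\<dots> = f * d * j * y" using fdc by simp
  finally have fJ: "f \<in> J" using two_sided_idealD[OF J(1)] J(2) by metis
  have "c \<noteq> 0" using nc by auto
  from exists_norming_character[OF c this]
  obtain \<gamma> where \<gamma>: "\<gamma> \<in> characters D" "cmod (\<gamma> c) = norm c" by blast
  have "\<gamma> f = of_real (max 0 ((norm c)\<^sup>2 - \<tau>))" using f(2)[OF \<gamma>(1)] \<gamma>(2) by simp
  then have "\<gamma> f \<noteq> 0" using \<tau> by (simp only: of_real_eq_0_iff)
  then have "f \<noteq> 0" using character_zero[OF \<gamma>(1)] by auto
  with fJ f(1) show ?thesis by blast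
qed

end

context commutative_cstar_subalgebra
begin

lemma closedin_vanishing:
  assumes "I \<subseteq> D" "I \<noteq> {}"
  shows "closedin (spectrum D) {\<gamma> \<in> characters D. \<forall>i\<in>I. \<gamma> i = 0}"
proof -
  have "closedin (spectrum D) {\<gamma> \<in> topspace (spectrum D). \<gamma> i \<in> {0}}" if "i \<in> I" for i
  proof (rule closedin_continuous_map_preimage)
    have "i \<in> D" using that assms by blast
    then have "continuous_map (product_topology (\<lambda>_. euclidean) D) euclidean (\<lambda>\<gamma>. \<gamma> i :: complex)"
      by (rule continuous_map_product_projection)
    then show "continuous_map (spectrum D) euclidean (\<lambda>\<gamma>. \<gamma> i :: complex)"
      unfolding spectrum_def by (rule continuous_map_from_subtopology)
  qed simp
  then have "closedin (spectrum D) (\<Inter>i\<in>I. {\<gamma> \<in> topspace (spectrum D). \<gamma> i \<in> {0}})"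
    using assms(2) by (intro closedin_INT) auto
  also have "(\<Inter>i\<in>I. {\<gamma> \<in> topspace (spectrum D). \<gamma> i \<in> {0}}) = {\<gamma> \<in> characters D. \<forall>i\<in>I. \<gamma> i = 0}"
    using assms(2) by (auto simp: topspace_spectrum)
  finally show ?thesis .
qed

text \<open>A basic neighbourhood of \<open>\<xi>\<close> missing \<open>S\<close> involves finitely many elements \<open>i\<close> of the algebra, and
  \<open>h = (\<Sum>i\<in>F. adj (i - \<xi> i) * (i - \<xi> i))\<close> is zero at \<open>\<xi>\<close> and bounded below on \<open>S\<close>. A function of \<open>h\<close> does the job.\<close>

lemma separate_closed:
  assumes S: "closedin (spectrum D) S" and \<xi>: "\<xi> \<in> characters D" "\<xi> \<notin> S"
  obtains c where "c \<in> D" "\<xi> c = 1" "\<And>\<gamma>. \<gamma> \<in> S \<Longrightarrow> \<gamma> c = 0"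
proof -
  have Schar: "S \<subseteq> characters D" using closedin_subset[OF S] by (simp add: topspace_spectrum)
  have "openin (spectrum D) (topspace (spectrum D) - S)" using S by (simp add: closedin_def)
  then obtain T where T: "openin (product_topology (\<lambda>_. euclidean) D) T" "characters D - S = T \<inter> characters D"
    unfolding spectrum_def openin_subtopology topspace_spectrum[unfolded spectrum_def] by blast
  have "\<xi> \<in> T" using T(2) \<xi> by blast
  then obtain V where V: "finite {i \<in> D. V i \<noteq> (UNIV :: complex set)}" "\<And>i. i \<in> D \<Longrightarrow> open (V i)"
    "\<xi> \<in> PiE D V" "PiE D V \<subseteq> T"
    using T(1) unfolding openin_product_topology_alt by auto
  define F where "F = {i \<in> D. V i \<noteq> UNIV}"
  have F: "finite F" "\<And>i. i \<in> F \<Longrightarrow> i \<in> D" using V(1) by (auto simp: F_def)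
  have "\<exists>e>0. ball (\<xi> i) e \<subseteq> V i" if "i \<in> F" for i
    using V(2,3) F(2)[OF that] by (meson PiE_mem openE)
  then obtain r where r: "\<And>i. i \<in> F \<Longrightarrow> r i > 0 \<and> ball (\<xi> i) (r i) \<subseteq> V i" by metis
  define \<epsilon> where "\<epsilon> = Min (insert 1 (r ` F))"
  have \<epsilon>: "\<epsilon> > 0" "\<And>i. i \<in> F \<Longrightarrow> \<epsilon> \<le> r i" using F r by (auto simp: \<epsilon>_def)
  define k where "k = (\<lambda>i. i - scaleC (\<xi> i) 1)"
  define h where "h = (\<Sum>i\<in>F. adj (k i) * k i)"
  have k: "k i \<in> D" if "i \<in> F" for i using F(2)[OF that] by (auto simp: k_def)
  have h: "h \<in> D" unfolding h_def by (rule sum_mem[OF subalgebra]) (use k in auto)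
  have "adj h = h" by (simp add: h_def adj_sum adj_mult adj_adj)
  have \<gamma>h: "Re (\<gamma> h) = (\<Sum>i\<in>F. (cmod (\<gamma> i - \<xi> i))\<^sup>2)" if \<gamma>: "\<gamma> \<in> characters D" for \<gamma>
  proof -
    have "\<gamma> (k i) = \<gamma> i - \<xi> i" if "i \<in> F" for i
      using F(2)[OF that] by (simp add: k_def character_diff[OF \<gamma>] character_simps[OF \<gamma>] character_one[OF \<gamma>])
    then have "\<gamma> h = of_real (\<Sum>i\<in>F. (cmod (\<gamma> i - \<xi> i))\<^sup>2)"
      using k character_sum[OF \<gamma>, of F "\<lambda>i. adj (k i) * k i"]
      by (simp add: h_def character_square[OF \<gamma>])
    then show ?thesis by (simp only: Re_complex_of_real)
  qed
  have "continuous_on UNIV (\<lambda>t::real. max 0 (1 - t / \<epsilon>\<^sup>2))" using \<epsilon>(1) by (intro continuous_intros) auto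
  from functional_calculus[OF h \<open>adj h = h\<close> this] obtain c where c: "c \<in> D"
    "\<And>\<gamma>. \<gamma> \<in> characters D \<Longrightarrow> \<gamma> c = of_real (max 0 (1 - Re (\<gamma> h) / \<epsilon>\<^sup>2))" by metis
  show thesis
  proof (rule that[OF c(1)])
    show "\<xi> c = 1" using c(2)[OF \<xi>(1)] \<gamma>h[OF \<xi>(1)] by simp
    fix \<gamma> assume "\<gamma> \<in> S"
    then have \<gamma>: "\<gamma> \<in> characters D" using Schar by blast
    have "\<gamma> \<notin> PiE D V" using V(4) T(2) \<open>\<gamma> \<in> S\<close> \<gamma> by blast
    moreover have "\<gamma> \<in> extensional D" using charactersD(1)[OF \<gamma>] .
    ultimately obtain i where i: "i \<in> D" "\<gamma> i \<notin> V i" by (auto simp: PiE_def)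
    then have iF: "i \<in> F" by (auto simp: F_def)
    then have "\<epsilon> \<le> cmod (\<gamma> i - \<xi> i)" using r[OF iF] i(2) \<epsilon>(2)[OF iF] by (force simp: dist_norm norm_minus_commute)
    then have "\<epsilon>\<^sup>2 \<le> (cmod (\<gamma> i - \<xi> i))\<^sup>2" using \<epsilon>(1) by (intro power_mono) auto
    also have "\<dots> \<le> Re (\<gamma> h)" unfolding \<gamma>h[OF \<gamma>] using F(1) iF by (intro member_le_sum) auto
    finally show "\<gamma> c = 0" using c(2)[OF \<gamma>] \<epsilon>(1) by simp
  qed
qed

text \<open>The closed left ideal of the whole algebra generated by the kernel of the character. Describing
  it by peaks avoids sums of products and makes it evident that it is proper.\<close>

definition null_left_ideal :: "('a \<Rightarrow> complex) \<Rightarrow> 'a set" where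
  "null_left_ideal \<gamma> = {x. \<forall>\<epsilon>>0. \<exists>e\<in>peaks \<gamma>. norm (x * e) \<le> \<epsilon>}"

context
  fixes \<gamma> assumes \<gamma>: "\<gamma> \<in> characters D"
begin

lemma null_left_ideal_add:
  assumes "x \<in> null_left_ideal \<gamma>" "y \<in> null_left_ideal \<gamma>" shows "x + y \<in> null_left_ideal \<gamma>"
  unfolding null_left_ideal_def
proof (intro CollectI allI impI)
  fix \<epsilon> :: real assume "\<epsilon> > 0"
  then obtain e f where e: "e \<in> peaks \<gamma>" "norm (x * e) \<le> \<epsilon> / 2" and f: "f \<in> peaks \<gamma>" "norm (y * f) \<le> \<epsilon> / 2"
    using assms half_gt_zero[of \<epsilon>] unfolding null_left_ideal_def by blast
  have ef: "e \<in> D" "f \<in> D" "norm e \<le> 1" "norm f \<le> 1" using e f by (auto simp: peaks_def)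
  have "norm (x * e * f) \<le> norm (x * e) * norm f" "norm (y * f * e) \<le> norm (y * f) * norm e"
    by (rule norm_mult_ineq)+
  moreover have "norm (x * e) * norm f \<le> norm (x * e)" "norm (y * f) * norm e \<le> norm (y * f)"
    using ef by (simp_all add: mult_left_le)
  moreover have "(x + y) * (e * f) = x * e * f + y * f * e"
    using ef by (simp add: distrib_right mult.assoc commute)
  ultimately have "norm ((x + y) * (e * f)) \<le> \<epsilon>"
    using norm_triangle_ineq[of "x * e * f" "y * f * e"] e(2) f(2) by simp
  then show "\<exists>e\<in>peaks \<gamma>. norm ((x + y) * e) \<le> \<epsilon>" using peaks_mult[OF \<gamma> e(1) f(1)] by blast
qed

lemma null_left_ideal_mult:
  assumes "x \<in> null_left_ideal \<gamma>" shows "z * x \<in> null_left_ideal \<gamma>"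
  unfolding null_left_ideal_def
proof (intro CollectI allI impI)
  fix \<epsilon> :: real assume "\<epsilon> > 0"
  then have "\<epsilon> / (norm z + 1) > 0" by (simp add: add_nonneg_pos)
  then obtain e where e: "e \<in> peaks \<gamma>" "norm (x * e) \<le> \<epsilon> / (norm z + 1)"
    using assms unfolding null_left_ideal_def by blast
  have "norm (z * x * e) \<le> norm z * norm (x * e)" by (simp add: mult.assoc norm_mult_ineq)
  also have "\<dots> \<le> (norm z + 1) * (\<epsilon> / (norm z + 1))" using e(2) by (intro mult_mono) auto
  also have "\<dots> = \<epsilon>" using norm_ge_zero[of z] by (simp add: add_nonneg_eq_0_iff)
  finally show "\<exists>e\<in>peaks \<gamma>. norm (z * x * e) \<le> \<epsilon>" using e(1) by blast
qed

lemma null_left_ideal_closed: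
  assumes "\<And>\<epsilon>. \<epsilon> > 0 \<Longrightarrow> \<exists>y\<in>null_left_ideal \<gamma>. norm (x - y) \<le> \<epsilon>" shows "x \<in> null_left_ideal \<gamma>"
  unfolding null_left_ideal_def
proof (intro CollectI allI impI)
  fix \<epsilon> :: real assume "\<epsilon> > 0"
  then obtain y where y: "y \<in> null_left_ideal \<gamma>" "norm (x - y) \<le> \<epsilon> / 2" using assms[of "\<epsilon> / 2"] by auto
  then obtain e where e: "e \<in> peaks \<gamma>" "norm (y * e) \<le> \<epsilon> / 2"
    using half_gt_zero[OF \<open>\<epsilon> > 0\<close>] unfolding null_left_ideal_def by blast
  have "norm ((x - y) * e) \<le> norm (x - y) * norm e" by (rule norm_mult_ineq)
  also have "\<dots> \<le> norm (x - y)" using e(1) by (intro mult_left_le) (auto simp: peaks_def)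
  finally have "norm (x * e) \<le> \<epsilon>"
    using y(2) e(2) norm_triangle_ineq[of "(x - y) * e" "y * e"] by (simp add: left_diff_distrib)
  then show "\<exists>e\<in>peaks \<gamma>. norm (x * e) \<le> \<epsilon>" using e(1) by blast
qed

text \<open>If \<open>e\<close> is a peak then \<open>\<gamma> k = \<gamma> (k * e)\<close> is bounded by \<open>norm (k * e)\<close>. In particular the left ideal is proper.\<close>

lemma null_left_ideal_iff:
  assumes k: "k \<in> D" shows "k \<in> null_left_ideal \<gamma> \<longleftrightarrow> \<gamma> k = 0"
proof
  assume "\<gamma> k = 0"
  then show "k \<in> null_left_ideal \<gamma>"
    unfolding null_left_ideal_def using exists_peak[OF \<gamma> k] by blast
next
  assume kL: "k \<in> null_left_ideal \<gamma>"
  have "cmod (\<gamma> k) \<le> \<epsilon>" if \<epsilon>: "\<epsilon> > 0" for \<epsilon>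
  proof -
    obtain e where e: "e \<in> peaks \<gamma>" "norm (k * e) \<le> \<epsilon>" using kL \<epsilon> unfolding null_left_ideal_def by blast
    then have "e \<in> D" "\<gamma> (k * e) = \<gamma> k" using k by (auto simp: peaks_def character_simps[OF \<gamma>])
    then show ?thesis using character_norm_le[OF \<gamma>, of "k * e"] k e(2) by simp
  qed
  then have "cmod (\<gamma> k) \<le> 0" by (rule field_le_epsilon) simp
  then show "\<gamma> k = 0" by simp
qed

lemma null_left_ideal_sum:
  assumes "\<And>i. i \<in> I \<Longrightarrow> f i \<in> null_left_ideal \<gamma>" shows "sum f I \<in> null_left_ideal \<gamma>"
  using assms null_left_ideal_iff[of 0]
  by (induction I rule: infinite_finite_induct) (auto simp: character_zero[OF \<gamma>] intro: null_left_ideal_add)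

lemma character_resolvent:
  assumes "e \<in> D" "k \<in> D" "e + e * (adj k * k) = 1"
  shows "\<gamma> e * of_real (1 + (cmod (\<gamma> k))\<^sup>2) = 1"
proof -
  have "\<gamma> (e + e * (adj k * k)) = 1" using assms(3) character_one[OF \<gamma>] by simp
  moreover have "\<gamma> (e + e * (adj k * k)) = \<gamma> e + \<gamma> e * \<gamma> (adj k * k)"
    using assms(1,2) by (simp add: character_simps(1,3)[OF \<gamma>])
  ultimately show ?thesis
    unfolding character_square[OF \<gamma> assms(2)] by (simp add: distrib_left)
qed

lemma unimodular_resolvent:
  assumes "e \<in> D" "k \<in> D" "e + e * (adj k * k) = 1" "cmod (\<gamma> e) = 1"
  shows "\<gamma> k = 0"
proof -
  have "cmod (\<gamma> e) * cmod (of_real (1 + (cmod (\<gamma> k))\<^sup>2)) = 1"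
    using character_resolvent[OF assms(1-3)] by (metis norm_mult norm_one)
  then have "\<bar>1 + (cmod (\<gamma> k))\<^sup>2\<bar> = 1" by (simp only: assms(4) norm_of_real mult_1)
  then have "(cmod (\<gamma> k))\<^sup>2 = 0" using zero_le_power2[of "cmod (\<gamma> k)"] by linarith
  then show ?thesis by simp
qed

end

end

section \<open>The function algebra and the shift\<close>

lemma CX_D:
  assumes "f \<in> CX X"
  shows "continuous_map X euclidean f" "x \<notin> topspace X \<Longrightarrow> f x = 0"
  using assms by (auto simp: CX_def)

lemma CX_zero [simp]: "(\<lambda>x. 0) \<in> CX X"
  by (simp add: CX_def)

lemma CX_add: "\<lbrakk>f \<in> CX X; g \<in> CX X\<rbrakk> \<Longrightarrow> (\<lambda>x. f x + g x) \<in> CX X"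
  by (auto simp: CX_def intro: continuous_map_add)

lemma CX_mult: "\<lbrakk>f \<in> CX X; g \<in> CX X\<rbrakk> \<Longrightarrow> (\<lambda>x. f x * g x) \<in> CX X"
  by (auto simp: CX_def continuous_map_atin intro!: tendsto_mult)

lemma CX_scale: "f \<in> CX X \<Longrightarrow> (\<lambda>x. c * f x) \<in> CX X"
  by (auto simp: CX_def continuous_map_atin intro!: tendsto_mult)

lemma CX_cnj: "f \<in> CX X \<Longrightarrow> (\<lambda>x. cnj (f x)) \<in> CX X"
  by (auto simp: CX_def continuous_map_atin intro!: tendsto_cnj)

lemma CX_sum: "(\<And>i. i \<in> I \<Longrightarrow> f i \<in> CX X) \<Longrightarrow> (\<lambda>x. \<Sum>i\<in>I. f i x) \<in> CX X"
  by (induction I rule: infinite_finite_induct) (simp_all add: CX_add)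

lemma CX_indicator: "indicator (topspace X) \<in> CX X"
proof -
  have "continuous_map X euclidean (indicator (topspace X) :: _ \<Rightarrow> complex)"
    by (rule continuous_map_eq[of _ _ "\<lambda>x. 1"]) auto
  then show ?thesis by (simp add: CX_def)
qed

lemma funpow_in: "(\<And>x. x \<in> A \<Longrightarrow> f x \<in> A) \<Longrightarrow> x \<in> A \<Longrightarrow> (f ^^ n) x \<in> A"
  by (induction n) auto

context topological_dynamical_system
begin

abbreviation (input) "shift \<equiv> iter_int X \<sigma>"
abbreviation (input) "\<alpha> \<equiv> alpha_pow X \<sigma>"
abbreviation (input) "\<sigma>' \<equiv> inv_into (topspace X) \<sigma>"

lemma sigma_bij: "bij_betw \<sigma> (topspace X) (topspace X)"
  using homeo by (simp add: bij_betw_def homeomorphic_imp_injective_map homeomorphic_imp_surjective_map)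

lemma sigma_in: "x \<in> topspace X \<Longrightarrow> \<sigma> x \<in> topspace X" 
  and sigma_inv_in: "x \<in> topspace X \<Longrightarrow> \<sigma>' x \<in> topspace X"
  and sigma_inv: "x \<in> topspace X \<Longrightarrow> \<sigma> (\<sigma>' x) = x"
  and inv_sigma: "x \<in> topspace X \<Longrightarrow> \<sigma>' (\<sigma> x) = x"
  using sigma_bij bij_betwE[OF sigma_bij] bij_betwE[OF bij_betw_inv_into[OF sigma_bij]]
    bij_betw_inv_into_right[OF sigma_bij] bij_betw_inv_into_left[OF sigma_bij] by auto

lemma shift_zero [simp]: "shift 0 x = x"
  by (simp add: iter_int_def)

lemma shift_in: "x \<in> topspace X \<Longrightarrow> shift n x \<in> topspace X"
  by (simp add: iter_int_def funpow_in sigma_in sigma_inv_in)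

lemma shift_Suc: 
  assumes "x \<in> topspace X" shows "shift (n + 1) x = \<sigma> (shift n x)"
proof (cases "n \<ge> 0")
  case True
  then have "nat (n + 1) = Suc (nat n)" by simp
  with True show ?thesis by (simp add: iter_int_def)
next
  case False
  define k where "k = nat (- (n + 1))"
  have "nat (- n) = Suc k" using False by (simp add: k_def)
  then have "\<sigma> (shift n x) = (\<sigma>' ^^ k) x"
    using False assms funpow_in[of "topspace X" \<sigma>' x k] sigma_inv_in by (simp add: iter_int_def sigma_inv)
  also have "\<dots> = shift (n + 1) x" using False by (auto simp: iter_int_def k_def)
  finally show ?thesis by simp
qed

lemma shift_pred:
  assumes "x \<in> topspace X" shows "shift (n - 1) x = \<sigma>' (shift n x)"
  using shift_Suc[OF assms, of "n - 1"] inv_sigma shift_in[OF assms, of "n - 1"] by simp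

lemma shift_add:
  assumes "x \<in> topspace X" shows "shift (m + n) x = shift m (shift n x)"
proof (induction m rule: int_induct[where k = 0])
  case (step1 i)
  have "shift (i + 1 + n) x = \<sigma> (shift (i + n) x)"
    using shift_Suc[OF assms, of "i + n"] by (simp add: add_ac)
  then show ?case using step1 shift_Suc[OF shift_in[OF assms], of i] by simp
next
  case (step2 i)
  have "shift (i - 1 + n) x = \<sigma>' (shift (i + n) x)"
    using shift_pred[OF assms, of "i + n"] by (simp add: algebra_simps)
  then show ?case using step2 shift_pred[OF shift_in[OF assms], of i] by simp
qed simp

lemma continuous_shift: "continuous_map X X (shift n)"
proof -
  have pow: "continuous_map X X f \<Longrightarrow> continuous_map X X (f ^^ k)" for f k
    by (induction k) (auto intro: continuous_map_compose)
  obtain g where g: "homeomorphic_maps X X \<sigma> g" using homeo by (auto simp: homeomorphic_map_maps)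
  have "continuous_map X X \<sigma>'"
  proof (rule continuous_map_eq)
    show "continuous_map X X g" using g by (simp add: homeomorphic_maps_def)
    show "g x = \<sigma>' x" if "x \<in> topspace X" for x
      using g that sigma_inv[OF that] sigma_inv_in[OF that] by (metis homeomorphic_maps_def)
  qed
  then show ?thesis
    using pow homeomorphic_imp_continuous_map[OF homeo] by (simp add: iter_int_def)
qed

lemma openin_shift_preimage: 
  assumes "openin X U" shows "openin X {x \<in> topspace X. shift n x \<in> U}"
  using continuous_shift assms by (rule openin_continuous_map_preimage)

lemma alpha_in: 
  assumes "f \<in> CX X" shows "\<alpha> n f \<in> CX X"
proof -
  have "continuous_map X euclidean (f \<circ> shift (- n))"
    using continuous_shift CX_D(1)[OF assms] by (rule continuous_map_compose)
  then have "continuous_map X euclidean (\<alpha> n f)"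
    by (rule continuous_map_eq) (simp add: alpha_pow_def)
  then show ?thesis by (simp add: CX_def alpha_pow_def)
qed

lemma alpha_alpha: "f \<in> CX X \<Longrightarrow> \<alpha> m (\<alpha> n f) = \<alpha> (m + n) f"
proof
  fix x
  show "\<alpha> m (\<alpha> n f) x = \<alpha> (m + n) f x"
  proof (cases "x \<in> topspace X")
    case True
    have "shift (- (m + n)) x = shift (- n) (shift (- m) x)"
      using shift_add[OF True, of "- n" "- m"] by (simp only: minus_add)
    then show ?thesis using True shift_in[OF True, of "- m"] by (simp only: alpha_pow_def if_True)
  qed (simp add: alpha_pow_def)
qed

lemma alpha_0: "f \<in> CX X \<Longrightarrow> \<alpha> 0 f = f"
  by (auto simp: alpha_pow_def fun_eq_iff CX_def)

lemma alpha_zero [simp]: "\<alpha> n (\<lambda>x. 0) = (\<lambda>x. 0)"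
  by (simp add: alpha_pow_def fun_eq_iff)

lemma alpha_cnj: "\<alpha> n (\<lambda>x. cnj (f x)) = (\<lambda>x. cnj (\<alpha> n f x))"
  by (simp add: alpha_pow_def fun_eq_iff)

end

section \<open>Covariant pairs\<close>

lemma unitary_pow_zero [simp]: "unitary_pow u 0 = 1"
  by (simp add: unitary_pow_def)

lemma unitary_pow_Suc:
  fixes u :: "'a::unital_cstar_algebra"
  assumes "adj u * u = 1" "u * adj u = 1"
  shows "unitary_pow u (n + 1) = u * unitary_pow u n"
proof (cases "n \<ge> 0")
  case True
  then have "nat (n + 1) = Suc (nat n)" by simp
  with True show ?thesis by (simp add: unitary_pow_def)
next
  case False
  define k where "k = nat (- (n + 1))"
  have "nat (- n) = Suc k" using False by (simp add: k_def)
  then have "u * unitary_pow u n = (u * adj u) * adj u ^ k"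
    using False by (simp add: unitary_pow_def mult.assoc)
  also have "\<dots> = unitary_pow u (n + 1)" using False assms by (auto simp: unitary_pow_def k_def)
  finally show ?thesis by simp
qed

lemma unitary_pow_pred:
  fixes u :: "'a::unital_cstar_algebra"
  assumes "adj u * u = 1" "u * adj u = 1"
  shows "unitary_pow u (n - 1) = adj u * unitary_pow u n"
  using unitary_pow_Suc[OF assms, of "n - 1"] assms(1) by (simp add: mult.assoc[symmetric])

lemma unitary_pow_add:
  fixes u :: "'a::unital_cstar_algebra"
  assumes "adj u * u = 1" "u * adj u = 1"
  shows "unitary_pow u (m + n) = unitary_pow u m * unitary_pow u n"
proof (induction m rule: int_induct[where k = 0])
  case (step1 i)
  have "unitary_pow u (i + 1 + n) = u * unitary_pow u (i + n)"
    using unitary_pow_Suc[OF assms, of "i + n"] by (simp add: add_ac)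
  then show ?case using step1 unitary_pow_Suc[OF assms, of i] by (simp add: mult.assoc)
next
  case (step2 i)
  have "unitary_pow u (i - 1 + n) = adj u * unitary_pow u (i + n)"
    using unitary_pow_pred[OF assms, of "i + n"] by (simp add: algebra_simps)
  then show ?case using step2 unitary_pow_pred[OF assms, of i] by (simp add: mult.assoc)
qed simp

lemma adj_unitary_pow: "adj (unitary_pow u n) = unitary_pow u (- n)"
  by (auto simp: unitary_pow_def adj_power adj_adj)

locale covariant_pair = topological_dynamical_system X \<sigma>
  for X :: "'x topology" and \<sigma> :: "'x \<Rightarrow> 'x" +
  fixes \<pi> :: "('x \<Rightarrow> complex) \<Rightarrow> 'a::unital_cstar_algebra" and u :: 'a
  assumes pi_add: "\<lbrakk>f \<in> CX X; g \<in> CX X\<rbrakk> \<Longrightarrow> \<pi> (\<lambda>x. f x + g x) = \<pi> f + \<pi> g"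
    and pi_scale: "f \<in> CX X \<Longrightarrow> \<pi> (\<lambda>x. c * f x) = scaleC c (\<pi> f)"
    and pi_mult: "\<lbrakk>f \<in> CX X; g \<in> CX X\<rbrakk> \<Longrightarrow> \<pi> (\<lambda>x. f x * g x) = \<pi> f * \<pi> g"
    and pi_adj: "f \<in> CX X \<Longrightarrow> \<pi> (\<lambda>x. cnj (f x)) = adj (\<pi> f)"
    and pi_one: "\<pi> (indicator (topspace X)) = 1"
    and unitary: "adj u * u = 1" "u * adj u = 1"
    and covariant: "f \<in> CX X \<Longrightarrow> u * \<pi> f * adj u = \<pi> (alpha_pow X \<sigma> 1 f)"
begin

abbreviation (input) "U \<equiv> unitary_pow u"
abbreviation (input) "IF \<equiv> integrated_form \<pi> u"

lemmas U_add = unitary_pow_add[OF unitary]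
lemmas U_Suc = unitary_pow_Suc[OF unitary]
lemmas U_pred = unitary_pow_pred[OF unitary]

lemma U_inverse: "U n * U (- n) = 1" "U (- n) * U n = 1"
  using U_add[of n "- n"] U_add[of "- n" n] by simp_all

lemma norm_mult_U: "norm (x * U n) = norm x"
proof -
  have le: "norm (U n) \<le> 1" for n
    using cstar_identity[of "U n"] norm_one_le[where 'a='a] by (simp add: adj_unitary_pow U_inverse power_le_one_iff)
  have le_mult: "norm (x * U n) \<le> norm x" for n x
    using norm_mult_ineq[of x "U n"] mult_left_mono[OF le[of n], of "norm x"] by simp
  show "norm (x * U n) = norm x"
    using le_mult[of x n] le_mult[of "x * U n" "- n"] by (simp add: mult.assoc U_inverse)
qed

lemma U_pi: "f \<in> CX X \<Longrightarrow> U n * \<pi> f = \<pi> (\<alpha> n f) * U n"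
proof (induction n rule: int_induct[where k = 0])
  case base
  then show ?case by (simp add: alpha_0)
next
  case (step1 i)
  have "u * \<pi> g = \<pi> (\<alpha> 1 g) * u" if "g \<in> CX X" for g
    using covariant[OF that, symmetric] unitary by (simp add: mult.assoc)
  from this[OF alpha_in[OF step1(3), of i]] have "u * U i * \<pi> f = \<pi> (\<alpha> (1 + i) f) * u * U i"
    using step1 by (simp add: mult.assoc alpha_alpha) (simp add: mult.assoc[symmetric])
  then show ?case using U_Suc[of i] by (simp add: add.commute mult.assoc)
next
  case (step2 i)
  have "adj u * \<pi> g = \<pi> (\<alpha> (- 1) g) * adj u" if "g \<in> CX X" for g
  proof -
    have "u * \<pi> (\<alpha> (- 1) g) * adj u = \<pi> g"
      using covariant[OF alpha_in[OF that]] that by (simp add: alpha_alpha alpha_0)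
    then have "adj u * (u * \<pi> (\<alpha> (- 1) g) * adj u) = adj u * \<pi> g" by simp
    then show ?thesis using unitary by (simp add: mult.assoc[symmetric])
  qed
  from this[OF alpha_in[OF step2(3), of i]] have "adj u * U i * \<pi> f = \<pi> (\<alpha> (- 1 + i) f) * adj u * U i"
    using step2 by (simp add: mult.assoc alpha_alpha) (simp add: mult.assoc[symmetric])
  then show ?case using U_pred[of i] by (simp add: mult.assoc)
qed

lemma pi_zero [simp]: "\<pi> (\<lambda>x. 0) = 0"
  using pi_scale[of "\<lambda>x. 0" 0] by simp

lemma pi_sum: "(\<And>i. i \<in> I \<Longrightarrow> f i \<in> CX X) \<Longrightarrow> \<pi> (\<lambda>x. \<Sum>i\<in>I. f i x) = (\<Sum>i\<in>I. \<pi> (f i))"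
  by (induction I rule: infinite_finite_induct) (simp_all add: pi_add CX_sum)

lemma IF_eq: 
  assumes "finite S" "{n. a n \<noteq> (\<lambda>x. 0)} \<subseteq> S"
  shows "IF a = (\<Sum>n\<in>S. \<pi> (a n) * U n)"
  unfolding integrated_form_def using assms by (intro sum.mono_neutral_left) auto

lemma IF_add:
  assumes "a \<in> conv_carrier X" "b \<in> conv_carrier X"
  shows "IF (\<lambda>n x. a n x + b n x) = IF a + IF b"
proof -
  define S where "S = {n. a n \<noteq> (\<lambda>x. 0)} \<union> {n. b n \<noteq> (\<lambda>x. 0)}"
  have S: "finite S" using assms by (auto simp: S_def conv_carrier_def)
  have "IF (\<lambda>n x. a n x + b n x) = (\<Sum>n\<in>S. \<pi> (\<lambda>x. a n x + b n x) * U n)"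
    by (rule IF_eq[OF S]) (auto simp: S_def)
  also have "\<dots> = (\<Sum>n\<in>S. \<pi> (a n) * U n) + (\<Sum>n\<in>S. \<pi> (b n) * U n)"
    using assms by (simp add: pi_add conv_carrier_def distrib_right sum.distrib)
  also have "\<dots> = IF a + IF b"
    by (subst (1 2) IF_eq[OF S]) (auto simp: S_def)
  finally show ?thesis .
qed

lemma IF_scale:
  assumes "a \<in> conv_carrier X"
  shows "IF (\<lambda>n x. c * a n x) = scaleC c (IF a)"
proof -
  define S where "S = {n. a n \<noteq> (\<lambda>x. 0)}"
  have S: "finite S" using assms by (auto simp: S_def conv_carrier_def)
  have "IF (\<lambda>n x. c * a n x) = (\<Sum>n\<in>S. \<pi> (\<lambda>x. c * a n x) * U n)"
    by (rule IF_eq[OF S]) (auto simp: S_def)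
  also have "\<dots> = scaleC c (\<Sum>n\<in>S. \<pi> (a n) * U n)"
    using assms by (simp add: pi_scale conv_carrier_def mult_scaleC_left scaleC_sum_right)
  also have "\<dots> = scaleC c (IF a)"
    by (subst IF_eq[OF S]) (auto simp: S_def)
  finally show ?thesis .
qed

lemma IF_adj:
  assumes "a \<in> conv_carrier X"
  shows "conv_adj X \<sigma> a \<in> conv_carrier X" "IF (conv_adj X \<sigma> a) = adj (IF a)"
proof -
  define S where "S = {n. a n \<noteq> (\<lambda>x. 0)}"
  have S: "finite S" "\<And>n. a n \<in> CX X" using assms by (auto simp: S_def conv_carrier_def)
  have sub: "{n. conv_adj X \<sigma> a n \<noteq> (\<lambda>x. 0)} \<subseteq> uminus ` S"
  proof
    fix n assume "n \<in> {n. conv_adj X \<sigma> a n \<noteq> (\<lambda>x. 0)}"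
    then have "a (- n) \<noteq> (\<lambda>x. 0)" by (auto simp: conv_adj_def)
    then have "- n \<in> S" by (simp add: S_def)
    then show "n \<in> uminus ` S" by (metis image_eqI minus_minus)
  qed
  then show "conv_adj X \<sigma> a \<in> conv_carrier X"
    using S(1) finite_subset[OF sub] by (auto simp: conv_carrier_def conv_adj_def intro!: CX_cnj alpha_in S)
  have "IF (conv_adj X \<sigma> a) = (\<Sum>n\<in>uminus ` S. \<pi> (conv_adj X \<sigma> a n) * U n)"
    using S sub by (intro IF_eq) auto
  also have "\<dots> = (\<Sum>n\<in>S. \<pi> (conv_adj X \<sigma> a (- n)) * U (- n))"
    by (subst sum.reindex) (auto simp: inj_on_def)
  also have "\<dots> = (\<Sum>n\<in>S. adj (\<pi> (a n) * U n))"
  proof (rule sum.cong)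
    fix n
    have "\<pi> (conv_adj X \<sigma> a (- n)) * U (- n) = \<pi> (\<alpha> (- n) (\<lambda>x. cnj (a n x))) * U (- n)"
      by (simp add: conv_adj_def alpha_cnj)
    also have "\<dots> = U (- n) * \<pi> (\<lambda>x. cnj (a n x))" by (rule U_pi[symmetric]) (intro CX_cnj S)
    also have "\<dots> = adj (\<pi> (a n) * U n)" by (simp add: adj_mult adj_unitary_pow pi_adj S)
    finally show "\<pi> (conv_adj X \<sigma> a (- n)) * U (- n) = adj (\<pi> (a n) * U n)" .
  qed simp
  also have "\<dots> = adj (IF a)" by (simp add: integrated_form_def S_def adj_sum)
  finally show "IF (conv_adj X \<sigma> a) = adj (IF a)" .
qed

lemma IF_mult:
  assumes "a \<in> conv_carrier X" "b \<in> conv_carrier X"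
  shows "conv_mult X \<sigma> a b \<in> conv_carrier X" "IF (conv_mult X \<sigma> a b) = IF a * IF b"
proof -
  define S where "S = {n. a n \<noteq> (\<lambda>x. 0)}"
  define T where "T = {n. b n \<noteq> (\<lambda>x. 0)}"
  define N where "N = (\<lambda>(k, l). k + l) ` (S \<times> T)"
  have S: "finite S" "\<And>n. a n \<in> CX X" using assms by (auto simp: S_def conv_carrier_def)
  have T: "finite T" "\<And>n. b n \<in> CX X" using assms by (auto simp: T_def conv_carrier_def)
  have N: "finite N" using S T by (simp add: N_def)
  have c: "conv_mult X \<sigma> a b n = (\<lambda>x. \<Sum>k\<in>S. a k x * \<alpha> k (b (n - k)) x)" for n
    by (simp add: conv_mult_def S_def)
  have sub: "{n. conv_mult X \<sigma> a b n \<noteq> (\<lambda>x. 0)} \<subseteq> N"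
  proof
    fix n assume "n \<in> {n. conv_mult X \<sigma> a b n \<noteq> (\<lambda>x. 0)}"
    then obtain x where "(\<Sum>k\<in>S. a k x * \<alpha> k (b (n - k)) x) \<noteq> 0" by (auto simp: c fun_eq_iff)
    then obtain k where "k \<in> S" "a k x * \<alpha> k (b (n - k)) x \<noteq> 0" by (meson sum.neutral)
    then have "k \<in> S" "n - k \<in> T" by (auto simp: T_def alpha_zero)
    then show "n \<in> N" by (force simp: N_def)
  qed
  have term_in: "(\<lambda>x. a k x * \<alpha> k (b l) x) \<in> CX X" for k l by (intro CX_mult S alpha_in T)
  then show "conv_mult X \<sigma> a b \<in> conv_carrier X"
    using finite_subset[OF sub N] by (auto simp: conv_carrier_def c intro!: CX_sum)
  have t: "\<pi> (\<lambda>x. a k x * \<alpha> k (b l) x) * U (k + l) = (\<pi> (a k) * U k) * (\<pi> (b l) * U l)" for k l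
  proof -
    have "(\<pi> (a k) * U k) * (\<pi> (b l) * U l) = \<pi> (a k) * (U k * \<pi> (b l)) * U l" by (simp add: mult.assoc)
    also have "\<dots> = (\<pi> (a k) * \<pi> (\<alpha> k (b l))) * (U k * U l)" by (simp add: U_pi T mult.assoc)
    finally show ?thesis by (simp add: pi_mult S T alpha_in U_add)
  qed
  have "IF (conv_mult X \<sigma> a b) = (\<Sum>n\<in>N. \<pi> (conv_mult X \<sigma> a b n) * U n)"
    using N sub by (rule IF_eq)
  also have "\<dots> = (\<Sum>n\<in>N. \<Sum>k\<in>S. \<pi> (\<lambda>x. a k x * \<alpha> k (b (n - k)) x) * U n)"
    unfolding c by (simp add: pi_sum term_in sum_distrib_right)
  also have "\<dots> = (\<Sum>k\<in>S. \<Sum>n\<in>N. \<pi> (\<lambda>x. a k x * \<alpha> k (b (n - k)) x) * U n)" by (rule sum.swap)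
  also have "\<dots> = (\<Sum>k\<in>S. \<Sum>l\<in>T. \<pi> (\<lambda>x. a k x * \<alpha> k (b l) x) * U (k + l))"
  proof (rule sum.cong)
    fix k assume k: "k \<in> S"
    have "(\<Sum>l\<in>T. \<pi> (\<lambda>x. a k x * \<alpha> k (b l) x) * U (k + l))
      = (\<Sum>n\<in>(\<lambda>l. k + l) ` T. \<pi> (\<lambda>x. a k x * \<alpha> k (b (n - k)) x) * U n)"
      by (subst sum.reindex) (auto simp: inj_on_def)
    also have "\<dots> = (\<Sum>n\<in>N. \<pi> (\<lambda>x. a k x * \<alpha> k (b (n - k)) x) * U n)"
    proof (rule sum.mono_neutral_left[OF N])
      show "(\<lambda>l. k + l) ` T \<subseteq> N" using k by (auto simp: N_def)
      show "\<forall>n\<in>N - (\<lambda>l. k + l) ` T. \<pi> (\<lambda>x. a k x * \<alpha> k (b (n - k)) x) * U n = 0"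
      proof
        fix n assume n: "n \<in> N - (\<lambda>l. k + l) ` T"
        have "n - k \<notin> T"
        proof
          assume "n - k \<in> T"
          then have "k + (n - k) \<in> (\<lambda>l. k + l) ` T" by blast
          with n show False by simp
        qed
        then have "b (n - k) = (\<lambda>x. 0)" by (simp add: T_def)
        then show "\<pi> (\<lambda>x. a k x * \<alpha> k (b (n - k)) x) * U n = 0" by simp
      qed
    qed
    finally show "(\<Sum>n\<in>N. \<pi> (\<lambda>x. a k x * \<alpha> k (b (n - k)) x) * U n) =
        (\<Sum>l\<in>T. \<pi> (\<lambda>x. a k x * \<alpha> k (b l) x) * U (k + l))" by simp
  qed simp
  also have "\<dots> = IF a * IF b"
    unfolding t by (simp add: integrated_form_def S_def T_def sum_product)
  finally show "IF (conv_mult X \<sigma> a b) = IF a * IF b" .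
qed

text \<open>This is how the universal property of the crossed product becomes available: it bounds the
  integrated form of every covariant pair in the same algebra.\<close>

lemma cstar_seminorm_IF: "cstar_seminorm X \<sigma> (\<lambda>a. norm (IF a))"
  by (simp add: cstar_seminorm_def IF_add IF_scale IF_adj IF_mult norm_triangle_ineq norm_mult_ineq
      norm_scaleC cstar_identity)

text \<open>The gauge action: the unitary may be multiplied by a scalar of modulus one.\<close>

lemma covariant_pair_rotate:
  assumes "cmod z = 1" shows "covariant_pair X \<sigma> \<pi> (scaleC z u)"
proof -
  have "z * cnj z = 1" "cnj z * z = 1" using complex_norm_square[of z] assms by (simp_all add: mult.commute)
  then show ?thesis
    by unfold_locales (simp_all add: pi_add pi_scale pi_mult pi_adj pi_one unitary covariant adj_scaleC mult_scaleC_left mult_scaleC_right scaleC_scaleC)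
qed

lemma scaleC_power: "(scaleC z x) ^ n = scaleC (z ^ n) (x ^ n :: 'b::unital_cstar_algebra)"
  by (induction n) (simp_all add: mult_scaleC_left mult_scaleC_right scaleC_scaleC mult.commute)

lemma unitary_pow_scale:
  assumes "cmod z = 1" shows "unitary_pow (scaleC z u) n = scaleC (z powi n) (U n)"
proof -
  have "inverse z = cnj z" using complex_norm_square[of z] assms by (intro inverse_unique) simp
  then show ?thesis by (simp add: unitary_pow_def adj_scaleC scaleC_power power_int_def)
qed

end

section \<open>Fourier coefficients and Fejer means\<close>

lemma root_of_unity_orthogonality:
  fixes m :: int and R :: nat
  assumes "\<bar>m\<bar> < int R"
  shows "(\<Sum>j<R. cis (2 * pi * real j / real R) powi m) = (if m = 0 then of_nat R else 0)"
proof (cases "m = 0")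
  case False
  define w where "w = cis (2 * pi * m / R)"
  have R: "R > 0" using assms by auto
  have "cis (2 * pi * j / R) powi m = w ^ j" for j :: nat
    unfolding w_def Complex.DeMoivre cis_power_int by (rule arg_cong[of _ _ cis]) (simp add: field_simps)
  then have "(\<Sum>j<R. cis (2 * pi * real j / real R) powi m) = (\<Sum>j<R. w ^ j)" by simp
  also have "w \<noteq> 1"
  proof
    assume "w = 1"
    then have "cos (2 * pi * m / R) = 1" by (simp add: w_def complex_eq_iff)
    then obtain n :: int where "2 * pi * m / R = n * 2 * pi" using cos_one_2pi_int by auto
    then have "real_of_int m = real_of_int (n * int R)" using R by (simp add: field_simps)
    then have "m = n * int R" by (simp only: of_int_eq_iff)
    then show False using assms False by (auto simp: abs_mult)
  qed
  then have "(\<Sum>j<R. w ^ j) = (w ^ R - 1) / (w - 1)" by (rule geometric_sum)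
  also have "w ^ R = cis (2 * pi * m)" using R by (simp add: w_def Complex.DeMoivre)
  finally show ?thesis using False by simp
qed simp

text \<open>The weight is \<open>max 0 (1 - \<bar>n\<bar> / N)\<close>, given as the number of representations of \<open>n\<close> as a difference
  because that is what the roots of unity produce.\<close>

definition fejer :: "nat \<Rightarrow> int \<Rightarrow> real" where
  "fejer N n = (\<Sum>k<N. \<Sum>l<N. if int k - int l + n = 0 then 1 else 0) / N"

lemma fejer_zero: "N > 0 \<Longrightarrow> fejer N 0 = 1"
  by (simp add: fejer_def)

lemma fejer_outside: "n \<notin> {- int N..int N} \<Longrightarrow> fejer N n = 0"
proof -
  assume "n \<notin> {- int N..int N}"
  then have "(\<Sum>k<N. \<Sum>l<N. if int k - int l + n = 0 then 1 else (0::real)) = 0"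
    by (intro sum.neutral ballI) auto
  then show ?thesis by (simp add: fejer_def)
qed

lemma fejer_near_one:
  assumes "N > 0" shows "\<bar>1 - fejer N n\<bar> \<le> \<bar>n\<bar> / N"
proof -
  define G where "G = {k\<in>{..<N}. 0 \<le> int k + n \<and> int k + n < N}"
  have inner: "(\<Sum>l<N. if int k - int l + n = 0 then 1 else 0) = (if k \<in> G then 1 else (0::real))" if "k < N" for k
  proof -
    have "(int k - int l + n = 0) = (l = nat (int k + n) \<and> 0 \<le> int k + n)" for l by auto
    then show ?thesis using that by (auto simp: G_def sum.delta nat_less_iff)
  qed
  have "(\<Sum>k<N. \<Sum>l<N. if int k - int l + n = 0 then 1 else (0::real)) = (\<Sum>k<N. if k \<in> G then 1 else 0)"
    using inner by (intro sum.cong) auto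
  also have "\<dots> = card G"
    by (simp add: sum.If_cases G_def Int_def)
  finally have f: "fejer N n = card G / N" by (simp add: fejer_def)
  have "{..<N} - G \<subseteq> (if n \<ge> 0 then {N - nat n..<N} else {..<nat (- n)})"
    by (auto simp: G_def)
  then have "card ({..<N} - G) \<le> card (if n \<ge> 0 then {N - nat n..<N} else {..<nat (- n)})"
    by (intro card_mono) auto
  also have "\<dots> \<le> nat \<bar>n\<bar>" by auto
  finally have "card ({..<N} - G) \<le> nat \<bar>n\<bar>" .
  moreover have "card ({..<N} - G) = N - card G"
    by (subst card_Diff_subset) (auto simp: G_def)
  moreover have "card G \<le> N" using card_mono[of "{..<N}" G] by (auto simp: G_def)
  ultimately have "real N - card G \<le> \<bar>n\<bar>" "card G \<le> real N" by linarith+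
  moreover have "1 - fejer N n = (real N - card G) / N" using assms by (simp add: f diff_divide_distrib)
  ultimately show ?thesis by (simp add: divide_right_mono)
qed

lemma tendsto_fejer: "(\<lambda>N. fejer N n) \<longlonglongrightarrow> 1"
proof -
  have "(\<lambda>N. \<bar>real_of_int n\<bar> / real N) \<longlonglongrightarrow> 0" by (rule lim_const_over_n)
  then have "(\<lambda>N. 1 - fejer N n) \<longlonglongrightarrow> 0"
    by (rule Lim_null_comparison[rotated])
       (use fejer_near_one in \<open>auto intro!: eventually_sequentiallyI[of 1]\<close>)
  then have "(\<lambda>N. 1 - (1 - fejer N n)) \<longlonglongrightarrow> 1 - 0" by (intro tendsto_intros)
  then show ?thesis by simp
qed

text \<open>Averages over roots of unity replace the integrals over the circle in the usual formula for
  Fejer means. The weights \<open>w j\<close> are non-negative because they are values of the Fejer kernel.\<close>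

lemma fejer_roots:
  assumes N: "N > 0" and n: "\<bar>n\<bar> + int N \<le> int R"
  defines "z \<equiv> \<lambda>j. cis (2 * pi * real j / real R)"
  defines "w \<equiv> \<lambda>j. of_real ((cmod (\<Sum>k<N. z j ^ k))\<^sup>2 / (N * R)) :: complex"
  shows "(\<Sum>j<R. w j * z j powi n) = fejer N n"
proof -
  have R: "R > 0" using N n by auto
  have z: "z j \<noteq> 0" "cnj (z j) = inverse (z j)" for j
    by (auto simp: z_def cis_cnj cis_inverse)
  have w: "w j = (\<Sum>k<N. \<Sum>l<N. z j powi (int k - int l)) / (N * R)" for j
  proof -
    have "of_real ((cmod (\<Sum>k<N. z j ^ k))\<^sup>2) = (\<Sum>k<N. z j ^ k) * (\<Sum>l<N. inverse (z j) ^ l)"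
      by (simp add: complex_norm_square z del: of_real_power)
    also have "\<dots> = (\<Sum>k<N. \<Sum>l<N. z j ^ k * inverse (z j) ^ l)"
      by (simp add: sum_product)
    also have "\<dots> = (\<Sum>k<N. \<Sum>l<N. z j powi (int k - int l))"
      using z by (simp add: power_int_diff divide_inverse power_inverse)
    finally show ?thesis by (simp add: w_def del: of_real_power)
  qed
  have "(\<Sum>j<R. w j * z j powi n) = (\<Sum>j<R. \<Sum>k<N. \<Sum>l<N. z j powi (int k - int l + n)) / (N * R)"
    using z by (simp add: w power_int_add sum_distrib_right sum_divide_distrib)
  also have "(\<Sum>j<R. \<Sum>k<N. \<Sum>l<N. z j powi (int k - int l + n))
      = (\<Sum>k<N. \<Sum>l<N. \<Sum>j<R. z j powi (int k - int l + n))"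
    by (subst sum.swap, rule sum.cong[OF refl], rule sum.swap)
  also have "\<dots> = (\<Sum>k<N. \<Sum>l<N. if int k - int l + n = 0 then of_nat R else 0)"
  proof (intro sum.cong refl)
    fix k l assume "k \<in> {..<N}" "l \<in> {..<N}"
    then have "\<bar>int k - int l + n\<bar> < int R" using n by auto
    then show "(\<Sum>j<R. z j powi (int k - int l + n)) = (if int k - int l + n = 0 then of_nat R else 0)"
      unfolding z_def by (rule root_of_unity_orthogonality)
  qed
  also have "\<dots> = of_nat R * (\<Sum>k<N. \<Sum>l<N. if int k - int l + n = 0 then 1 else 0)"
    by (simp add: sum_distrib_left if_distrib cong: if_cong)
  also have "\<dots> / (N * R) = fejer N n"
    using R N by (simp add: fejer_def if_distrib cong: if_cong)
  finally show ?thesis .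
qed

text \<open>Building on covariant pairs makes the same facts available for \<open>\<delta>\<close> and for its rotations \<open>z \<delta>\<close>, to which
  universality is applied.\<close>

locale crossed_product_dynamics = covariant_pair X \<sigma> \<pi> \<delta>
  for X :: "'x topology" and \<sigma> and \<pi> :: "('x \<Rightarrow> complex) \<Rightarrow> 'a::unital_cstar_algebra" and \<delta> +
  assumes pi_inj: "inj_on \<pi> (CX X)"
    and dense: "closure (integrated_form \<pi> \<delta> ` conv_carrier X) = UNIV"
    and universal: "\<lbrakk>cstar_seminorm X \<sigma> p; a \<in> conv_carrier X\<rbrakk>
          \<Longrightarrow> p a \<le> norm (integrated_form \<pi> \<delta> a)"
begin

text \<open>The gauge action is contractive, by universality.\<close>

lemma norm_rotate_le:
  assumes a: "a \<in> conv_carrier X" and S: "finite S" "{n. a n \<noteq> (\<lambda>x. 0)} \<subseteq> S" and z: "cmod z = 1"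
  shows "norm (\<Sum>n\<in>S. scaleC (z powi n) (\<pi> (a n) * U n)) \<le> norm (IF a)"
proof -
  interpret r: covariant_pair X \<sigma> \<pi> "scaleC z \<delta>" by (rule covariant_pair_rotate[OF z])
  have "norm (integrated_form \<pi> (scaleC z \<delta>) a) \<le> norm (IF a)"
    by (rule universal[OF r.cstar_seminorm_IF a])
  also have "integrated_form \<pi> (scaleC z \<delta>) a = (\<Sum>n\<in>S. scaleC (z powi n) (\<pi> (a n) * U n))"
    unfolding r.IF_eq[OF S] by (simp add: unitary_pow_scale[OF z] mult_scaleC_right)
  finally show ?thesis .
qed

text \<open>A Fourier multiplier is bounded by the total mass of the measure on the circle whose transform
  it is.\<close>

lemma norm_multiplier_le:
  assumes a: "a \<in> conv_carrier X" and S: "finite S" "{n. a n \<noteq> (\<lambda>x. 0)} \<subseteq> S"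
    and z: "\<And>j. j \<in> I \<Longrightarrow> cmod (z j) = 1"
  shows "norm (\<Sum>n\<in>S. scaleC (\<Sum>j\<in>I. w j * z j powi n) (\<pi> (a n) * U n)) \<le> (\<Sum>j\<in>I. cmod (w j)) * norm (IF a)"
proof -
  have "(\<Sum>n\<in>S. scaleC (\<Sum>j\<in>I. w j * z j powi n) (\<pi> (a n) * U n))
      = (\<Sum>n\<in>S. \<Sum>j\<in>I. scaleC (w j) (scaleC (z j powi n) (\<pi> (a n) * U n)))"
    by (simp add: scaleC_sum_left scaleC_scaleC)
  also have "\<dots> = (\<Sum>j\<in>I. scaleC (w j) (\<Sum>n\<in>S. scaleC (z j powi n) (\<pi> (a n) * U n)))"
    by (subst sum.swap) (simp add: scaleC_sum_right)
  finally have eq: "(\<Sum>n\<in>S. scaleC (\<Sum>j\<in>I. w j * z j powi n) (\<pi> (a n) * U n)) = \<dots>" .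
  show ?thesis
    unfolding eq sum_distrib_right using norm_rotate_le[OF a S] z
    by (intro sum_norm_le) (simp add: norm_scaleC mult_left_mono)
qed

lemma support_bound:
  assumes "a \<in> conv_carrier X" obtains M :: nat where "{n. a n \<noteq> (\<lambda>x. 0)} \<subseteq> {- int M..int M}"
proof -
  have "finite {n. a n \<noteq> (\<lambda>x. 0)}" using assms by (simp add: conv_carrier_def)
  then obtain k where k: "\<And>n. a n \<noteq> (\<lambda>x. 0) \<Longrightarrow> \<bar>n\<bar> \<le> k"
    using finite_imageI[THEN bdd_above_finite, of "{n. a n \<noteq> (\<lambda>x. 0)}" abs] by (auto simp: bdd_above_def)
  show thesis by (rule that[of "nat k"]) (use k in fastforce)
qed

lemma norm_coefficient_le:
  assumes a: "a \<in> conv_carrier X"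
  shows "norm (\<pi> (a n)) \<le> norm (IF a)"
proof -
  obtain M where M: "{n. a n \<noteq> (\<lambda>x. 0)} \<subseteq> {- int M..int M}" using support_bound[OF a] .
  \<comment> \<open>With more roots of unity than degrees in play, averaging against \<open>z powi (- n)\<close> keeps degree \<open>n\<close> only.\<close>
  define M' where "M' = M + nat \<bar>n\<bar>"
  have M': "{n. a n \<noteq> (\<lambda>x. 0)} \<subseteq> {- int M'..int M'}" by (rule order_trans[OF M]) (auto simp: M'_def)
  define R where "R = 2 * M' + 1"
  define z where "z = (\<lambda>j. cis (2 * pi * real j / real R))"
  have z: "cmod (z j) = 1" "z j \<noteq> 0" for j by (simp_all add: z_def)
  have m: "(\<Sum>j<R. (z j powi (- n) / R) * z j powi i) = (if i = n then 1 else 0)" if "i \<in> {- int M'..int M'}" for i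
  proof -
    have R: "\<bar>i - n\<bar> < int R" "R > 0" using that by (auto simp: R_def M'_def)
    have "z j powi (- n) / R * z j powi i = z j powi (i - n) / R" for j
      using z by (simp add: power_int_diff power_int_minus field_simps)
    then have "(\<Sum>j<R. (z j powi (- n) / R) * z j powi i) = (\<Sum>j<R. z j powi (i - n)) / R"
      by (simp only: sum_divide_distrib)
    also have "\<dots> = (if i = n then 1 else 0)"
      unfolding z_def using that R by (subst root_of_unity_orthogonality) auto
    finally show ?thesis .
  qed
  have "norm (\<Sum>i\<in>{- int M'..int M'}. scaleC (\<Sum>j<R. (z j powi (- n) / R) * z j powi i) (\<pi> (a i) * U i))
      \<le> (\<Sum>j<R. cmod (z j powi (- n) / R)) * norm (IF a)"
    by (rule norm_multiplier_le[OF a _ M']) (use z in auto)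
  also have "(\<Sum>j<R. cmod (z j powi (- n) / R)) = 1"
  proof -
    have "R > 0" by (simp add: R_def)
    then show ?thesis using z by (simp add: norm_divide norm_power_int)
  qed
  also have "(\<Sum>i\<in>{- int M'..int M'}. scaleC (\<Sum>j<R. (z j powi (- n) / R) * z j powi i) (\<pi> (a i) * U i))
      = (\<Sum>i\<in>{- int M'..int M'}. if i = n then \<pi> (a i) * U i else 0)"
  proof (intro sum.cong refl)
    fix i assume "i \<in> {- int M'..int M'}"
    from m[OF this] show "scaleC (\<Sum>j<R. (z j powi (- n) / R) * z j powi i) (\<pi> (a i) * U i) =
        (if i = n then \<pi> (a i) * U i else 0)"
      by (simp only:) simp
  qed
  also have "n \<in> {- int M'..int M'}" by (auto simp: M'_def)
  then have "(\<Sum>i\<in>{- int M'..int M'}. if i = n then \<pi> (a i) * U i else 0) = \<pi> (a n) * U n"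
    by simp
  finally show ?thesis by (simp add: norm_mult_U)
qed

text \<open>The Fejer kernel has total mass one.\<close>

lemma norm_fejer_le:
  assumes a: "a \<in> conv_carrier X" and N: "N > 0"
  shows "norm (\<Sum>n\<in>{- int N..int N}. scaleC (fejer N n) (\<pi> (a n) * U n)) \<le> norm (IF a)"
proof -
  obtain M where M: "{n. a n \<noteq> (\<lambda>x. 0)} \<subseteq> {- int M..int M}" using support_bound[OF a] .
  define R where "R = N + M"
  define z where "z = (\<lambda>j. cis (2 * pi * real j / real R))"
  define w where "w = (\<lambda>j. of_real ((cmod (\<Sum>k<N. z j ^ k))\<^sup>2 / (N * R)) :: complex)"
  have z: "cmod (z j) = 1" for j by (simp add: z_def)
  have m: "(\<Sum>j<R. w j * z j powi n) = fejer N n" if "\<bar>n\<bar> \<le> int M" for n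
    unfolding w_def z_def by (rule fejer_roots[OF N]) (use that in \<open>simp add: R_def\<close>)
  have "of_real (\<Sum>j<R. cmod (w j)) = (\<Sum>j<R. w j * z j powi 0)"
    by (simp add: w_def norm_divide norm_mult norm_power)
  also have "\<dots> = 1" using m[of 0] N by (simp add: fejer_zero)
  finally have total: "(\<Sum>j<R. cmod (w j)) = 1" by (simp only: of_real_eq_1_iff)
  have "(\<Sum>n\<in>{- int N..int N}. scaleC (fejer N n) (\<pi> (a n) * U n))
      = (\<Sum>n\<in>{- int M..int M}. scaleC (fejer N n) (\<pi> (a n) * U n))"
  proof (rule sum.mono_neutral_cong)
    fix n assume "n \<in> {- int N..int N} - {- int M..int M}"
    then have "a n = (\<lambda>x. 0)" using M by blast
    then show "scaleC (fejer N n) (\<pi> (a n) * U n) = 0" by simp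
  qed (auto simp: fejer_outside)
  also have "\<dots> = (\<Sum>n\<in>{- int M..int M}. scaleC (\<Sum>j<R. w j * z j powi n) (\<pi> (a n) * U n))"
    by (intro sum.cong) (auto simp: m)
  also have "norm \<dots> \<le> (\<Sum>j<R. cmod (w j)) * norm (IF a)"
    by (rule norm_multiplier_le[OF a _ M]) (use z in auto)
  finally show ?thesis by (simp add: total)
qed

lemma conv_carrier_diff:
  assumes "a \<in> conv_carrier X" "b \<in> conv_carrier X"
  shows "(\<lambda>n x. a n x + (- 1) * b n x) \<in> conv_carrier X"
    "IF (\<lambda>n x. a n x + (- 1) * b n x) = IF a - IF b"
    "\<pi> (\<lambda>x. a n x + (- 1) * b n x) = \<pi> (a n) - \<pi> (b n)"
proof -
  have b: "(\<lambda>n x. (- 1) * b n x) \<in> conv_carrier X"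
    using assms(2) CX_scale[of _ X "- 1"] by (auto simp: conv_carrier_def fun_eq_iff)
  have "finite ({n. a n \<noteq> (\<lambda>x. 0)} \<union> {n. b n \<noteq> (\<lambda>x. 0)})"
    using assms by (simp add: conv_carrier_def)
  then have "finite {n. (\<lambda>x. a n x + (- 1) * b n x) \<noteq> (\<lambda>x. 0)}"
    by (rule rev_finite_subset) auto
  then show "(\<lambda>n x. a n x + (- 1) * b n x) \<in> conv_carrier X"
    using assms(1) b CX_add unfolding conv_carrier_def by blast
  show "IF (\<lambda>n x. a n x + (- 1) * b n x) = IF a - IF b"
    by (subst IF_add[OF assms(1) b], subst IF_scale[OF assms(2)]) (simp add: scaleC_minus_one)
  have ab: "a n \<in> CX X" "b n \<in> CX X" using assms by (auto simp: conv_carrier_def)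
  show "\<pi> (\<lambda>x. a n x + (- 1) * b n x) = \<pi> (a n) - \<pi> (b n)"
    by (subst pi_add[OF ab(1) CX_scale[OF ab(2)]], subst pi_scale[OF ab(2)]) (simp add: scaleC_minus_one)
qed

text \<open>The Fourier coefficients extend from the convolution algebra by continuity. By \<open>tendsto_fourier_coeff\<close>
  any other approximating sequence gives the same limit.\<close>

definition approximant :: "'a \<Rightarrow> nat \<Rightarrow> int \<Rightarrow> 'x \<Rightarrow> complex" where
  "approximant a k = (SOME b. b \<in> conv_carrier X \<and> norm (IF b - a) < inverse (Suc k))"

definition fourier_coeff :: "int \<Rightarrow> 'a \<Rightarrow> 'a" where
  "fourier_coeff n a = lim (\<lambda>k. \<pi> (approximant a k n))"

lemma exists_approximant:
  assumes "\<epsilon> > 0" obtains b where "b \<in> conv_carrier X" "norm (IF b - a) < \<epsilon>"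
  using closure_approachable[of a "IF ` conv_carrier X"] dense assms by (auto simp: dist_norm)

lemma approximant: "approximant a k \<in> conv_carrier X" "(\<lambda>k. IF (approximant a k)) \<longlonglongrightarrow> a"
proof -
  have *: "approximant a k \<in> conv_carrier X \<and> norm (IF (approximant a k) - a) < inverse (Suc k)" for k
  proof -
    have "inverse (real (Suc k)) > 0" by simp
    then have "\<exists>b. b \<in> conv_carrier X \<and> norm (IF b - a) < inverse (Suc k)"
      using exists_approximant[of _ a] by blast
    then show ?thesis unfolding approximant_def by (rule someI_ex)
  qed
  then show "approximant a k \<in> conv_carrier X" by blast
  have "(\<lambda>k. IF (approximant a k) - a) \<longlonglongrightarrow> 0"
    by (rule Lim_null_comparison[OF _ LIMSEQ_inverse_real_of_nat])
       (intro always_eventually allI less_imp_le conjunct2[OF *])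
  then show "(\<lambda>k. IF (approximant a k)) \<longlonglongrightarrow> a" by (simp add: LIM_zero_iff)
qed

lemma norm_coefficient_diff_le:
  assumes "a \<in> conv_carrier X" "b \<in> conv_carrier X"
  shows "norm (\<pi> (a n) - \<pi> (b n)) \<le> norm (IF a - IF b)"
  using norm_coefficient_le[OF conv_carrier_diff(1)[OF assms], of n] by (simp only: conv_carrier_diff[OF assms])

lemma tendsto_fourier_coeff:
  assumes b: "\<And>k. b k \<in> conv_carrier X" and lim: "(\<lambda>k. IF (b k)) \<longlonglongrightarrow> a"
  shows "(\<lambda>k. \<pi> (b k n)) \<longlonglongrightarrow> fourier_coeff n a"
proof -
  have "Cauchy (\<lambda>k. IF (approximant a k))" using approximant(2) by (rule LIMSEQ_imp_Cauchy)
  have "Cauchy (\<lambda>k. \<pi> (approximant a k n))"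
  proof (rule CauchyI)
    fix e :: real assume "e > 0"
    from CauchyD[OF \<open>Cauchy (\<lambda>k. IF (approximant a k))\<close> this]
    obtain M where M: "\<And>k l. \<lbrakk>k \<ge> M; l \<ge> M\<rbrakk> \<Longrightarrow> norm (IF (approximant a k) - IF (approximant a l)) < e" by blast
    show "\<exists>M. \<forall>k\<ge>M. \<forall>l\<ge>M. norm (\<pi> (approximant a k n) - \<pi> (approximant a l n)) < e"
      by (intro exI allI impI le_less_trans[OF norm_coefficient_diff_le[OF approximant(1) approximant(1)] M])
  qed
  then obtain l where "(\<lambda>k. \<pi> (approximant a k n)) \<longlonglongrightarrow> l" using convergent_eq_Cauchy by blast
  then have 1: "(\<lambda>k. \<pi> (approximant a k n)) \<longlonglongrightarrow> fourier_coeff n a"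
    using limI[of _ l] unfolding fourier_coeff_def by (simp only:)
  have "(\<lambda>k. norm (IF (b k) - IF (approximant a k))) \<longlonglongrightarrow> norm (a - a)"
    by (rule tendsto_norm[OF tendsto_diff[OF lim approximant(2)]])
  then have lim0: "(\<lambda>k. norm (IF (b k) - IF (approximant a k))) \<longlonglongrightarrow> 0" by simp
  have "(\<lambda>k. \<pi> (b k n) - \<pi> (approximant a k n)) \<longlonglongrightarrow> 0"
    by (rule Lim_null_comparison[OF _ lim0])
       (intro always_eventually allI norm_coefficient_diff_le b approximant(1))
  from tendsto_add[OF this 1] show ?thesis by simp
qed

lemma fourier_coeff_IF: "b \<in> conv_carrier X \<Longrightarrow> fourier_coeff n (IF b) = \<pi> (b n)"
  by (rule LIMSEQ_unique[OF tendsto_fourier_coeff[of "\<lambda>_. b" "IF b" n] tendsto_const]) auto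

lemma norm_fourier_coeff_le: "norm (fourier_coeff n a) \<le> norm a"
  by (rule LIMSEQ_le[OF tendsto_norm[OF tendsto_fourier_coeff[OF approximant]] tendsto_norm[OF approximant(2)]])
     (intro exI[of _ 0] allI impI norm_coefficient_le approximant)

lemma fourier_coeff_diff: "fourier_coeff n (a - b) = fourier_coeff n a - fourier_coeff n b"
proof (rule LIMSEQ_unique)
  let ?d = "\<lambda>k m x. approximant a k m x + (- 1) * approximant b k m x"
  have "(\<lambda>k. IF (approximant a k) - IF (approximant b k)) \<longlonglongrightarrow> a - b"
    by (intro tendsto_intros approximant)
  then have "(\<lambda>k. IF (?d k)) \<longlonglongrightarrow> a - b"
    by (simp only: conv_carrier_diff[OF approximant(1) approximant(1)])
  then show "(\<lambda>k. \<pi> (?d k n)) \<longlonglongrightarrow> fourier_coeff n (a - b)"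
    by (intro tendsto_fourier_coeff conv_carrier_diff approximant)
  show "(\<lambda>k. \<pi> (?d k n)) \<longlonglongrightarrow> fourier_coeff n a - fourier_coeff n b"
    unfolding conv_carrier_diff[OF approximant(1) approximant(1)]
    by (intro tendsto_intros tendsto_fourier_coeff approximant)
qed

lemma fourier_coeff_in_closure: "fourier_coeff n a \<in> closure (\<pi> ` CX X)"
  unfolding closure_sequential
  by (rule exI[of _ "\<lambda>k. \<pi> (approximant a k n)"])
     (use approximant(1) tendsto_fourier_coeff[OF approximant] in \<open>auto simp: conv_carrier_def\<close>)

lemma conv_carrier_mult:
  assumes "b \<in> conv_carrier X" and g: "\<And>n. g n \<in> CX X"
  shows "(\<lambda>n x. g n x * b n x) \<in> conv_carrier X"
proof -
  have "finite {n. b n \<noteq> (\<lambda>x. 0)}" using assms by (simp add: conv_carrier_def)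
  then have "finite {n. (\<lambda>x. g n x * b n x) \<noteq> (\<lambda>x. 0)}" by (rule rev_finite_subset) auto
  then show ?thesis using assms CX_mult[OF g] by (simp add: conv_carrier_def)
qed

lemma IF_pi_left:
  assumes b: "b \<in> conv_carrier X" and f: "f \<in> CX X"
  shows "IF (\<lambda>n x. f x * b n x) = \<pi> f * IF b"
proof -
  have S: "finite {n. b n \<noteq> (\<lambda>x. 0)}" and bn: "b n \<in> CX X" for n using b by (simp_all add: conv_carrier_def)
  have "IF (\<lambda>n x. f x * b n x) = (\<Sum>n | b n \<noteq> (\<lambda>x. 0). \<pi> (\<lambda>x. f x * b n x) * U n)"
    by (rule IF_eq[OF S]) auto
  also have "\<dots> = \<pi> f * IF b"
    by (simp add: pi_mult[OF f bn] integrated_form_def sum_distrib_left mult.assoc)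
  finally show ?thesis .
qed

lemma IF_pi_right:
  assumes b: "b \<in> conv_carrier X" and f: "f \<in> CX X"
  shows "IF (\<lambda>n x. \<alpha> n f x * b n x) = IF b * \<pi> f"
proof -
  have S: "finite {n. b n \<noteq> (\<lambda>x. 0)}" and bn: "b n \<in> CX X" for n using b by (simp_all add: conv_carrier_def)
  have "IF (\<lambda>n x. \<alpha> n f x * b n x) = (\<Sum>n | b n \<noteq> (\<lambda>x. 0). \<pi> (\<lambda>x. b n x * \<alpha> n f x) * U n)"
    by (subst IF_eq[OF S]) (auto simp: mult.commute)
  also have "\<dots> = IF b * \<pi> f"
    by (simp add: pi_mult[OF bn alpha_in[OF f]] integrated_form_def sum_distrib_right mult.assoc U_pi[OF f])
  finally show ?thesis .
qed

lemma fourier_coeff_pi_left: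
  assumes f: "f \<in> CX X" shows "fourier_coeff n (\<pi> f * a) = \<pi> f * fourier_coeff n a"
proof (rule LIMSEQ_unique)
  have "(\<lambda>k. IF (\<lambda>n x. f x * approximant a k n x)) \<longlonglongrightarrow> \<pi> f * a"
    unfolding IF_pi_left[OF approximant(1) f] by (intro tendsto_intros approximant)
  then show "(\<lambda>k. \<pi> (\<lambda>x. f x * approximant a k n x)) \<longlonglongrightarrow> fourier_coeff n (\<pi> f * a)"
    by (rule tendsto_fourier_coeff[rotated]) (intro conv_carrier_mult approximant f)
  have "approximant a k n \<in> CX X" for k using approximant(1) by (simp add: conv_carrier_def)
  then show "(\<lambda>k. \<pi> (\<lambda>x. f x * approximant a k n x)) \<longlonglongrightarrow> \<pi> f * fourier_coeff n a"
    by (simp add: pi_mult[OF f] tendsto_mult tendsto_fourier_coeff approximant)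
qed

lemma fourier_coeff_pi_right:
  assumes f: "f \<in> CX X" shows "fourier_coeff n (a * \<pi> f) = fourier_coeff n a * \<pi> (\<alpha> n f)"
proof (rule LIMSEQ_unique)
  have "(\<lambda>k. IF (\<lambda>n x. \<alpha> n f x * approximant a k n x)) \<longlonglongrightarrow> a * \<pi> f"
    unfolding IF_pi_right[OF approximant(1) f] by (intro tendsto_intros approximant)
  then show "(\<lambda>k. \<pi> (\<lambda>x. \<alpha> n f x * approximant a k n x)) \<longlonglongrightarrow> fourier_coeff n (a * \<pi> f)"
    by (rule tendsto_fourier_coeff[rotated]) (intro conv_carrier_mult approximant alpha_in f)
  have "approximant a k n \<in> CX X" for k using approximant(1) by (simp add: conv_carrier_def)
  from pi_mult[OF this alpha_in[OF f, of n]]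
  have "\<pi> (\<lambda>x. \<alpha> n f x * approximant a k n x) = \<pi> (approximant a k n) * \<pi> (\<alpha> n f)" for k
    by (simp only: mult.commute[of "\<alpha> n f _"])
  then show "(\<lambda>k. \<pi> (\<lambda>x. \<alpha> n f x * approximant a k n x)) \<longlonglongrightarrow> fourier_coeff n a * \<pi> (\<alpha> n f)"
    by (simp add: tendsto_mult tendsto_fourier_coeff approximant)
qed

lemma IF_U_right:
  assumes b: "b \<in> conv_carrier X"
  shows "(\<lambda>n. b (n - m)) \<in> conv_carrier X" "IF (\<lambda>n. b (n - m)) = IF b * U m"
proof -
  define S where "S = {n. b n \<noteq> (\<lambda>x. 0)}"
  have S: "finite S" using b by (simp add: conv_carrier_def S_def)
  have sub: "{n. b (n - m) \<noteq> (\<lambda>x. 0)} \<subseteq> (\<lambda>n. n + m) ` S"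
  proof
    fix n assume "n \<in> {n. b (n - m) \<noteq> (\<lambda>x. 0)}"
    then have "n - m \<in> S" by (simp add: S_def)
    then have "(n - m) + m \<in> (\<lambda>n. n + m) ` S" by blast
    then show "n \<in> (\<lambda>n. n + m) ` S" by simp
  qed
  then show "(\<lambda>n. b (n - m)) \<in> conv_carrier X"
    using b S finite_subset[OF sub] by (simp add: conv_carrier_def)
  have "IF (\<lambda>n. b (n - m)) = (\<Sum>n\<in>(\<lambda>n. n + m) ` S. \<pi> (b (n - m)) * U n)"
    using S sub by (intro IF_eq) auto
  also have "\<dots> = (\<Sum>n\<in>S. \<pi> (b n) * U (n + m))"
    by (subst sum.reindex) (auto simp: inj_on_def)
  also have "\<dots> = IF b * U m"
    by (simp add: U_add integrated_form_def S_def sum_distrib_right mult.assoc)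
  finally show "IF (\<lambda>n. b (n - m)) = IF b * U m" .
qed

lemma fourier_coeff_U_right: "fourier_coeff n (a * U m) = fourier_coeff (n - m) a"
proof (rule LIMSEQ_unique)
  have "(\<lambda>k. IF (\<lambda>n. approximant a k (n - m))) \<longlonglongrightarrow> a * U m"
    unfolding IF_U_right(2)[OF approximant(1)] by (intro tendsto_intros approximant)
  then show "(\<lambda>k. \<pi> (approximant a k (n - m))) \<longlonglongrightarrow> fourier_coeff n (a * U m)"
    by (rule tendsto_fourier_coeff[rotated]) (intro IF_U_right approximant)
  show "(\<lambda>k. \<pi> (approximant a k (n - m))) \<longlonglongrightarrow> fourier_coeff (n - m) a"
    by (intro tendsto_fourier_coeff approximant)
qed

definition fejer_mean :: "nat \<Rightarrow> 'a \<Rightarrow> 'a" where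
  "fejer_mean N a = (\<Sum>n\<in>{- int N..int N}. scaleC (fejer N n) (fourier_coeff n a * U n))"

lemma norm_fejer_mean_le:
  assumes "N > 0" shows "norm (fejer_mean N a) \<le> norm a"
proof (rule LIMSEQ_le)
  show "(\<lambda>k. norm (\<Sum>n\<in>{- int N..int N}. scaleC (fejer N n) (\<pi> (approximant a k n) * U n))) \<longlonglongrightarrow> norm (fejer_mean N a)"
    unfolding fejer_mean_def scaleC_of_real
    by (intro tendsto_intros tendsto_fourier_coeff approximant)
  show "(\<lambda>k. norm (IF (approximant a k))) \<longlonglongrightarrow> norm a" by (intro tendsto_intros approximant)
qed (use norm_fejer_le[OF approximant(1) assms] in auto)

lemma fejer_mean_diff: "fejer_mean N (a - b) = fejer_mean N a - fejer_mean N b"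
  by (simp add: fejer_mean_def fourier_coeff_diff left_diff_distrib scaleC_diff_right sum_subtractf)

lemma fejer_mean_IF_tendsto:
  assumes b: "b \<in> conv_carrier X" shows "(\<lambda>N. fejer_mean N (IF b)) \<longlonglongrightarrow> IF b"
proof -
  obtain M where M: "{n. b n \<noteq> (\<lambda>x. 0)} \<subseteq> {- int M..int M}" using support_bound[OF b] .
  have "(\<lambda>N. \<Sum>n\<in>{- int M..int M}. scaleC (fejer N n) (\<pi> (b n) * U n)) \<longlonglongrightarrow> (\<Sum>n\<in>{- int M..int M}. 1 *\<^sub>R (\<pi> (b n) * U n))"
    unfolding scaleC_of_real by (intro tendsto_intros tendsto_fejer)
  also have "(\<Sum>n\<in>{- int M..int M}. 1 *\<^sub>R (\<pi> (b n) * U n)) = IF b" using IF_eq[OF _ M] by simp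
  finally show ?thesis
  proof (rule Lim_transform_eventually)
    show "\<forall>\<^sub>F N in sequentially. (\<Sum>n\<in>{- int M..int M}. scaleC (fejer N n) (\<pi> (b n) * U n)) = fejer_mean N (IF b)"
    proof (rule eventually_sequentiallyI[of M])
      fix N assume "M \<le> N"
      then show "(\<Sum>n\<in>{- int M..int M}. scaleC (fejer N n) (\<pi> (b n) * U n)) = fejer_mean N (IF b)"
        unfolding fejer_mean_def fourier_coeff_IF[OF b]
      proof (intro sum.mono_neutral_left ballI)
        fix n assume "n \<in> {- int N..int N} - {- int M..int M}"
        then have "b n = (\<lambda>x. 0)" using M by blast
        then show "scaleC (fejer N n) (\<pi> (b n) * U n) = 0" by simp
      qed auto
    qed
  qed
qed

text \<open>The means converge on the dense convolution algebra and are uniformly contractive.\<close>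

lemma fejer_mean_tendsto: "(\<lambda>N. fejer_mean N a) \<longlonglongrightarrow> a"
proof (rule LIMSEQ_I)
  fix r :: real assume "r > 0"
  then obtain b where b: "b \<in> conv_carrier X" "norm (IF b - a) < r / 3"
    using exists_approximant[of "r / 3" a] by auto
  obtain N0 where N0: "\<And>N. N \<ge> N0 \<Longrightarrow> norm (fejer_mean N (IF b) - IF b) < r / 3"
    using LIMSEQ_D[OF fejer_mean_IF_tendsto[OF b(1)], of "r / 3"] \<open>r > 0\<close> by auto
  show "\<exists>N0. \<forall>N\<ge>N0. norm (fejer_mean N a - a) < r"
  proof (intro exI allI impI)
    fix N assume N: "N \<ge> Suc N0"
    have "norm (fejer_mean N (IF b - a)) \<le> norm (IF b - a)" using N by (intro norm_fejer_mean_le) auto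
    moreover have "norm (fejer_mean N a - a) = norm ((fejer_mean N (IF b) - IF b) + (IF b - a) - fejer_mean N (IF b - a))"
      by (simp add: fejer_mean_diff)
    moreover have "norm ((fejer_mean N (IF b) - IF b) + (IF b - a) - fejer_mean N (IF b - a)) \<le>
       norm (fejer_mean N (IF b) - IF b) + norm (IF b - a) + norm (fejer_mean N (IF b - a))"
      by (meson add_mono_thms_linordered_semiring(3) norm_triangle_ineq norm_triangle_ineq4 order_trans)
    moreover have "norm (fejer_mean N (IF b) - IF b) < r / 3" using N by (intro N0) simp
    ultimately show "norm (fejer_mean N a - a) < r" using b(2) by linarith
  qed
qed

lemma eq_zero_if_fourier_coeff_zero:
  assumes "\<And>n. fourier_coeff n a = 0" shows "a = 0"
proof -
  have "fejer_mean N a = 0" for N by (simp add: fejer_mean_def assms)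
  then show ?thesis using fejer_mean_tendsto[of a] LIMSEQ_unique[OF _ tendsto_const] by fastforce
qed

end

section \<open>The commutant of the function algebra\<close>

context topological_dynamical_system
begin

lemma exists_bump:
  assumes "openin X W" "x0 \<in> W"
  shows "\<exists>h\<in>CX X. h x0 = 1 \<and> (\<forall>x. x \<notin> W \<longrightarrow> h x = 0) \<and> (\<forall>x. cmod (h x) \<le> 1)"
proof -
  have norm: "normal_space X"
    using compact Hausdorff compact_Hausdorff_or_regular_imp_normal_space by blast
  have x0: "x0 \<in> topspace X" using assms openin_subset by blast
  have "closedin X {x0}" using Hausdorff x0 by (simp add: closedin_Hausdorff_singleton)
  moreover have "closedin X (topspace X - W)" using assms by blast
  moreover have "disjnt (topspace X - W) {x0}" using assms by (auto simp: disjnt_def)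
  ultimately obtain g where g: "continuous_map X (top_of_set {0..1::real}) g"
    "g ` (topspace X - W) \<subseteq> {0}" "g ` {x0} \<subseteq> {1}"
    using Urysohn_lemma[OF norm, of "topspace X - W" "{x0}" 0 1] by (metis zero_le_one)
  define h where "h = (\<lambda>x. if x \<in> topspace X then complex_of_real (g x) else 0)"
  have gc: "continuous_map X euclidean g" "\<And>x. x \<in> topspace X \<Longrightarrow> g x \<in> {0..1}"
    using g(1) by (auto simp: continuous_map_in_subtopology)
  have "continuous_map X euclidean (\<lambda>x. complex_of_real (g x))"
    using gc(1) by (auto simp: continuous_map_atin intro!: tendsto_of_real)
  then have "continuous_map X euclidean h"
    by (rule continuous_map_eq) (simp add: h_def)
  then have "h \<in> CX X" by (simp add: CX_def h_def)
  moreover have "h x0 = 1" using g(3) x0 by (simp add: h_def)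
  moreover have "h x = 0" if "x \<notin> W" for x using g(2) that by (auto simp: h_def)
  moreover have "cmod (h x) \<le> 1" for x using gc(2)[of x] by (simp add: h_def)
  ultimately show ?thesis by blast
qed

text \<open>For a single power \<open>k\<close>, either the power fixes \<open>W\<close> pointwise or it moves some point of \<open>W\<close>, and then it
  moves a whole neighbourhood off itself. Both properties pass to smaller open sets, so finitely many
  powers can be treated in turn.\<close>

lemma exists_separating_open:
  assumes W: "openin X W" "W \<noteq> {}" and "finite S"
  shows "\<exists>V. openin X V \<and> V \<noteq> {} \<and> V \<subseteq> W \<and>
           (\<forall>k\<in>S. (\<forall>x\<in>V. shift k x \<notin> V) \<or> (\<forall>x\<in>V. shift k x = x))"
  using \<open>finite S\<close>
proof (induction S rule: finite_induct)
  case empty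
  then show ?case using W by blast
next
  case (insert k S)
  then obtain V where V: "openin X V" "V \<noteq> {}" "V \<subseteq> W"
    "\<And>l. l \<in> S \<Longrightarrow> (\<forall>x\<in>V. shift l x \<notin> V) \<or> (\<forall>x\<in>V. shift l x = x)" by blast
  show ?case
  proof (cases "\<forall>x\<in>V. shift k x = x")
    case True
    then show ?thesis using V by (intro exI[of _ V]) auto
  next
    case False
    then obtain x where x: "x \<in> V" "shift k x \<noteq> x" by blast
    have xX: "x \<in> topspace X" using x V(1) openin_subset by blast
    obtain P Q where PQ: "openin X P" "openin X Q" "x \<in> P" "shift k x \<in> Q" "disjnt P Q"
      using Hausdorff xX shift_in[OF xX, of k] x(2) unfolding Hausdorff_space_def by metis
    define V' where "V' = V \<inter> P \<inter> {y \<in> topspace X. shift k y \<in> Q}"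
    have "openin X V'" unfolding V'_def using V PQ openin_shift_preimage by (intro openin_Int) auto
    moreover have "x \<in> V'" using x xX PQ by (simp add: V'_def)
    moreover have "shift k y \<notin> V'" if "y \<in> V'" for y
      using that PQ(5) by (auto simp: V'_def disjnt_iff)
    moreover have "V' \<subseteq> V" by (auto simp: V'_def)
    ultimately show ?thesis using V(3,4) by (intro exI[of _ V'] conjI ballI) blast+
  qed
qed

end

context covariant_pair
begin

lemma pi_norm_le_one_real:
  assumes f: "f \<in> CX X" and real: "\<And>x. Im (f x) = 0" and le: "\<And>x. \<bar>Re (f x)\<bar> \<le> 1"
  shows "norm (\<pi> f) \<le> 1"
proof -
  \<comment> \<open>The function \<open>f\<close> is the mean of the unitary \<open>s = f + \<i> sqrt (1 - f\<^sup>2)\<close> and its adjoint.\<close>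
  define s where "s = (\<lambda>x. f x + \<i> * (if x \<in> topspace X then complex_of_real (sqrt (1 - (Re (f x))\<^sup>2)) else 0))"
  have "continuous_map X euclidean (\<lambda>x. complex_of_real (sqrt (1 - (Re (f x))\<^sup>2)))"
    using CX_D(1)[OF f] by (auto simp: continuous_map_atin intro!: tendsto_intros)
  then have "continuous_map X euclidean (\<lambda>x. if x \<in> topspace X then complex_of_real (sqrt (1 - (Re (f x))\<^sup>2)) else 0)"
    by (rule continuous_map_eq) simp
  then have "(\<lambda>x. if x \<in> topspace X then complex_of_real (sqrt (1 - (Re (f x))\<^sup>2)) else 0) \<in> CX X"
    by (simp add: CX_def)
  then have s: "s \<in> CX X" unfolding s_def by (intro CX_add f CX_scale)
  have "cnj (s x) * s x = indicator (topspace X) x" for x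
  proof (cases "x \<in> topspace X")
    case True
    have "(Re (f x))\<^sup>2 \<le> 1" using le[of x] by (simp add: abs_square_le_1)
    then have "Re (s x) * Re (s x) + Im (s x) * Im (s x) = 1"
      using True real[of x] by (simp add: s_def power2_eq_square[symmetric])
    then show ?thesis using True by (simp add: complex_eq_iff mult.commute)
  qed (simp add: s_def CX_D(2)[OF f])
  then have "adj (\<pi> s) * \<pi> s = 1"
    using pi_mult[OF CX_cnj[OF s] s] pi_one by (simp add: pi_adj[OF s])
  then have "(norm (\<pi> s))\<^sup>2 \<le> 1" using cstar_identity[of "\<pi> s"] norm_one_le[where 'a='a] by simp
  then have ns: "norm (\<pi> s) \<le> 1" by (simp add: power_le_one_iff)
  have "f x = (1/2) * (s x + cnj (s x))" for x
    using real[of x] by (simp add: s_def complex_eq_iff)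
  then have "f = (\<lambda>x. (1/2) * (s x + cnj (s x)))" by (rule ext)
  then have "\<pi> f = \<pi> (\<lambda>x. (1/2) * (s x + cnj (s x)))" by (rule arg_cong)
  also have "\<dots> = scaleC (1/2) (\<pi> s + adj (\<pi> s))"
    by (simp only: pi_scale[OF CX_add[OF s CX_cnj[OF s]]] pi_add[OF s CX_cnj[OF s]] pi_adj[OF s])
  finally have "norm (\<pi> f) \<le> (1/2) * (norm (\<pi> s) + norm (adj (\<pi> s)))"
    using norm_triangle_ineq[of "\<pi> s" "adj (\<pi> s)"] by (simp add: norm_scaleC)
  then show ?thesis using ns by simp
qed

lemma pi_norm_le:
  assumes f: "f \<in> CX X" and le: "\<And>x. cmod (f x) \<le> r"
  shows "norm (\<pi> f) \<le> r"
proof (cases "r = 0")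
  case True
  then have "f = (\<lambda>x. 0)" using le by (intro ext) simp
  then show ?thesis using True by simp
next
  case False
  then have r: "r > 0" using order_trans[OF norm_ge_zero le] by (simp add: less_le)
  define g where "g = (\<lambda>x. complex_of_real (1 / r\<^sup>2) * (cnj (f x) * f x))"
  have g_eq: "g x = complex_of_real ((cmod (f x))\<^sup>2 / r\<^sup>2)" for x
  proof -
    have "cnj (f x) * f x = complex_of_real ((cmod (f x))\<^sup>2)"
      by (simp only: complex_norm_square mult.commute)
    then have "g x = complex_of_real (1 / r\<^sup>2 * (cmod (f x))\<^sup>2)"
      by (simp only: g_def of_real_mult)
    then show ?thesis by (simp only: mult_1 times_divide_eq_left)
  qed
  have "norm (\<pi> g) \<le> 1"
  proof (rule pi_norm_le_one_real)
    show "g \<in> CX X" unfolding g_def by (rule CX_scale[OF CX_mult[OF CX_cnj[OF f] f]])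
    show "Im (g x) = 0" for x unfolding g_eq by (rule Im_complex_of_real)
    show "\<bar>Re (g x)\<bar> \<le> 1" for x
    proof -
      have "(cmod (f x))\<^sup>2 \<le> r\<^sup>2" using le[of x] by (rule power_mono) simp
      then have "(cmod (f x))\<^sup>2 / r\<^sup>2 \<le> r\<^sup>2 / r\<^sup>2" by (rule divide_right_mono) simp
      then show ?thesis unfolding g_eq Re_complex_of_real using r by simp
    qed
  qed
  also have "\<pi> g = scaleC (complex_of_real (1 / r\<^sup>2)) (adj (\<pi> f) * \<pi> f)"
    unfolding g_def pi_scale[OF CX_mult[OF CX_cnj[OF f] f]] pi_mult[OF CX_cnj[OF f] f] pi_adj[OF f] ..
  finally have "cmod (complex_of_real (1 / r\<^sup>2)) * (norm (\<pi> f))\<^sup>2 \<le> 1"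
    by (simp only: norm_scaleC cstar_identity)
  then have "1 / r\<^sup>2 * (norm (\<pi> f))\<^sup>2 \<le> 1" by (simp only: norm_of_real abs_divide abs_one abs_power2)
  then have "(norm (\<pi> f))\<^sup>2 \<le> r\<^sup>2" using r by (simp add: field_simps)
  then show ?thesis using less_imp_le[OF r] by (rule power2_le_imp_le)
qed

end

context crossed_product_dynamics
begin

text \<open>Together with the previous bound this makes \<open>\<pi>\<close> isometric. If \<open>norm (\<pi> f)\<close> were less than \<open>r\<close> and
  \<open>g\<close> a bump function living where \<open>f\<close> exceeds \<open>r\<close>, then writing \<open>g = g * (f * k)\<close> with \<open>k \<le> 1 / r\<close>
  would force \<open>\<pi> g = 0\<close>.\<close>

lemma pi_norm_ge:
  assumes f: "f \<in> CX X" shows "cmod (f x0) \<le> norm (\<pi> f)"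
proof (rule ccontr)
  assume "\<not> ?thesis"
  then obtain r where r: "norm (\<pi> f) < r" "r < cmod (f x0)" using dense_order_class.dense[of "norm (\<pi> f)" "cmod (f x0)"] by (auto simp: not_le)
  have r0: "r > 0" using r(1) norm_ge_zero order_le_less_trans by blast
  define W where "W = {x \<in> topspace X. cmod (f x) \<in> {r<..}}"
  have x0: "x0 \<in> topspace X" using r r0 CX_D(2)[OF f, of x0] by (cases "x0 \<in> topspace X") auto
  have "continuous_map X euclidean (\<lambda>x. cmod (f x))"
    using CX_D(1)[OF f] by (auto simp: continuous_map_atin intro!: tendsto_intros)
  then have W: "openin X W" unfolding W_def by (rule openin_continuous_map_preimage) simp
  have "x0 \<in> W" using x0 r by (simp add: W_def)
  obtain g where g: "g \<in> CX X" "g x0 = 1" "\<And>x. x \<notin> W \<Longrightarrow> g x = 0" "\<And>x. cmod (g x) \<le> 1"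
    using exists_bump[OF W \<open>x0 \<in> W\<close>] by blast
  \<comment> \<open>The function \<open>k\<close> inverts \<open>f\<close> wherever \<open>g\<close> does not vanish, and it is bounded by \<open>1 / r\<close>.\<close>
  define k where "k = (\<lambda>x. cnj (f x) * complex_of_real (1 / max ((cmod (f x))\<^sup>2) (r\<^sup>2)))"
  have max: "max (t\<^sup>2) (r\<^sup>2) \<noteq> 0" for t using r0 by (auto simp: max_def)
  have "(k \<longlongrightarrow> k x) (atin X x)" if "x \<in> topspace X" for x
  proof -
    have F: "(f \<longlongrightarrow> f x) (atin X x)" using CX_D(1)[OF f] that by (simp add: continuous_map_atin)
    show ?thesis
      unfolding k_def
      by (rule tendsto_mult[OF tendsto_cnj[OF F] tendsto_of_real[OF tendsto_divide[OF tendsto_const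
            tendsto_max[OF tendsto_power[OF tendsto_norm[OF F]] tendsto_const] max]]])
  qed
  then have "continuous_map X euclidean k" by (simp add: continuous_map_atin)
  then have k: "k \<in> CX X" using CX_D(2)[OF f] by (simp add: CX_def k_def)
  have "cmod (k x) \<le> 1 / r" for x
  proof -
    define t where "t = cmod (f x)"
    have "cmod (k x) = t / max (t\<^sup>2) (r\<^sup>2)" using r0 by (simp add: k_def norm_mult norm_divide t_def abs_of_nonneg le_max_iff_disj)
    also have "\<dots> \<le> 1 / r"
    proof (cases "t \<le> r")
      case True
      then have "t / max (t\<^sup>2) (r\<^sup>2) \<le> r / r\<^sup>2"
        using r0 by (intro frac_le) (auto simp: t_def)
      also have "\<dots> = 1 / r" using r0 by (simp add: power2_eq_square)
      finally show ?thesis .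
    next
      case False
      then have "t / max (t\<^sup>2) (r\<^sup>2) \<le> t / t\<^sup>2"
        using r0 by (intro frac_le) auto
      also have "\<dots> = 1 / t" using r0 False by (simp add: power2_eq_square)
      also have "\<dots> \<le> 1 / r" using r0 False by (intro frac_le) auto
      finally show ?thesis .
    qed
    finally show ?thesis .
  qed
  then have nk: "norm (\<pi> k) \<le> 1 / r" by (rule pi_norm_le[OF k])
  have "g x = g x * (f x * k x)" for x
  proof (cases "x \<in> W")
    case True
    then have t: "r < cmod (f x)" by (simp add: W_def)
    then have "r\<^sup>2 \<le> (cmod (f x))\<^sup>2" using r0 by (intro power_mono) auto
    then have "f x * k x = (f x * cnj (f x)) * complex_of_real (1 / (cmod (f x))\<^sup>2)"
      by (simp add: k_def max_def)
    also have "f x * cnj (f x) = complex_of_real ((cmod (f x))\<^sup>2)" by (rule complex_norm_square[symmetric])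
    also have "\<dots> * complex_of_real (1 / (cmod (f x))\<^sup>2) = 1" using t r0 by auto
    finally show ?thesis by simp
  qed (simp add: g(3))
  then have "g = (\<lambda>x. g x * (f x * k x))" by (rule ext)
  then have "\<pi> g = \<pi> (\<lambda>x. g x * (f x * k x))" by (rule arg_cong)
  also have "\<dots> = \<pi> g * (\<pi> f * \<pi> k)"
    unfolding pi_mult[OF g(1) CX_mult[OF f k]] pi_mult[OF f k] ..
  finally have "norm (\<pi> g) \<le> norm (\<pi> g) * norm (\<pi> f * \<pi> k)" by (metis norm_mult_ineq)
  also have "norm (\<pi> f * \<pi> k) \<le> norm (\<pi> f) * (1 / r)"
    using nk norm_mult_ineq[of "\<pi> f" "\<pi> k"] by (meson mult_left_mono norm_ge_zero order_trans)
  finally have "norm (\<pi> g) \<le> norm (\<pi> g) * (norm (\<pi> f) / r)" by (simp add: mult_left_mono)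
  moreover have "norm (\<pi> f) / r < 1" using r r0 by simp
  ultimately have "norm (\<pi> g) = 0"
    using mult_strict_left_mono[of "norm (\<pi> f) / r" 1 "norm (\<pi> g)"] by (cases "norm (\<pi> g) = 0") auto
  then have "\<pi> g = \<pi> (\<lambda>x. 0)" by simp
  then have "g = (\<lambda>x. 0)" by (rule inj_onD[OF pi_inj _ g(1) CX_zero])
  with g(2) show False by simp
qed

abbreviation (input) "C' \<equiv> commutant (\<pi> ` CX X)"

lemma commutant_iff: "a \<in> C' \<longleftrightarrow> (\<forall>f\<in>CX X. a * \<pi> f = \<pi> f * a)"
  by (auto simp: commutant_def)

lemma closed_commutant: "closed C'"
proof (rule closed_sequential_limits[THEN iffD2], intro allI impI, elim conjE)
  fix s l assume s: "\<forall>n. s n \<in> C'" and l: "s \<longlonglongrightarrow> l"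
  have "l * \<pi> f = \<pi> f * l" if f: "f \<in> CX X" for f
  proof (rule LIMSEQ_unique)
    show "(\<lambda>n. s n * \<pi> f) \<longlonglongrightarrow> l * \<pi> f" by (intro tendsto_intros l)
    have "s n * \<pi> f = \<pi> f * s n" for n using s f by (simp add: commutant_iff)
    then show "(\<lambda>n. s n * \<pi> f) \<longlonglongrightarrow> \<pi> f * l" by (simp add: tendsto_intros l)
  qed
  then show "l \<in> C'" by (simp add: commutant_iff)
qed

lemma pi_commute: "\<lbrakk>f \<in> CX X; g \<in> CX X\<rbrakk> \<Longrightarrow> \<pi> f * \<pi> g = \<pi> g * \<pi> f"
  using pi_mult[of f g] pi_mult[of g f] by (simp add: mult.commute)

lemma pi_in_commutant: "f \<in> CX X \<Longrightarrow> \<pi> f \<in> C'"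
  by (simp add: commutant_iff pi_commute)

lemma commutant_subalgebra: "cstar_subalgebra C'"
  unfolding cstar_subalgebra_def
proof (intro conjI ballI allI closed_commutant)
  fix a assume a: "a \<in> C'"
  show "adj a \<in> C'"
    unfolding commutant_iff
  proof
    fix f assume f: "f \<in> CX X"
    have "a * adj (\<pi> f) = adj (\<pi> f) * a"
      using a CX_cnj[OF f] pi_adj[OF f] unfolding commutant_iff by fastforce
    then have "adj (a * adj (\<pi> f)) = adj (adj (\<pi> f) * a)" by simp
    then show "adj a * \<pi> f = \<pi> f * adj a" by (simp add: adj_mult adj_adj)
  qed
next
  fix a b assume ab: "a \<in> C'" "b \<in> C'"
  show "a + b \<in> C'" using ab by (simp add: commutant_iff distrib_left distrib_right)
  show "a * b \<in> C'"
    unfolding commutant_iff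
  proof
    fix f assume "f \<in> CX X"
    then have "a * \<pi> f = \<pi> f * a" "b * \<pi> f = \<pi> f * b" using ab by (simp_all add: commutant_iff)
    then show "a * b * \<pi> f = \<pi> f * (a * b)" by (metis mult.assoc)
  qed
next
  fix a c assume "a \<in> C'"
  then show "scaleC c a \<in> C'" by (simp add: commutant_iff mult_scaleC_left mult_scaleC_right)
qed (simp add: commutant_iff)

lemma one_in_commutant: "1 \<in> C'"
  by (simp add: commutant_iff)

lemma commutant_commutes_closure:
  assumes a: "a \<in> C'" and y: "y \<in> closure (\<pi> ` CX X)"
  shows "a * y = y * a"
proof -
  obtain s where s: "\<And>n. s n \<in> \<pi> ` CX X" "s \<longlonglongrightarrow> y" using y unfolding closure_sequential by blast
  show ?thesis
  proof (rule LIMSEQ_unique)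
    show "(\<lambda>n. a * s n) \<longlonglongrightarrow> a * y" by (intro tendsto_intros s)
    have "a * s n = s n * a" for n using s(1)[of n] a by (auto simp: commutant_iff)
    then show "(\<lambda>n. a * s n) \<longlonglongrightarrow> y * a" by (simp add: tendsto_intros s)
  qed
qed

lemma fourier_coeff_term_in_commutant:
  assumes a: "a \<in> C'" shows "fourier_coeff n a * U n \<in> C'"
  unfolding commutant_iff
proof
  fix f assume f: "f \<in> CX X"
  have "fourier_coeff n a * U n * \<pi> f = fourier_coeff n a * \<pi> (\<alpha> n f) * U n"
    by (simp add: mult.assoc U_pi[OF f])
  also have "\<dots> = \<pi> f * fourier_coeff n a * U n"
    using a f fourier_coeff_pi_right[OF f, of n a] fourier_coeff_pi_left[OF f, of n a] by (simp add: commutant_iff)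
  finally show "fourier_coeff n a * U n * \<pi> f = \<pi> f * (fourier_coeff n a * U n)" by (simp add: mult.assoc)
qed

text \<open>The term \<open>fourier_coeff n a * U n\<close> lies in the commutant and so commutes with the coefficients of \<open>b\<close>,
  and conversely. Moving each coefficient past the other term reduces the claim to the commutativity
  of coefficients and of powers of the unitary.\<close>

lemma fourier_coeff_terms_commute:
  assumes a: "a \<in> C'" and b: "b \<in> C'"
  shows "(fourier_coeff n a * U n) * (fourier_coeff m b * U m) = (fourier_coeff m b * U m) * (fourier_coeff n a * U n)"
proof -
  have closure_sub: "closure (\<pi> ` CX X) \<subseteq> C'"
    by (rule closure_minimal) (use closed_commutant pi_in_commutant in auto)
  have xy: "fourier_coeff m b * fourier_coeff n a = fourier_coeff n a * fourier_coeff m b"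
    using commutant_commutes_closure closure_sub fourier_coeff_in_closure by blast
  have UU: "U n * U m = U m * U n" by (simp add: U_add[symmetric] add.commute)
  have "(fourier_coeff n a * U n) * (fourier_coeff m b * U m) = fourier_coeff m b * fourier_coeff n a * (U n * U m)"
    using commutant_commutes_closure[OF fourier_coeff_term_in_commutant[OF a, of n] fourier_coeff_in_closure[of m b]]
    by (simp add: mult.assoc[symmetric])
  also have "\<dots> = fourier_coeff n a * fourier_coeff m b * (U m * U n)" by (simp only: xy UU)
  also have "\<dots> = (fourier_coeff m b * U m) * (fourier_coeff n a * U n)"
    using commutant_commutes_closure[OF fourier_coeff_term_in_commutant[OF b, of m] fourier_coeff_in_closure[of n a]]
    by (simp add: mult.assoc[symmetric])
  finally show ?thesis .
qed

text \<open>Fejer means reduce this to the commutativity of the terms of two Fourier series.\<close>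

lemma commutant_commutative:
  assumes a: "a \<in> C'" and b: "b \<in> C'" shows "a * b = b * a"
proof (rule LIMSEQ_unique)
  have "fejer_mean N a * fejer_mean N b = fejer_mean N b * fejer_mean N a" for N
  proof -
    have "scaleC r (fourier_coeff n a * U n) * scaleC s (fourier_coeff m b * U m) =
        scaleC s (fourier_coeff m b * U m) * scaleC r (fourier_coeff n a * U n)" for r s n m
      unfolding mult_scaleC_left mult_scaleC_right scaleC_scaleC fourier_coeff_terms_commute[OF a b, of n m]
      by (simp only: mult.commute)
    then show ?thesis
      unfolding fejer_mean_def sum_product by (subst sum.swap) (simp only:)
  qed
  then show "(\<lambda>N. fejer_mean N a * fejer_mean N b) \<longlonglongrightarrow> b * a"
    by (simp add: tendsto_mult fejer_mean_tendsto)
  show "(\<lambda>N. fejer_mean N a * fejer_mean N b) \<longlonglongrightarrow> a * b"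
    by (intro tendsto_mult fejer_mean_tendsto)
qed

sublocale commutant: commutative_cstar_subalgebra C'
  by unfold_locales (fact commutant_subalgebra one_in_commutant commutant_commutative)+

text \<open>Take \<open>j\<close> in the ideal whose zeroth coefficient is not zero and a finite sum \<open>b\<close> close to it. On a
  small open set \<open>V\<close> where the zeroth coefficient of \<open>b\<close> is large, each of the finitely many powers of
  \<open>\<sigma>\<close> occurring in \<open>b\<close> either moves \<open>V\<close> off itself or is the identity. For a bump function \<open>h\<close> on \<open>V\<close>
  the element \<open>h b h\<close> therefore lies in the commutant. It is close to \<open>h j h\<close>, which is in the ideal,
  and it is not small because its zeroth coefficient is not.\<close>

lemma ideal_meets_commutant:
  assumes J: "two_sided_ideal J" "J \<noteq> {0}"
  shows "J \<inter> C' \<noteq> {0}"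
proof -
  obtain j0 where j0: "j0 \<in> J" "j0 \<noteq> 0" using J two_sided_idealD(1)[OF J(1)] by blast
  then obtain n where n: "fourier_coeff n j0 \<noteq> 0" using eq_zero_if_fourier_coeff_zero by blast
  \<comment> \<open>Shift a non-zero coefficient to degree zero.\<close>
  define j where "j = j0 * U (- n)"
  have j: "j \<in> J" using two_sided_idealD(5)[OF J(1) j0(1)] by (simp add: j_def)
  define \<eta> where "\<eta> = norm (fourier_coeff 0 j)"
  have \<eta>: "\<eta> > 0" using n by (simp add: \<eta>_def j_def fourier_coeff_U_right)
  obtain b where b: "b \<in> conv_carrier X" "norm (IF b - j) < \<eta> / 8"
    using exists_approximant[of "\<eta> / 8" j] \<eta> by auto
  have bn: "b k \<in> CX X" for k using b(1) by (simp add: conv_carrier_def)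
  have "norm (\<pi> (b 0) - fourier_coeff 0 j) \<le> norm (IF b - j)"
    using norm_fourier_coeff_le[of 0 "IF b - j"] by (simp add: fourier_coeff_diff fourier_coeff_IF[OF b(1)])
  have b0: "norm (\<pi> (b 0)) > 3/4 * \<eta>"
  proof -
    have "\<eta> - norm (\<pi> (b 0)) \<le> norm (\<pi> (b 0) - fourier_coeff 0 j)"
      unfolding \<eta>_def by (subst norm_minus_commute) (rule norm_triangle_ineq2)
    with \<open>norm (\<pi> (b 0) - fourier_coeff 0 j) \<le> norm (IF b - j)\<close> b(2) \<eta> show ?thesis by linarith
  qed
  define W where "W = {x \<in> topspace X. cmod (b 0 x) \<in> {3/4 * \<eta><..}}"
  have "W \<noteq> {}"
  proof
    assume "W = {}"
    then have "cmod (b 0 x) \<le> 3/4 * \<eta>" for x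
      using CX_D(2)[OF bn[of 0], of x] \<eta> by (cases "x \<in> topspace X") (auto simp: W_def not_less)
    from pi_norm_le[OF bn this] b0 show False by simp
  qed
  have "continuous_map X euclidean (\<lambda>x. cmod (b 0 x))"
    using CX_D(1)[OF bn[of 0]] by (auto simp: continuous_map_atin intro!: tendsto_intros)
  then have "openin X W" unfolding W_def by (rule openin_continuous_map_preimage) simp
  define S where "S = {k. b k \<noteq> (\<lambda>x. 0)}"
  have "finite S" using b(1) by (simp add: S_def conv_carrier_def)
  from exists_separating_open[OF \<open>openin X W\<close> \<open>W \<noteq> {}\<close> this]
  obtain V where V: "openin X V" "V \<noteq> {}" "V \<subseteq> W" 
    and sep: "\<And>k. k \<in> S \<Longrightarrow> (\<forall>x\<in>V. shift k x \<notin> V) \<or> (\<forall>x\<in>V. shift k x = x)" by blast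
  from V(2) obtain x0 where x0: "x0 \<in> V" by blast
  obtain h where h: "h \<in> CX X" "h x0 = 1" "\<And>x. x \<notin> V \<Longrightarrow> h x = 0" "\<And>x. cmod (h x) \<le> 1"
    using exists_bump[OF V(1) x0] by blast
  have nh: "norm (\<pi> h) \<le> 1" by (rule pi_norm_le[OF h(1,4)])
  define c where "c = (\<lambda>k x. \<alpha> k h x * (h x * b k x))"
  have cc: "c \<in> conv_carrier X" unfolding c_def
    by (intro conv_carrier_mult conv_carrier_mult[OF b(1)] alpha_in h)
  have IFc: "IF c = \<pi> h * IF b * \<pi> h"
    unfolding c_def IF_pi_right[OF conv_carrier_mult[OF b(1) h(1)] h(1)] IF_pi_left[OF b(1) h(1)] ..
  \<comment> \<open>A term of \<open>h b h\<close> survives only if \<open>\<sigma>\<^sup>k\<close> returns to \<open>V\<close>, and then \<open>\<sigma>\<^sup>k\<close> is the identity on \<open>V\<close>.\<close>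
  have fixed: "shift (- k) x = x" if "c k x \<noteq> 0" for k x
  proof -
    have "b k \<noteq> (\<lambda>x. 0)" "h x \<noteq> 0" "\<alpha> k h x \<noteq> 0" using that by (auto simp: c_def)
    then have k: "k \<in> S" and x: "x \<in> V" and y: "shift (- k) x \<in> V" and xX: "x \<in> topspace X"
      using h(3) by (auto simp: S_def alpha_pow_def split: if_splits)
    have "shift k (shift (- k) x) = x" using shift_add[OF xX, of k "- k"] by simp
    then show ?thesis using sep[OF k] x y by metis
  qed
  have ck: "c k \<in> CX X" for k using cc by (simp add: conv_carrier_def)
  have "\<pi> (c k) * U k \<in> C'" for k
    unfolding commutant_iff
  proof
    fix f assume f: "f \<in> CX X"
    have "c k x * \<alpha> k f x = f x * c k x" for x
      using fixed[of k x] CX_D(2)[OF ck] by (cases "c k x = 0") (auto simp: alpha_pow_def)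
    then have "\<pi> (c k) * \<pi> (\<alpha> k f) = \<pi> f * \<pi> (c k)"
      by (simp only: pi_mult[OF ck alpha_in[OF f], symmetric] pi_mult[OF f ck, symmetric])
    then show "\<pi> (c k) * U k * \<pi> f = \<pi> f * (\<pi> (c k) * U k)"
      by (simp add: mult.assoc U_pi[OF f]) (simp add: mult.assoc[symmetric])
  qed
  then have "IF c \<in> C'"
    unfolding integrated_form_def
    by (intro sum_mem[OF commutant_subalgebra])
  moreover have "\<pi> h * j * \<pi> h \<in> J" using two_sided_idealD(4,5)[OF J(1)] j by blast
  moreover have "norm (IF c - \<pi> h * j * \<pi> h) < norm (IF c) / 2"
  proof -
    have "\<alpha> 0 h = h" using h(1) by (rule alpha_0)
    then have "3/4 * \<eta> < cmod (c 0 x0)" using x0 V(3) h(2) by (auto simp: c_def W_def)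
    also have "\<dots> \<le> norm (\<pi> (c 0))" by (rule pi_norm_ge[OF ck])
    also have "\<dots> \<le> norm (IF c)" by (rule norm_coefficient_le[OF cc])
    finally have big: "3/4 * \<eta> < norm (IF c)" .
    have "IF c - \<pi> h * j * \<pi> h = \<pi> h * (IF b - j) * \<pi> h"
      by (simp add: IFc left_diff_distrib right_diff_distrib)
    also have "norm \<dots> \<le> norm (\<pi> h * (IF b - j)) * norm (\<pi> h)" by (rule norm_mult_ineq)
    also have "\<dots> \<le> norm (\<pi> h * (IF b - j)) * 1" using nh by (rule mult_left_mono) simp
    also have "\<dots> \<le> norm (\<pi> h) * norm (IF b - j)" using norm_mult_ineq by simp
    also have "\<dots> \<le> 1 * norm (IF b - j)" using nh by (rule mult_right_mono) simp
    finally show ?thesis using b(2) big \<eta> by simp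
  qed
  ultimately show ?thesis by (intro commutant.ideal_near_element_meets[OF J(1)])
qed

end

section \<open>Ideals and invariant closed sets\<close>

context crossed_product_dynamics
begin

lemma U_one: "U 1 = \<delta>" "U (- 1) = adj \<delta>"
  by (simp_all add: unitary_pow_def)

lemma Ad_commutant:
  assumes a: "a \<in> C'" shows "U n * a * U (- n) \<in> C'"
  unfolding commutant_iff
proof
  fix f assume f: "f \<in> CX X"
  define g where "g = \<alpha> (- n) f"
  have g: "g \<in> CX X" and gf: "\<alpha> n g = f" using f by (simp_all add: g_def alpha_in alpha_alpha alpha_0)
  have "U n * a * U (- n) * \<pi> f = U n * a * \<pi> g * U (- n)" by (simp add: mult.assoc U_pi[OF f] g_def)
  also have "\<dots> = U n * \<pi> g * a * U (- n)" using a g by (simp add: commutant_iff mult.assoc)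
  also have "\<dots> = \<pi> f * U n * a * U (- n)" by (simp add: U_pi[OF g] gf)
  finally show "U n * a * U (- n) * \<pi> f = \<pi> f * (U n * a * U (- n))" by (simp add: mult.assoc)
qed

text \<open>The action of the integers on the spectrum of the commutant; \<open>n = - 1\<close> is the map in question and
  \<open>n = 1\<close> its inverse.\<close>

definition translate :: "int \<Rightarrow> ('a \<Rightarrow> complex) \<Rightarrow> 'a \<Rightarrow> complex" where
  "translate n \<gamma> = restrict (\<lambda>a. \<gamma> (U n * a * U (- n))) C'"

lemma translate_spectrum_map: "translate (- 1) = spectrum_map \<delta> C'"
  by (simp add: fun_eq_iff translate_def spectrum_map_def U_one)

lemma translate_in:
  assumes \<gamma>: "\<gamma> \<in> characters C'" shows "translate n \<gamma> \<in> characters C'"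
  unfolding characters_def
proof (intro CollectI conjI ballI allI)
  show "translate n \<gamma> \<in> extensional C'" by (simp add: translate_def)
  note G = charactersD(2-4)[OF \<gamma>]
  fix a b assume a: "a \<in> C'" and b: "b \<in> C'"
  show "translate n \<gamma> (a + b) = translate n \<gamma> a + translate n \<gamma> b"
    using G(1)[OF Ad_commutant[OF a, of n] Ad_commutant[OF b, of n]] a b
    by (simp add: translate_def distrib_left distrib_right)
  have "U n * (a * b) * U (- n) = U n * a * (U (- n) * U n) * b * U (- n)"
    by (simp add: U_inverse mult.assoc)
  also have "\<dots> = (U n * a * U (- n)) * (U n * b * U (- n))" by (simp only: mult.assoc)
  finally have "U n * (a * b) * U (- n) = (U n * a * U (- n)) * (U n * b * U (- n))" .
  then show "translate n \<gamma> (a * b) = translate n \<gamma> a * translate n \<gamma> b"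
    using G(3)[OF Ad_commutant[OF a, of n] Ad_commutant[OF b, of n]] a b
    by (simp only: translate_def restrict_apply' commutant.mem)
next
  fix c a assume a: "a \<in> C'"
  show "translate n \<gamma> (scaleC c a) = c * translate n \<gamma> a"
    using charactersD(3)[OF \<gamma> Ad_commutant[OF a, of n]] a
    by (simp add: translate_def mult_scaleC_left mult_scaleC_right)
next
  show "\<exists>a\<in>C'. translate n \<gamma> a \<noteq> 0"
    by (rule bexI[of _ 1]) (simp_all add: translate_def U_inverse commutant.character_one[OF \<gamma>])
qed

lemma translate_add:
  shows "translate m (translate n \<gamma>) = translate (n + m) \<gamma>"
proof
  fix a
  have "U n * (U m * a * U (- m)) * U (- n) = (U n * U m) * a * (U (- m) * U (- n))"
    by (simp only: mult.assoc)
  also have "\<dots> = U (n + m) * a * U (- (n + m))" by (simp only: U_add[symmetric] minus_add)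
  finally show "translate m (translate n \<gamma>) a = translate (n + m) \<gamma> a"
    using Ad_commutant[of a m] by (cases "a \<in> C'") (simp_all add: translate_def)
qed

lemma translate_zero: "\<gamma> \<in> characters C' \<Longrightarrow> translate 0 \<gamma> = \<gamma>"
  using charactersD(1)[of \<gamma> C'] by (auto simp: translate_def fun_eq_iff extensional_def)

lemma inv_spectrum_map:
  assumes \<gamma>: "\<gamma> \<in> characters C'"
  shows "inv_into (characters C') (spectrum_map \<delta> C') \<gamma> = translate 1 \<gamma>"
  unfolding translate_spectrum_map[symmetric]
proof (rule inv_into_f_eq)
  show "inj_on (translate (- 1)) (characters C')"
    by (rule inj_on_inverseI[of _ "translate 1"]) (simp add: translate_add translate_zero)
qed (use \<gamma> in \<open>simp_all add: translate_in translate_add translate_zero\<close>)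

lemma invariant_iff_translate:
  assumes S: "S \<subseteq> characters C'"
  shows "spectrum_map \<delta> C' ` S \<subseteq> S \<and> inv_into (characters C') (spectrum_map \<delta> C') ` S \<subseteq> S \<longleftrightarrow>
    (\<forall>n. \<forall>\<gamma>\<in>S. translate n \<gamma> \<in> S)"
proof -
  have inv: "inv_into (characters C') (spectrum_map \<delta> C') \<gamma> = translate 1 \<gamma>" if "\<gamma> \<in> S" for \<gamma>
    using that S by (intro inv_spectrum_map) auto
  have "spectrum_map \<delta> C' ` S \<subseteq> S \<and> inv_into (characters C') (spectrum_map \<delta> C') ` S \<subseteq> S \<longleftrightarrow>
     (\<forall>\<gamma>\<in>S. translate (- 1) \<gamma> \<in> S \<and> translate 1 \<gamma> \<in> S)"
    unfolding translate_spectrum_map[symmetric] using inv[unfolded translate_spectrum_map[symmetric]] by auto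
  also have "\<dots> \<longleftrightarrow> (\<forall>n. \<forall>\<gamma>\<in>S. translate n \<gamma> \<in> S)"
  proof safe
    fix n \<gamma> assume step: "\<forall>\<gamma>\<in>S. translate (- 1) \<gamma> \<in> S \<and> translate 1 \<gamma> \<in> S" and \<gamma>: "\<gamma> \<in> S"
    show "translate n \<gamma> \<in> S"
    proof (induction n rule: int_induct[where k = 0])
      case base
      then show ?case using \<gamma> S translate_zero by (metis subsetD)
    next
      case (step1 i)
      then show ?case using step translate_add[of 1 i \<gamma>] by metis
    next
      case (step2 i)
      then show ?case using step translate_add[of "- 1" i \<gamma>] by (metis diff_conv_add_uminus)
    qed
  qed auto
  finally show ?thesis .
qed

end

locale intermediate_subalgebra = crossed_product_dynamics X \<sigma> \<pi> \<delta>
  for X :: "'x topology" and \<sigma> and \<pi> :: "('x \<Rightarrow> complex) \<Rightarrow> 'a::unital_cstar_algebra" and \<delta> +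
  fixes B :: "'a set"
  assumes B_subalgebra: "cstar_subalgebra B"
    and pi_subset_B: "\<pi> ` CX X \<subseteq> B" and B_subset: "B \<subseteq> C'"
begin

sublocale B: commutative_cstar_subalgebra B
proof
  show "1 \<in> B" using pi_subset_B CX_indicator[of X] pi_one by (metis image_eqI subsetD)
  show "a * b = b * a" if "a \<in> B" "b \<in> B" for a b using that B_subset commutant_commutative by blast
qed (rule B_subalgebra)

lemma restrict_character:
  assumes \<gamma>: "\<gamma> \<in> characters C'" shows "restrict \<gamma> B \<in> characters B"
proof -
  have "\<exists>a\<in>B. \<gamma> a \<noteq> 0" by (rule bexI[of _ 1]) (simp_all add: commutant.character_one[OF \<gamma>])
  then show ?thesis using charactersD(2-4)[OF \<gamma>] B_subset unfolding characters_def by (auto simp: subset_iff)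
qed

text \<open>If the restriction of \<open>S\<close> were the whole spectrum of \<open>B\<close>, the ideal \<open>J\<close> below would be non-zero, as it
  contains an element \<open>c\<close> of the commutant vanishing on \<open>S\<close>: moving \<open>c\<close> past a power of the unitary
  amounts to translating the point of \<open>S\<close>. But an element of \<open>B\<close> in \<open>J\<close> vanishes on \<open>S\<close>, hence at every
  character of \<open>B\<close>.\<close>

lemma restriction_proper_if_intersection_property:
  assumes ip: "intersection_property B"
    and S: "closedin (spectrum C') S" "S \<subset> characters C'" and inv: "\<And>n \<gamma>. \<gamma> \<in> S \<Longrightarrow> translate n \<gamma> \<in> S"
  shows "(\<lambda>\<gamma>. restrict \<gamma> B) ` S \<subset> characters B"
proof (rule psubsetI)
  show "(\<lambda>\<gamma>. restrict \<gamma> B) ` S \<subseteq> characters B" using restrict_character S(2) by auto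
  show "(\<lambda>\<gamma>. restrict \<gamma> B) ` S \<noteq> characters B"
  proof
    assume eq: "(\<lambda>\<gamma>. restrict \<gamma> B) ` S = characters B"
    have Sch: "\<gamma> \<in> characters C'" if "\<gamma> \<in> S" for \<gamma> using that S(2) by blast
    note L = commutant.null_left_ideal_add[OF Sch] commutant.null_left_ideal_mult[OF Sch]
      commutant.null_left_ideal_closed[OF Sch] commutant.null_left_ideal_iff[OF Sch]
      commutant.null_left_ideal_sum[OF Sch]
    obtain \<xi> where \<xi>: "\<xi> \<in> characters C'" "\<xi> \<notin> S" using S(2) by blast
    obtain c where c: "c \<in> C'" "\<xi> c = 1" "\<And>\<gamma>. \<gamma> \<in> S \<Longrightarrow> \<gamma> c = 0"
      using commutant.separate_closed[OF S(1) \<xi>] by blast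
    \<comment> \<open>The largest two-sided ideal inside all the left ideals belonging to the points of \<open>S\<close>.\<close>
    define J where "J = {a. \<forall>y. \<forall>\<gamma>\<in>S. a * y \<in> commutant.null_left_ideal \<gamma>}"
    have "two_sided_ideal J"
      unfolding two_sided_ideal_def
    proof (intro conjI ballI allI)
      show "0 \<in> J" unfolding J_def using L(4) commutant.character_zero[OF Sch] by simp
      fix a b assume "a \<in> J" "b \<in> J"
      then show "a + b \<in> J" unfolding J_def by (auto simp: distrib_right intro: L(1))
    next
      fix s a assume "a \<in> J"
      moreover have "scaleC s a * y = scaleC s 1 * (a * y)" for y by (simp add: mult_scaleC_left)
      ultimately show "scaleC s a \<in> J" unfolding J_def by (auto intro: L(2))
    next
      fix x a assume "a \<in> J"
      then show "x * a \<in> J" "a * x \<in> J" unfolding J_def by (auto simp: mult.assoc intro: L(2))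
    qed
    moreover have "c \<in> J"
      unfolding J_def
    proof (intro CollectI allI ballI)
      fix y \<gamma> assume \<gamma>: "\<gamma> \<in> S"
      have term_in: "c * (\<pi> f * U n) \<in> commutant.null_left_ideal \<gamma>" if f: "f \<in> CX X" for f n
      proof -
        define k where "k = c * \<pi> f"
        have k: "k \<in> C'" using c(1) pi_in_commutant[OF f] by (simp add: k_def)
        have t: "translate (- n) \<gamma> \<in> S" using \<gamma> by (rule inv)
        have "translate (- n) \<gamma> k = 0"
          using charactersD(4)[OF Sch[OF t] c(1) pi_in_commutant[OF f]] c(3)[OF t] by (simp add: k_def)
        then have "\<gamma> (U (- n) * k * U n) = 0" using k by (simp add: translate_def)
        then have "U (- n) * k * U n \<in> commutant.null_left_ideal \<gamma>"
          using L(4)[OF \<gamma>] Ad_commutant[OF k, of "- n"] by simp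
        then have "U n * (U (- n) * k * U n) \<in> commutant.null_left_ideal \<gamma>" by (rule L(2)[OF \<gamma>])
        then show ?thesis by (simp add: mult.assoc[symmetric] U_inverse k_def)
      qed
      show "c * y \<in> commutant.null_left_ideal \<gamma>"
      proof (rule L(3)[OF \<gamma>])
        fix \<epsilon> :: real assume "\<epsilon> > 0"
        then have "\<epsilon> / (norm c + 1) > 0" by (simp add: add_nonneg_pos)
        then obtain b where b: "b \<in> conv_carrier X" "norm (IF b - y) < \<epsilon> / (norm c + 1)"
          by (rule exists_approximant)
        have "c * IF b \<in> commutant.null_left_ideal \<gamma>"
          unfolding integrated_form_def sum_distrib_left
          using b(1) by (intro L(5)[OF \<gamma>] term_in) (simp add: conv_carrier_def)
        moreover have "norm (c * y - c * IF b) \<le> \<epsilon>"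
        proof -
          have "norm (c * y - c * IF b) \<le> norm c * norm (IF b - y)"
            using norm_mult_ineq[of c "y - IF b"] by (simp add: right_diff_distrib norm_minus_commute)
          also have "\<dots> \<le> (norm c + 1) * (\<epsilon> / (norm c + 1))" using b(2) by (intro mult_mono) auto
          also have "\<dots> = \<epsilon>" using norm_ge_zero[of c] by (simp add: add_nonneg_eq_0_iff)
          finally show ?thesis .
        qed
        ultimately show "\<exists>z\<in>commutant.null_left_ideal \<gamma>. norm (c * y - z) \<le> \<epsilon>" by blast
      qed
    qed
    moreover have "c \<noteq> 0" using c(2) commutant.character_zero[OF \<xi>(1)] by auto
    ultimately have "J \<inter> B \<noteq> {0}" using ip unfolding intersection_property_def by blast
    moreover have "0 \<in> J \<inter> B" using \<open>two_sided_ideal J\<close> by (auto dest: two_sided_idealD(1))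
    ultimately obtain b where b: "b \<in> J" "b \<in> B" "b \<noteq> 0" by blast
    have "\<gamma> b = 0" if "\<gamma> \<in> S" for \<gamma>
    proof -
      have "b * 1 \<in> commutant.null_left_ideal \<gamma>" using b(1) that unfolding J_def by blast
      then show ?thesis using L(4)[OF that] b(2) B_subset by auto
    qed
    then have "\<xi>' b = 0" if "\<xi>' \<in> characters B" for \<xi>' using that b(2) unfolding eq[symmetric] by auto
    then have "b = 0"
      by (intro B.eq_if_characters_eq) (use b in \<open>simp_all add: B.character_zero\<close>)
    with b(3) show False by simp
  qed
qed

text \<open>Let \<open>S\<close> be the zero set of \<open>J \<inter> C'\<close>, a proper subset because \<open>J\<close> meets the commutant. If \<open>J\<close> met \<open>B\<close>
  only in zero, every character \<open>\<xi>\<close> of \<open>B\<close> would extend to a point of \<open>S\<close>. The extension is a character that is unimodular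
  on the set \<open>E\<close> below. Elements of \<open>E\<close> have norm one: high powers of a smaller one would be small, while
  modulo \<open>J\<close> they agree with powers of an element of \<open>B\<close>, which have norm at least one.\<close>

lemma intersection_property_if_restriction_proper:
  assumes proper: "\<And>S. \<lbrakk>closedin (spectrum C') S; S \<subset> characters C'; \<And>n \<gamma>. \<gamma> \<in> S \<Longrightarrow> translate n \<gamma> \<in> S\<rbrakk> \<Longrightarrow>
      (\<lambda>\<gamma>. restrict \<gamma> B) ` S \<subset> characters B"
  shows "intersection_property B"
  unfolding intersection_property_def
proof (intro allI impI notI, elim conjE)
  fix J assume J: "two_sided_ideal J" "J \<noteq> {0}" and JB: "J \<inter> B = {0}"
  note JD = two_sided_idealD[OF J(1)] two_sided_ideal_minus[OF J(1)]
  define S where "S = {\<gamma> \<in> characters C'. \<forall>i\<in>J \<inter> C'. \<gamma> i = 0}"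
  have zero: "0 \<in> J \<inter> C'" using JD(1) by simp
  then obtain i0 where i0: "i0 \<in> J \<inter> C'" "i0 \<noteq> 0" using ideal_meets_commutant[OF J] by blast
  have "(\<lambda>\<gamma>. restrict \<gamma> B) ` S \<subset> characters B"
  proof (rule proper)
    show "closedin (spectrum C') S"
      unfolding S_def by (rule commutant.closedin_vanishing) (use zero in blast)+
    obtain \<gamma> where \<gamma>: "\<gamma> \<in> characters C'" "cmod (\<gamma> i0) = norm i0"
      using commutant.exists_norming_character[of i0] i0 by blast
    then have "\<gamma> i0 \<noteq> 0" using i0(2) by auto
    then have "\<gamma> \<notin> S" using i0(1) unfolding S_def by blast
    with \<gamma>(1) show "S \<subset> characters C'" by (auto simp: S_def)
    fix n \<gamma> assume \<gamma>: "\<gamma> \<in> S"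
    have "translate n \<gamma> i = 0" if "i \<in> J \<inter> C'" for i
    proof -
      have "U n * i * U (- n) \<in> J \<inter> C'" using that JD(4,5) Ad_commutant by blast
      then show ?thesis using \<gamma> that by (simp add: S_def translate_def)
    qed
    then show "translate n \<gamma> \<in> S" using \<gamma> translate_in by (simp add: S_def)
  qed
  then obtain \<xi> where \<xi>: "\<xi> \<in> characters B" "\<xi> \<notin> (\<lambda>\<gamma>. restrict \<gamma> B) ` S" by blast
  \<comment> \<open>Modulo \<open>J\<close> these elements are peaks at \<open>\<xi>\<close>. A character that is unimodular on all of them extends
    \<open>\<xi>\<close> and annihilates \<open>J \<inter> C'\<close>.\<close>
  define E where "E = {e \<in> C'. adj e = e \<and> norm e \<le> 1 \<and> (\<exists>b\<in>B. \<xi> b = 1 \<and> e - b \<in> J)}"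
  have E_norm: "norm e = 1" if "e \<in> E" for e
  proof (rule ccontr)
    assume "norm e \<noteq> 1"
    then have "norm e < 1" using that by (simp add: E_def)
    then have "(\<lambda>n. norm e ^ n) \<longlonglongrightarrow> 0" by (intro LIMSEQ_realpow_zero) auto
    then have "\<forall>\<^sub>F n in sequentially. norm e ^ n < 1/2" by (rule order_tendstoD) simp
    then obtain n where n: "norm e ^ n < 1/2" by (auto simp: eventually_sequentially)
    obtain b where b: "b \<in> B" "\<xi> b = 1" "e - b \<in> J" using \<open>e \<in> E\<close> by (auto simp: E_def)
    have "e ^ m - b ^ m \<in> J" for m
    proof (induction m)
      case (Suc m)
      have "e ^ Suc m - b ^ Suc m = e * (e ^ m - b ^ m) + (e - b) * b ^ m" by (simp add: algebra_simps)
      then show ?case using JD(2)[OF JD(4)[OF Suc] JD(5)[OF b(3)]] by simp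
    qed (simp add: JD(1))
    then have j: "b ^ n - e ^ n \<in> J" using JD(6)[of "e ^ n - b ^ n"] by simp
    have "norm (b ^ n - (b ^ n - e ^ n)) < 1/2" using n norm_power_le[of e n] by simp
    moreover have "1 \<le> norm (b ^ n)"
      using B.character_norm_le[OF \<xi>(1), of "b ^ n"] b by (simp add: B.character_power[OF \<xi>(1)])
    ultimately have "norm (b ^ n - (b ^ n - e ^ n)) < norm (b ^ n) / 2" by linarith
    from B.ideal_near_element_meets[OF J(1) j _ this] JB b(1) show False by simp
  qed
  have E_mult: "e * f \<in> E" if ef: "e \<in> E" "f \<in> E" for e f
  proof -
    obtain b d where b: "b \<in> B" "\<xi> b = 1" "e - b \<in> J" and d: "d \<in> B" "\<xi> d = 1" "f - d \<in> J"
      using ef by (auto simp: E_def)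
    have "e * f - b * d = e * (f - d) + (e - b) * d" by (simp add: algebra_simps)
    then have "e * f - b * d \<in> J" using JD(2)[OF JD(4)[OF d(3)] JD(5)[OF b(3)]] by simp
    moreover have "b * d \<in> B" "\<xi> (b * d) = 1" using b d charactersD(4)[OF \<xi>(1)] by auto
    moreover have "norm (e * f) \<le> 1"
      using norm_mult_ineq[of e f] E_norm[OF ef(1)] E_norm[OF ef(2)] by simp
    moreover have "e * f \<in> C'" "adj (e * f) = e * f"
      using ef commutant_commutative by (auto simp: E_def adj_mult)
    ultimately show ?thesis by (auto simp: E_def)
  qed
  have "(1::'a) - 1 \<in> J" using JD(1) by simp
  then have "1 \<in> E"
    unfolding E_def using norm_one_le[where 'a='a] B.character_one[OF \<xi>(1)] adj_one one_in_commutant B.one_mem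
    by blast
  then have "E \<noteq> {}" by blast
  moreover have "e \<in> C' \<and> adj e = e \<and> norm e = 1" if "e \<in> E" for e
    using that E_norm[OF that] by (simp add: E_def)
  ultimately obtain \<gamma> where \<gamma>: "\<gamma> \<in> characters C'" "\<And>e. e \<in> E \<Longrightarrow> cmod (\<gamma> e) = 1"
    using commutant.exists_character[of E] E_mult by blast
  have "\<gamma> i = 0" if i: "i \<in> J \<inter> C'" for i
  proof -
    have "i \<in> C'" using i by blast
    from commutant.exists_resolvent[OF this]
    obtain e where e: "e \<in> C'" "adj e = e" "norm e \<le> 1" "e + e * (adj i * i) = 1" by blast
    have "e * (adj i * i) \<in> J" using JD(4) i by blast
    then have "e - (e + e * (adj i * i)) \<in> J" using JD(6) by simp
    then have "e - 1 \<in> J" by (simp only: e(4))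
    then have "e \<in> E"
      unfolding E_def using e(1-3) B.character_one[OF \<xi>(1)] by blast
    then show ?thesis using commutant.unimodular_resolvent[OF \<gamma>(1) e(1) \<open>i \<in> C'\<close> e(4)] \<gamma>(2) by blast
  qed
  then have "\<gamma> \<in> S" using \<gamma>(1) by (simp add: S_def)
  have ker: "\<gamma> k = 0" if k: "k \<in> B" "\<xi> k = 0" for k
  proof -
    from B.exists_resolvent[OF k(1)]
    obtain e where e: "e \<in> B" "adj e = e" "norm e \<le> 1" "e + e * (adj k * k) = 1" by blast
    have "\<xi> e = 1" "e - e \<in> J"
      using B.character_resolvent[OF \<xi>(1) e(1) k(1) e(4)] k(2) JD(1) by simp_all
    moreover have eC: "e \<in> C'" "k \<in> C'" using e(1) k(1) B_subset by blast+
    ultimately have "e \<in> E" unfolding E_def using e(1-3) by blast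
    then show ?thesis using commutant.unimodular_resolvent[OF \<gamma>(1) eC e(4)] \<gamma>(2) by blast
  qed
  have "restrict \<gamma> B = \<xi>"
  proof
    fix b
    show "restrict \<gamma> B b = \<xi> b"
    proof (cases "b \<in> B")
      case True
      define k where "k = b - scaleC (\<xi> b) 1"
      have "\<gamma> k = 0" using True by (intro ker) (auto simp: k_def B.character_diff[OF \<xi>(1)] charactersD(3)[OF \<xi>(1)] B.character_one[OF \<xi>(1)])
      moreover have "\<gamma> k = \<gamma> b - \<xi> b"
        using True B_subset by (auto simp: k_def commutant.character_diff[OF \<gamma>(1)] charactersD(3)[OF \<gamma>(1)] commutant.character_one[OF \<gamma>(1)])
      ultimately show ?thesis using True by simp
    qed (use charactersD(1)[OF \<xi>(1)] in \<open>simp add: extensional_def\<close>)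
  qed
  with \<xi>(2) \<open>\<gamma> \<in> S\<close> show False by blast
qed

end

theorem proposition5p1:
  fixes X :: "'x topology" and \<sigma> :: "'x \<Rightarrow> 'x"
    and \<pi> :: "('x \<Rightarrow> complex) \<Rightarrow> 'a::unital_cstar_algebra" and \<delta> :: 'a
    and B C' :: "'a set"
    and \<Delta> \<Gamma> :: "('a \<Rightarrow> complex) topology"
    and \<sigma>t :: "('a \<Rightarrow> complex) \<Rightarrow> ('a \<Rightarrow> complex)"
  assumes "topological_dynamical_system X \<sigma>"
    and "cstar_crossed_product X \<sigma> \<pi> \<delta>"
    and "cstar_subalgebra B"
  defines "C' \<equiv> commutant (\<pi> ` CX X)"
  assumes "\<pi> ` CX X \<subseteq> B" and "B \<subseteq> C'"
  defines "\<Delta> \<equiv> spectrum B" and "\<Gamma> \<equiv> spectrum C'"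
    and "\<sigma>t \<equiv> spectrum_map \<delta> C'"
  shows "intersection_property B \<longleftrightarrow>
    (\<forall>S. closedin \<Gamma> S \<and> S \<subset> topspace \<Gamma> \<and>
         \<sigma>t ` S \<subseteq> S \<and> inv_into (topspace \<Gamma>) \<sigma>t ` S \<subseteq> S \<longrightarrow>
         (\<lambda>\<gamma>. restrict \<gamma> B) ` S \<subset> topspace \<Delta>)"
proof -
  interpret T: topological_dynamical_system X \<sigma> by fact
  interpret P: cstar_crossed_product X \<sigma> \<pi> \<delta> by fact
  interpret intermediate_subalgebra X \<sigma> \<pi> \<delta> B
  proof unfold_locales
    show "\<pi> ` CX X \<subseteq> B" by fact
    show "B \<subseteq> commutant (\<pi> ` CX X)" using assms by simp
    show "cstar_subalgebra B" by fact
  qed (fact P.pi_add P.pi_scale P.pi_mult P.pi_adj P.pi_one P.unitary P.covariant P.pi_inj P.dense P.universal)+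
  have top: "topspace \<Gamma> = characters C'" "topspace \<Delta> = characters B"
    by (simp_all only: \<Gamma>_def \<Delta>_def topspace_spectrum)
  have inv: "(\<sigma>t ` S \<subseteq> S \<and> inv_into (topspace \<Gamma>) \<sigma>t ` S \<subseteq> S) = (\<forall>n. \<forall>\<gamma>\<in>S. translate n \<gamma> \<in> S)"
    if "S \<subset> topspace \<Gamma>" for S
    using invariant_iff_translate[folded C'_def, of S] that unfolding \<sigma>t_def top by (simp only: psubset_imp_subset)
  show ?thesis
  proof (intro iffI allI impI; (elim conjE)?)
    fix S
    assume ip: "intersection_property B" and S: "closedin \<Gamma> S" "S \<subset> topspace \<Gamma>"
      and stable: "\<sigma>t ` S \<subseteq> S" "inv_into (topspace \<Gamma>) \<sigma>t ` S \<subseteq> S"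
    have translates: "\<forall>n. \<forall>\<gamma>\<in>S. translate n \<gamma> \<in> S" using inv[OF S(2)] stable by simp
    show "(\<lambda>\<gamma>. restrict \<gamma> B) ` S \<subset> topspace \<Delta>"
      unfolding top
    proof (rule restriction_proper_if_intersection_property[folded C'_def, OF ip])
      show "closedin (spectrum C') S" using S(1) by (simp only: \<Gamma>_def)
      show "S \<subset> characters C'" using S(2) by (simp only: top)
      show "translate n \<gamma> \<in> S" if "\<gamma> \<in> S" for n \<gamma>
        using translates that by blast
    qed
  next
    assume proper: "\<forall>S. closedin \<Gamma> S \<and> S \<subset> topspace \<Gamma> \<and>
         \<sigma>t ` S \<subseteq> S \<and> inv_into (topspace \<Gamma>) \<sigma>t ` S \<subseteq> S \<longrightarrow>
         (\<lambda>\<gamma>. restrict \<gamma> B) ` S \<subset> topspace \<Delta>"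
    show "intersection_property B"
    proof (rule intersection_property_if_restriction_proper[folded C'_def])
      fix S assume S: "closedin (spectrum C') S" "S \<subset> characters C'"
        and stable: "\<And>n \<gamma>. \<gamma> \<in> S \<Longrightarrow> translate n \<gamma> \<in> S"
      have sub: "S \<subset> topspace \<Gamma>" using S(2) by (simp only: top)
      have "\<forall>n. \<forall>\<gamma>\<in>S. translate n \<gamma> \<in> S" using stable by blast
      then have "closedin \<Gamma> S \<and> S \<subset> topspace \<Gamma> \<and> \<sigma>t ` S \<subseteq> S \<and> inv_into (topspace \<Gamma>) \<sigma>t ` S \<subseteq> S"
        unfolding inv[OF sub] using S(1) sub by (simp only: \<Gamma>_def) 
      from mp[OF spec[OF proper] this]
      show "(\<lambda>\<gamma>. restrict \<gamma> B) ` S \<subset> characters B" by (simp only: top)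
    qed
  qed
qed

end
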